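(* Let $K$ be a bounded convex symmetric domain in $\mathbb{R}^2$ that is not a parallelogram. Then there exists an irreducible bounded convex symmetric domain $H\subset\mathbb{R}^2$, not a parallelogram, such that $\mathcal{L}(H)$ is an embedded circle in $X_2$ (i.e. $\mathcal{L}(H)$ is homeomorphic to $\mathbb{S}^1$) and $\mathcal{L}(K)$ is a closed subset of $\mathcal{L}(H)$.
   Context: A domain in $\mathbb{R}^2$ is a non-empty connected open set; a domain $K$ is symmetric if $K=-K$ (symmetric about the origin). A lattice in $\mathbb{R}^2$ is a set of the form $\Lambda=g\mathbb{Z}^2$ with $g\in\operatorname{GL}_2(\mathbb{R})$; its covolume is $d(\Lambda)=|\det g|$, which is independent of the choice of $g$. The space $X_2$ of all lattices in $\mathbb{R}^2$ is identified with $\operatorname{GL}_2(\mathbb{R})/\operatorname{GL}_2(\mathbb{Z})$ and carries the quotient topology. Let $K$ be a bounded convex symmetric domain in $\mathbb{R}^2$. A lattice $\Lambda$ is $K$-admissible if $\Lambda\cap K=\{0\}$. The critical determinant of $K$ is $\Delta(K)=\inf\{d(\Lambda):\Lambda \text{ is } K\text{-admissible}\}$. A lattice is $K$-critical if it is $K$-admissible and $d(\Lambda)=\Delta(K)$. The critical locus $\mathcal{L}(K)\subset X_2$ is the set of all $K$-critical lattices, with the subspace topology. A bounded convex symmetric domain $H$ is irreducible if every bounded convex symmetric domain $H'\subsetneq H$ satisfies $\Delta(H')<\Delta(H)$. *)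

theory Defs
  imports "HOL-Analysis.Analysis"
begin

definition integer_points :: "(real^2) set" where
  "integer_points = {z. \<forall>i. z $ i \<in> \<int>}"

definition GL2 :: "(real^2^2) set" where
  "GL2 = {g. invertible g}"

definition lattice_of :: "real^2^2 \<Rightarrow> (real^2) set" where
  "lattice_of g = (\<lambda>z. g *v z) ` integer_points"

definition is_lattice :: "(real^2) set \<Rightarrow> bool" where
  "is_lattice L \<longleftrightarrow> (\<exists>g\<in>GL2. L = lattice_of g)"

text \<open>The choice of \<open>g\<close> is immaterial; see \<open>covolume_lattice_of\<close> below.\<close>

definition covolume :: "(real^2) set \<Rightarrow> real" where
  "covolume L = \<bar>det (SOME g. g \<in> GL2 \<and> L = lattice_of g)\<bar>"

lemma abs_det_le_of_lattice_of_eq: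
  assumes g: "g \<in> GL2" and eq: "lattice_of g = lattice_of h"
  shows "\<bar>det h\<bar> \<le> \<bar>det g\<bar>"
proof -
  have "\<exists>z. z \<in> integer_points \<and> g *v axis j 1 = h *v z" for j
  proof -
    have "axis j 1 \<in> integer_points"
      by (simp add: integer_points_def axis_def)
    then have "g *v axis j 1 \<in> lattice_of g"
      unfolding lattice_of_def by blast
    then have "g *v axis j 1 \<in> lattice_of h"
      unfolding eq .
    then show ?thesis
      unfolding lattice_of_def by blast
  qed
  then obtain z where z: "\<And>j. z j \<in> integer_points" "\<And>j. g *v axis j 1 = h *v z j"
    by metis
  define A :: "real^2^2" where "A = (\<chi> i j. z j $ i)"
  have "g $ i $ j = (h ** A) $ i $ j" for i j
  proof -
    have "g $ i $ j = (g *v axis j 1) $ i"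
      by (simp add: matrix_vector_mult_basis column_def)
    also have "\<dots> = (h ** A) $ i $ j"
      unfolding z(2) by (simp add: matrix_vector_mult_def matrix_matrix_mult_def A_def)
    finally show ?thesis .
  qed
  then have "g = h ** A"
    by (simp add: vec_eq_iff)
  then have dg: "det g = det h * det A"
    by (simp add: det_mul)
  have "det A \<in> \<int>"
    using z(1) unfolding det_2 A_def integer_points_def
    by (auto intro!: Ints_diff Ints_mult)
  moreover have "det A \<noteq> 0"
    using g dg unfolding GL2_def by (auto simp: invertible_det_nz)
  ultimately have "1 \<le> \<bar>det A\<bar>"
    by (rule Ints_nonzero_abs_ge1)
  then show ?thesis
    unfolding dg abs_mult by (simp add: mult_le_cancel_left1)
qed

lemma covolume_lattice_of:
  assumes "g \<in> GL2"
  shows "covolume (lattice_of g) = \<bar>det g\<bar>"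
proof -
  define h where "h = (SOME h. h \<in> GL2 \<and> lattice_of g = lattice_of h)"
  have "h \<in> GL2 \<and> lattice_of g = lattice_of h"
    unfolding h_def by (rule someI[of _ g]) (use assms in auto)
  then have "\<bar>det h\<bar> = \<bar>det g\<bar>"
    using abs_det_le_of_lattice_of_eq[of g h] abs_det_le_of_lattice_of_eq[of h g] assms by auto
  then show ?thesis
    unfolding covolume_def h_def by simp
qed

text \<open>The fibres of \<open>lattice_of\<close> on \<open>GL2\<close> are the left cosets of the group of integral
  matrices of determinant \<open>1\<close> or \<open>-1\<close>, so the quotient topology is carried directly by the set of all lattices.\<close>

definition lattice_space :: "(real^2) set topology" where
  "lattice_space = topology (\<lambda>U. U \<subseteq> Collect is_lattice \<and>
     openin (top_of_set GL2) {g \<in> GL2. lattice_of g \<in> U})"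

lemma openin_lattice_space:
  "openin lattice_space U \<longleftrightarrow> U \<subseteq> Collect is_lattice \<and>
     openin (top_of_set GL2) {g \<in> GL2. lattice_of g \<in> U}"
proof -
  have "istopology (\<lambda>U. U \<subseteq> Collect is_lattice \<and>
     openin (top_of_set GL2) {g \<in> GL2. lattice_of g \<in> U})" (is "istopology ?P")
    unfolding istopology_def
  proof (intro conjI allI impI; (elim conjE)?)
    fix S T
    assume "openin (top_of_set GL2) {g \<in> GL2. lattice_of g \<in> S}"
      and "openin (top_of_set GL2) {g \<in> GL2. lattice_of g \<in> T}"
    then have "openin (top_of_set GL2)
        ({g \<in> GL2. lattice_of g \<in> S} \<inter> {g \<in> GL2. lattice_of g \<in> T})"
      by (rule openin_Int)
    also have "{g \<in> GL2. lattice_of g \<in> S} \<inter> {g \<in> GL2. lattice_of g \<in> T} =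
        {g \<in> GL2. lattice_of g \<in> S \<inter> T}"
      by blast
    finally show "openin (top_of_set GL2) {g \<in> GL2. lattice_of g \<in> S \<inter> T}" .
  next
    fix \<K> assume "\<forall>K\<in>\<K>. ?P K"
    then have "openin (top_of_set GL2) (\<Union>K\<in>\<K>. {g \<in> GL2. lattice_of g \<in> K})"
      by (intro openin_Union) auto
    also have "(\<Union>K\<in>\<K>. {g \<in> GL2. lattice_of g \<in> K}) = {g \<in> GL2. lattice_of g \<in> \<Union>\<K>}"
      by blast
    finally show "openin (top_of_set GL2) {g \<in> GL2. lattice_of g \<in> \<Union>\<K>}" .
  qed blast+
  then show ?thesis
    unfolding lattice_space_def by (simp add: topology_inverse')
qed

lemma topspace_lattice_space: "topspace lattice_space = Collect is_lattice"
proof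
  show "topspace lattice_space \<subseteq> Collect is_lattice"
    unfolding topspace_def by (auto simp: openin_lattice_space)
  have "{g \<in> GL2. lattice_of g \<in> Collect is_lattice} = GL2"
    by (auto simp: is_lattice_def)
  then have "openin lattice_space (Collect is_lattice)"
    by (simp add: openin_lattice_space)
  then show "Collect is_lattice \<subseteq> topspace lattice_space"
    by (rule openin_subset)
qed

lemma quotient_map_lattice_of: "quotient_map (top_of_set GL2) lattice_space lattice_of"
  unfolding quotient_map_def
  by (auto simp: topspace_lattice_space openin_lattice_space is_lattice_def)

text \<open>\<open>connected\<close> is implied by \<open>convex\<close>; it is kept because a domain is a non-empty connected
  open set.\<close>

definition symmetric_domain :: "(real^2) set \<Rightarrow> bool" where
  "symmetric_domain K \<longleftrightarrow> open K \<and> connected K \<and> K \<noteq> {} \<and> uminus ` K = K"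

definition bcs_domain :: "(real^2) set \<Rightarrow> bool" where
  "bcs_domain K \<longleftrightarrow> symmetric_domain K \<and> bounded K \<and> convex K"

definition admissible :: "(real^2) set \<Rightarrow> (real^2) set \<Rightarrow> bool" where
  "admissible K L \<longleftrightarrow> is_lattice L \<and> L \<inter> K = {0}"

definition critical_determinant :: "(real^2) set \<Rightarrow> real" where
  "critical_determinant K = Inf {covolume L |L. admissible K L}"

definition critical_locus :: "(real^2) set \<Rightarrow> (real^2) set set" where
  "critical_locus K = {L. admissible K L \<and> covolume L = critical_determinant K}"

definition irreducible_domain :: "(real^2) set \<Rightarrow> bool" where
  "irreducible_domain H \<longleftrightarrow> bcs_domain H \<and>
     (\<forall>H'. bcs_domain H' \<and> H' \<subset> H \<longrightarrow> critical_determinant H' < critical_determinant H)"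

text \<open>Domains are open, so the relevant parallelograms are open and non-degenerate.\<close>

definition parallelogram :: "(real^2) set \<Rightarrow> bool" where
  "parallelogram P \<longleftrightarrow> (\<exists>c u v. u \<noteq> v \<and> independent {u, v} \<and>
     P = {c + s *\<^sub>R u + t *\<^sub>R v |s t. 0 < s \<and> s < 1 \<and> 0 < t \<and> t < 1})"

end

theory Submission
  imports Defs
begin

text \<open>
  Let \<open>N\<close> be the Minkowski functional of a bounded convex symmetric domain \<open>H\<close>
  and \<open>\<Delta>\<close> its critical determinant. Everything rests on inscribed affinely regular
  hexagons, that is on pairs \<open>p\<close>, \<open>q\<close> such that \<open>p\<close>,
  \<open>q\<close> and \<open>q - p\<close> have norm \<open>1\<close> (\<open>hexad\<close>). The
  lattice that they span is admissible (\<open>hexad_admissible\<close>), each boundary point is a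
  vertex of such a hexagon (\<open>exists_hexad\<close>), and an admissible lattice has at least the
  covolume of the hexagon over its shortest vector, rescaled to the boundary, because otherwise the next
  row of lattice points would cross a chord of \<open>H\<close> longer than the row spacing
  (\<open>row_meets_body\<close>). Thus \<open>\<Delta>\<close> is the minimum of the determinant over
  the compact set of hexagons.

  If \<open>H\<close> is not a parallelogram, a critical hexagon is determined by one vertex, and the
  critical lattices are exactly the lattices of critical hexagons. A failure would place an edge of the
  boundary at the height of \<open>q\<close>, parallel to \<open>p\<close> and at least as long; sliding
  a vertex around the end of this edge lowers the determinant unless the edge has twice the length of
  \<open>p\<close>, and then \<open>H\<close> is a parallelogram
  (\<open>flat_imp_parallelogram\<close>). The map taking a vertex of a critical hexagon to the next one
  therefore is well defined; it preserves the cyclic order (\<open>critical_hexad_sector_step\<close>),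
  since a nested pair of critical hexagons is excluded by a computation with a two-by-two determinant
  (\<open>critical_hexad_nested\<close>).

  If \<open>H\<close> is moreover irreducible, each boundary point is a vertex of a critical hexagon.
  Cutting off a small cap shows that every cap of the boundary contains critical vertices
  (\<open>irreducible_no_gap\<close>), so a boundary arc free of them is a segment, and so are its two
  successors under rotation. Along three such segments the determinant of the interpolated hexagons
  cannot exceed \<open>\<Delta>\<close>, so these hexagons are critical (\<open>all_critical\<close>).
  Moving a vertex along the boundary from \<open>p\<close> to the next vertex \<open>q\<close> then
  describes each critical lattice once, closing up at \<open>q\<close>; as the space of lattices is a
  Hausdorff space, the critical locus is a circle (\<open>critical_locus_circle\<close>).

  For a given \<open>K\<close>, a minimal domain \<open>H\<close> inside \<open>K\<close> with the same
  critical determinant is irreducible and exists by Zorn's lemma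
  (\<open>exists_irreducible_subdomain\<close>). It is not a parallelogram unless \<open>K\<close> is
  (\<open>parallelogram_if_contains_parallelogram\<close>). A critical lattice of \<open>K\<close> is
  critical for \<open>H\<close>, and \<open>K\<close>-admissibility is a closed condition, so the
  critical locus of \<open>K\<close> is closed in that of \<open>H\<close>.
\<close>

section \<open>Plane lattices spanned by two vectors\<close>

definition cross2 :: "real^2 \<Rightarrow> real^2 \<Rightarrow> real" where
  "cross2 p q = p$1 * q$2 - p$2 * q$1"

lemma cross2_algebra:
  "cross2 (p + p') q = cross2 p q + cross2 p' q" "cross2 (p - p') q = cross2 p q - cross2 p' q"
  "cross2 p (q + q') = cross2 p q + cross2 p q'" "cross2 p (q - q') = cross2 p q - cross2 p q'"
  "cross2 (a *\<^sub>R p) q = a * cross2 p q" "cross2 p (a *\<^sub>R q) = a * cross2 p q"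
  "cross2 (- p) q = - cross2 p q" "cross2 p (- q) = - cross2 p q"
  "cross2 p p = 0" "cross2 0 q = 0" "cross2 p 0 = 0"
  by (simp_all add: cross2_def algebra_simps)

lemma cross2_swap: "cross2 q p = - cross2 p q"
  by (simp add: cross2_def)

lemma cross2_cramer:
  assumes "cross2 p q \<noteq> 0"
  shows "x = (cross2 x q / cross2 p q) *\<^sub>R p + (cross2 p x / cross2 p q) *\<^sub>R q"
  using assms unfolding cross2_def
  by (simp add: vec_eq_iff forall_2 divide_simps) (simp add: algebra_simps)

lemma cross2_basis_unique:
  assumes "cross2 p q \<noteq> 0" "a *\<^sub>R p + b *\<^sub>R q = c *\<^sub>R p + d *\<^sub>R q"
  shows "a = c" "b = d"
proof -
  have "cross2 (a *\<^sub>R p + b *\<^sub>R q) q = cross2 (c *\<^sub>R p + d *\<^sub>R q) q"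
    "cross2 p (a *\<^sub>R p + b *\<^sub>R q) = cross2 p (c *\<^sub>R p + d *\<^sub>R q)"
    using assms(2) by simp_all
  then show "a = c" "b = d" using assms(1) by (simp_all add: cross2_algebra)
qed

lemma continuous_on_cross2 [continuous_intros]:
  "continuous_on S f \<Longrightarrow> continuous_on S g \<Longrightarrow> continuous_on S (\<lambda>x. cross2 (f x) (g x))"
  unfolding cross2_def by (intro continuous_intros)

definition lat :: "real^2 \<Rightarrow> real^2 \<Rightarrow> (real^2) set" where
  "lat p q = {of_int m *\<^sub>R p + of_int n *\<^sub>R q |m n. True}"

lemma lat_mem [intro]: "of_int m *\<^sub>R p + of_int n *\<^sub>R q \<in> lat p q"
  unfolding lat_def by blast

text \<open>Every element of \<open>GL2\<close> has this form, which turns statements about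
  \<open>lattice_of\<close> into statements about two spanning vectors.\<close>

definition cols :: "real^2 \<Rightarrow> real^2 \<Rightarrow> real^2^2" where
  "cols p q = (\<chi> i j. if j = 1 then p $ i else q $ i)"

lemma lattice_of_cols: "lattice_of (cols p q) = lat p q"
proof -
  have mult: "cols p q *v z = z$1 *\<^sub>R p + z$2 *\<^sub>R q" for z
    by (simp add: vec_eq_iff matrix_vector_mult_def cols_def sum_2)
  show ?thesis
  proof (intro set_eqI iffI)
    fix x assume "x \<in> lattice_of (cols p q)"
    then obtain z :: "real^2" where z: "z$1 \<in> \<int>" "z$2 \<in> \<int>" "x = z$1 *\<^sub>R p + z$2 *\<^sub>R q"
      unfolding lattice_of_def integer_points_def by (auto simp: mult)
    then show "x \<in> lat p q" by (metis Ints_cases lat_mem)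
  next
    fix x assume "x \<in> lat p q"
    then obtain m n where x: "x = of_int m *\<^sub>R p + of_int n *\<^sub>R q" unfolding lat_def by auto
    define z :: "real^2" where "z = vector [of_int m, of_int n]"
    have "z \<in> integer_points" by (simp add: integer_points_def z_def forall_2)
    moreover have "x = cols p q *v z" by (simp add: mult x z_def)
    ultimately show "x \<in> lattice_of (cols p q)" unfolding lattice_of_def by blast
  qed
qed

lemma det_cols: "det (cols p q) = cross2 p q"
  by (simp add: det_2 cols_def cross2_def)

lemma cols_GL2: "cols p q \<in> GL2 \<longleftrightarrow> cross2 p q \<noteq> 0"
  by (simp add: GL2_def invertible_det_nz det_cols)

lemma cols_surj: "\<exists>p q. g = cols p q"
  by (rule exI[of _ "column 1 g"], rule exI[of _ "column 2 g"])
     (simp add: cols_def column_def vec_eq_iff forall_2)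

lemma columns_cols [simp]: "column 1 (cols p q) = p" "column 2 (cols p q) = q"
  by (simp_all add: cols_def column_def vec_eq_iff)

lemma lattice_of_columns: "lattice_of g = lat (column 1 g) (column 2 g)"
  using cols_surj[of g] by (auto simp: lattice_of_cols)

lemma GL2_columns: "g \<in> GL2 \<longleftrightarrow> cross2 (column 1 g) (column 2 g) \<noteq> 0"
  using cols_surj[of g] by (auto simp: cols_GL2)

lemma is_lattice_lat: "cross2 p q \<noteq> 0 \<Longrightarrow> is_lattice (lat p q)"
  unfolding is_lattice_def using cols_GL2 lattice_of_cols by blast

lemma covolume_lat: "cross2 p q \<noteq> 0 \<Longrightarrow> covolume (lat p q) = \<bar>cross2 p q\<bar>"
  using covolume_lattice_of[of "cols p q"] by (simp add: cols_GL2 lattice_of_cols det_cols)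

lemma is_latticeE:
  assumes "is_lattice L"
  obtains p q where "cross2 p q \<noteq> 0" "L = lat p q"
  using assms unfolding is_lattice_def by (metis cols_GL2 cols_surj lattice_of_cols)

lemma zero_in_lat: "0 \<in> lat p q"
  using lat_mem[of 0 p 0 q] by simp

lemma gens_in_lat: "p \<in> lat p q" "q \<in> lat p q"
  using lat_mem[of 1 p 0 q] lat_mem[of 0 p 1 q] by simp_all

lemma lat_combination:
  assumes "x \<in> lat p q" "y \<in> lat p q"
  shows "of_int m *\<^sub>R x + of_int n *\<^sub>R y \<in> lat p q"
proof -
  obtain a b c d where "x = of_int a *\<^sub>R p + of_int b *\<^sub>R q" "y = of_int c *\<^sub>R p + of_int d *\<^sub>R q"
    using assms unfolding lat_def by auto
  then have "of_int m *\<^sub>R x + of_int n *\<^sub>R y = of_int (m*a+n*c) *\<^sub>R p + of_int (m*b+n*d) *\<^sub>R q"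
    by (simp add: algebra_simps)
  then show ?thesis by (metis lat_mem)
qed

lemma lat_subset: "x \<in> lat p q \<Longrightarrow> y \<in> lat p q \<Longrightarrow> lat x y \<subseteq> lat p q"
  using lat_combination unfolding lat_def[of x y] by blast

text \<open>Passing from one pair of consecutive hexagon vertices to the next does not change the
  lattice.\<close>

lemma lat_rotate: "lat q (q - p) = lat p q"
proof
  show "lat q (q - p) \<subseteq> lat p q"
    using lat_combination[OF gens_in_lat(1) gens_in_lat(2), where p=p and q=q and m="-1" and n=1] by (intro lat_subset) (auto simp: gens_in_lat)
  show "lat p q \<subseteq> lat q (q - p)"
    using lat_combination[OF gens_in_lat(1) gens_in_lat(2), where p=q and q="q-p" and m=1 and n="-1"] by (intro lat_subset) (auto simp: gens_in_lat)
qed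

lemma lat_uminus: "lat p (- q) = lat p q"
proof -
  have "lat p (- q) \<subseteq> lat p q" for q
    using lat_combination[OF gens_in_lat(1) gens_in_lat(2), where p=p and q=q and m="0" and n="-1"] by (intro lat_subset) (auto simp: gens_in_lat)
  from this[of q] this[of "-q"] show ?thesis by auto
qed

lemma lat_shear: "lat p (q + of_int k *\<^sub>R p) = lat p q"
proof -
  have "lat p (q + of_int k *\<^sub>R p) \<subseteq> lat p q" for q k
    using lat_combination[OF gens_in_lat(1) gens_in_lat(2), where p=p and q=q and m=k and n=1]
    by (intro lat_subset) (auto simp: gens_in_lat add.commute)
  from this[of q k] this[of "q + of_int k *\<^sub>R p" "-k"] show ?thesis by auto
qed

lemma lat_scale: "c \<noteq> 0 \<Longrightarrow> z \<in> lat (c *\<^sub>R p) (c *\<^sub>R q) \<longleftrightarrow> inverse c *\<^sub>R z \<in> lat p q"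
proof -
  assume c: "c \<noteq> 0"
  have "z = of_int m *\<^sub>R c *\<^sub>R p + of_int n *\<^sub>R c *\<^sub>R q \<longleftrightarrow>
      inverse c *\<^sub>R z = of_int m *\<^sub>R p + of_int n *\<^sub>R q" for m n
    using c by (simp add: vec_eq_iff forall_2 field_simps)
  then show ?thesis unfolding lat_def by auto
qed

lemma abs_cross2_le: "\<bar>cross2 x y\<bar> \<le> 2 * norm x * norm y"
proof -
  have "\<bar>cross2 x y\<bar> \<le> \<bar>x$1\<bar>*\<bar>y$2\<bar> + \<bar>x$2\<bar>*\<bar>y$1\<bar>"
    unfolding cross2_def by (metis abs_mult abs_triangle_ineq4)
  also have "\<dots> \<le> norm x * norm y + norm x * norm y"
    by (intro add_mono mult_mono component_le_norm_cart) auto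
  finally show ?thesis by simp
qed

text \<open>By Cramer's rule the integer coordinates of a lattice point are cross products with the
  generators, divided by a constant, so they are bounded on a bounded set.\<close>

lemma finite_lat_bounded:
  assumes "cross2 p q \<noteq> 0" "bounded B"
  shows "finite (lat p q \<inter> B)"
proof -
  obtain R where R: "\<And>x. x \<in> B \<Longrightarrow> norm x \<le> R" using assms(2) bounded_iff by blast
  define M where "M = \<lceil>2 * R * (norm p + norm q) / \<bar>cross2 p q\<bar>\<rceil>"
  have *: "\<bar>m\<bar> \<le> M" if "\<bar>of_int m * cross2 p q\<bar> \<le> 2 * R * (norm p + norm q)" for m :: int
  proof -
    have "\<bar>of_int m :: real\<bar> * \<bar>cross2 p q\<bar> \<le> 2 * R * (norm p + norm q)"
      using that by (simp add: abs_mult)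
    then have "of_int \<bar>m\<bar> \<le> 2 * R * (norm p + norm q) / \<bar>cross2 p q\<bar>"
      using assms(1) by (simp add: field_simps)
    then show ?thesis unfolding M_def by linarith
  qed
  have "lat p q \<inter> B \<subseteq> (\<lambda>(m,n). of_int m *\<^sub>R p + of_int n *\<^sub>R q) ` ({-M..M} \<times> {-M..M})"
  proof
    fix x assume x: "x \<in> lat p q \<inter> B"
    then obtain m n where mn: "x = of_int m *\<^sub>R p + of_int n *\<^sub>R q" unfolding lat_def by auto
    have nx: "norm x \<le> R" using x R by auto
    have "cross2 x q = of_int m * cross2 p q" "cross2 p x = of_int n * cross2 p q"
      by (simp_all add: mn cross2_algebra)
    moreover have "\<bar>cross2 x q\<bar> \<le> 2 * R * (norm p + norm q)"
    proof -
      have "\<bar>cross2 x q\<bar> \<le> 2 * norm x * norm q" by (rule abs_cross2_le)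
      also have "\<dots> \<le> 2 * R * (norm p + norm q)" using nx by (intro mult_mono) (auto intro: order_trans[OF norm_ge_zero])
      finally show ?thesis .
    qed
    moreover have "\<bar>cross2 p x\<bar> \<le> 2 * R * (norm p + norm q)"
    proof -
      have "\<bar>cross2 p x\<bar> \<le> 2 * norm x * norm p" using abs_cross2_le[of p x] by (simp add: mult.commute mult.left_commute)
      also have "\<dots> \<le> 2 * R * (norm p + norm q)" using nx by (intro mult_mono) (auto intro: order_trans[OF norm_ge_zero])
      finally show ?thesis .
    qed
    ultimately have "\<bar>m\<bar> \<le> M" "\<bar>n\<bar> \<le> M" using * by auto
    then show "x \<in> (\<lambda>(m,n). of_int m *\<^sub>R p + of_int n *\<^sub>R q) ` ({-M..M} \<times> {-M..M})"
      unfolding mn by (auto intro!: image_eqI[of _ _ "(m,n)"])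
  qed
  then show ?thesis by (rule finite_subset) simp
qed

lemma cross2_zero_imp_scale: "cross2 p q = 0 \<Longrightarrow> p \<noteq> 0 \<Longrightarrow> \<exists>c. q = c *\<^sub>R p"
proof -
  assume c: "cross2 p q = 0" and p: "p \<noteq> 0"
  have "p$1 \<noteq> 0 \<or> p$2 \<noteq> 0" using p by (auto simp: vec_eq_iff forall_2)
  then show ?thesis
  proof
    assume "p$1 \<noteq> 0"
    then show ?thesis using c by (intro exI[of _ "q$1/p$1"]) (auto simp: vec_eq_iff forall_2 cross2_def field_simps)
  next
    assume "p$2 \<noteq> 0"
    then show ?thesis using c by (intro exI[of _ "q$2/p$2"]) (auto simp: vec_eq_iff forall_2 cross2_def field_simps)
  qed
qed

lemma cross2_pos_exists: "p \<noteq> 0 \<Longrightarrow> \<exists>v. cross2 p v > 0"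
proof -
  assume "p \<noteq> 0"
  then have "cross2 p (vector [- p$2, p$1]) = p$1 * p$1 + p$2 * p$2" by (simp add: cross2_def)
  also have "\<dots> > 0" using \<open>p \<noteq> 0\<close> by (simp add: sum_squares_gt_zero_iff vec_eq_iff forall_2)
  finally show ?thesis by blast
qed

lemma cross2_nonzero: "cross2 p q \<noteq> 0 \<Longrightarrow> p \<noteq> 0 \<and> q \<noteq> 0"
  by (auto simp: cross2_algebra)

lemma latE:
  assumes "z \<in> lat p q"
  obtains m n where "z = of_int m *\<^sub>R p + of_int n *\<^sub>R q"
  using assms unfolding lat_def by blast

section \<open>The Minkowski functional of a symmetric domain\<close>

definition minkowski :: "(real^2) set \<Rightarrow> real^2 \<Rightarrow> real" where
  "minkowski H x = Inf {t. 0 < t \<and> inverse t *\<^sub>R x \<in> H}"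

locale bcs =
  fixes H :: "(real^2) set"
  assumes bcs: "bcs_domain H"
begin

abbreviation N :: "real^2 \<Rightarrow> real" where "N \<equiv> minkowski H"

lemma open_H: "open H" and convex_H: "convex H" and bounded_H: "bounded H"
  and uminus_H: "x \<in> H \<Longrightarrow> - x \<in> H"
  using bcs unfolding bcs_domain_def symmetric_domain_def by auto

lemma zero_in_H: "0 \<in> H"
proof -
  obtain x where x: "x \<in> H" using bcs unfolding bcs_domain_def symmetric_domain_def by auto
  then have "(1/2) *\<^sub>R x + (1/2) *\<^sub>R (- x) \<in> H"
    by (intro convexD[OF convex_H] uminus_H) auto
  then show ?thesis by simp
qed

lemma scale_in_H: "x \<in> H \<Longrightarrow> 0 \<le> s \<Longrightarrow> s \<le> 1 \<Longrightarrow> s *\<^sub>R x \<in> H"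
  using convexD[OF convex_H, of x 0 s "1 - s"] zero_in_H by simp

lemma inradius: obtains e where "e > 0" "ball 0 e \<subseteq> H"
  using open_H zero_in_H open_contains_ball by blast

lemma circumradius: obtains R where "R > 0" "H \<subseteq> ball 0 R"
  using bounded_H bounded_subset_ballD by blast

lemma minkowski_set_nonempty: "\<exists>t>0. inverse t *\<^sub>R x \<in> H"
proof -
  obtain e where e: "e > 0" "ball 0 e \<subseteq> H" by (rule inradius)
  define t where "t = (norm x + 1) / e"
  have "t > 0" using e by (simp add: t_def add_nonneg_pos)
  moreover have "norm (inverse t *\<^sub>R x) < e"
    using e \<open>t > 0\<close> by (simp add: t_def field_simps)
  then have "inverse t *\<^sub>R x \<in> H" by (intro subsetD[OF e(2)]) simp
  ultimately show ?thesis by blast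
qed

text \<open>Openness of \<open>H\<close> gives the strict inequality: a point of \<open>H\<close> can be
  pushed outwards a little without leaving \<open>H\<close>. The norm axioms below are consequences of
  this equivalence.\<close>

lemma minkowski_less_iff: "0 < t \<Longrightarrow> N x < t \<longleftrightarrow> inverse t *\<^sub>R x \<in> H"
proof
  assume t: "0 < t" and "N x < t"
  then obtain s where s: "0 < s" "inverse s *\<^sub>R x \<in> H" "s < t"
    unfolding minkowski_def using cInf_lessD[of "{t. 0 < t \<and> inverse t *\<^sub>R x \<in> H}" t] minkowski_set_nonempty by auto
  have "(s / t) *\<^sub>R inverse s *\<^sub>R x \<in> H" by (rule scale_in_H) (use s t in auto)
  then show "inverse t *\<^sub>R x \<in> H" using s t by (simp add: field_simps)
next
  assume t: "0 < t" and x: "inverse t *\<^sub>R x \<in> H"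
  obtain e where e: "e > 0" "ball (inverse t *\<^sub>R x) e \<subseteq> H" using open_H x open_contains_ball by blast
  define d where "d = e / (norm (inverse t *\<^sub>R x) + 1)"
  have d: "d > 0" using e by (simp add: d_def add_nonneg_pos)
  have "d * norm (inverse t *\<^sub>R x) < e"
    using e unfolding d_def by (simp add: divide_simps) (smt (verit) norm_ge_zero mult_pos_pos)
  then have "dist (inverse t *\<^sub>R x) ((1 + d) *\<^sub>R inverse t *\<^sub>R x) < e"
    using d by (simp add: dist_norm algebra_simps abs_mult)
  then have "(1 + d) *\<^sub>R inverse t *\<^sub>R x \<in> H" using e by auto
  then have "inverse (t / (1 + d)) *\<^sub>R x \<in> H" using d t by (simp add: field_simps)
  then have "N x \<le> t / (1 + d)" unfolding minkowski_def using d t by (intro cInf_lower bdd_belowI[of _ 0]) auto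
  also have "\<dots> < t" using d t by (simp add: field_simps)
  finally show "N x < t" .
qed

lemma minkowski_nonneg: "0 \<le> N x"
  unfolding minkowski_def using minkowski_set_nonempty by (intro cInf_greatest) auto

lemma mem_H_iff: "x \<in> H \<longleftrightarrow> N x < 1"
  using minkowski_less_iff[of 1 x] by simp

lemma eq_if_same_strict_upper_bounds: "a = b" if "0 \<le> a" "0 \<le> b" "\<And>t. 0 < t \<Longrightarrow> a < t \<longleftrightarrow> b < t" for a b :: real
  using that by (metis linorder_less_linear order_le_less_trans less_irrefl)

lemma minkowski_zero [simp]: "N 0 = 0"
  using zero_in_H minkowski_less_iff[of _ 0] minkowski_nonneg by (intro eq_if_same_strict_upper_bounds) auto

lemma minkowski_minus [simp]: "N (- x) = N x"
proof -
  have "- y \<in> H \<longleftrightarrow> y \<in> H" for y using uminus_H[of y] uminus_H[of "-y"] by auto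
  then show ?thesis using minkowski_nonneg by (intro eq_if_same_strict_upper_bounds) (auto simp: minkowski_less_iff)
qed

lemma minkowski_scale: "N (c *\<^sub>R x) = \<bar>c\<bar> * N x"
proof -
  have pos: "N (c *\<^sub>R x) = c * N x" if c: "c > 0" for c
  proof (rule eq_if_same_strict_upper_bounds)
    fix t :: real assume t: "0 < t"
    have "N (c *\<^sub>R x) < t \<longleftrightarrow> inverse (t / c) *\<^sub>R x \<in> H" using t c by (simp add: minkowski_less_iff field_simps)
    also have "\<dots> \<longleftrightarrow> N x < t / c" using t c by (simp add: minkowski_less_iff)
    also have "\<dots> \<longleftrightarrow> c * N x < t" using c by (simp add: field_simps)
    finally show "N (c *\<^sub>R x) < t \<longleftrightarrow> c * N x < t" .
  qed (use c minkowski_nonneg in auto)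
  consider "c > 0" | "c = 0" | "c < 0" by linarith
  then show ?thesis
  proof cases
    case 3
    then show ?thesis using pos[of "-c"] minkowski_minus[of "c *\<^sub>R x"] by simp
  qed (use pos in auto)
qed

lemma minkowski_triangle: "N (x + y) \<le> N x + N y"
proof (rule field_le_epsilon)
  fix e :: real assume e: "0 < e"
  define s where "s = N x + e / 2" define t where "t = N y + e / 2"
  have st: "s > 0" "t > 0" using minkowski_nonneg e by (simp_all add: s_def t_def add_nonneg_pos)
  have "inverse s *\<^sub>R x \<in> H" "inverse t *\<^sub>R y \<in> H"
    using st e minkowski_less_iff[of s x] minkowski_less_iff[of t y] unfolding s_def t_def by auto
  then have "(s/(s+t)) *\<^sub>R inverse s *\<^sub>R x + (t/(s+t)) *\<^sub>R inverse t *\<^sub>R y \<in> H"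
    using st by (intro convexD[OF convex_H]) (auto simp: add_divide_distrib[symmetric])
  moreover have "(s/(s+t)) *\<^sub>R inverse s *\<^sub>R x + (t/(s+t)) *\<^sub>R inverse t *\<^sub>R y = inverse (s+t) *\<^sub>R (x + y)"
    using st by (simp add: vec_eq_iff forall_2 divide_simps)
  ultimately have "inverse (s+t) *\<^sub>R (x + y) \<in> H" by simp
  then have "N (x + y) < s + t" using st minkowski_less_iff[of "s+t"] by simp
  then show "N (x + y) \<le> N x + N y + e" by (simp add: s_def t_def)
qed

lemma minkowski_triangle_diff: "N (x - y) \<le> N x + N y"
  using minkowski_triangle[of x "-y"] by simp

lemma minkowski_reverse_triangle: "N x - N y \<le> N (x + y)"
  using minkowski_triangle[of "x + y" "- y"] by simp

lemma minkowski_minus_commute: "N (x - y) = N (y - x)"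
  using minkowski_minus[of "x - y"] by simp

lemma minkowski_norm_bounds: obtains a b where "a > 0" "b > 0" "\<And>x. N x \<le> a * norm x" "\<And>x. norm x \<le> b * N x"
proof -
  obtain e where e: "e > 0" "ball 0 e \<subseteq> H" by (rule inradius)
  obtain R where R: "R > 0" "H \<subseteq> ball 0 R" by (rule circumradius)
  have "N x \<le> (2/e) * norm x" for x
  proof (cases "x = 0")
    case False
    have "inverse ((2/e) * norm x) *\<^sub>R x \<in> H" using False e by (intro subsetD[OF e(2)]) auto
    then show ?thesis using False e minkowski_less_iff[of "(2/e) * norm x" x] by simp
  qed simp
  moreover have "norm x \<le> R * N x" for x
  proof (rule field_le_epsilon)
    fix d :: real assume d: "d > 0"
    define t where "t = N x + d / R"
    have t: "t > 0" using d R minkowski_nonneg by (simp add: t_def add_nonneg_pos)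
    have "inverse t *\<^sub>R x \<in> H" using t minkowski_less_iff[of t x] d R by (simp add: t_def)
    then have "norm (inverse t *\<^sub>R x) < R" using R by auto
    then have "norm x < R * t" using t by (simp add: field_simps)
    then show "norm x \<le> R * N x + d" using R by (simp add: t_def distrib_left)
  qed
  ultimately show ?thesis using that[of "2/e" R] e R by auto
qed

lemma minkowski_pos: "x \<noteq> 0 \<Longrightarrow> N x > 0"
proof -
  assume x: "x \<noteq> 0"
  obtain b where "b > 0" "norm x \<le> b * N x" using minkowski_norm_bounds by metis
  then show ?thesis using x by (metis minkowski_nonneg less_eq_real_def mult_zero_right norm_le_zero_iff)
qed

lemma continuous_minkowski: "continuous_on S N"
proof -
  obtain a where a: "a > 0" "\<And>x. N x \<le> a * norm x" using minkowski_norm_bounds by metis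
  have "\<bar>N x - N y\<bar> \<le> a * dist x y" for x y
    using minkowski_triangle[of "x - y" y] minkowski_triangle[of "y - x" x] a(2)[of "x-y"] a(2)[of "y-x"]
    by (simp add: dist_norm norm_minus_commute)
  then have "a-lipschitz_on UNIV N" using a by (intro lipschitz_onI) (auto simp: dist_real_def)
  then show ?thesis using lipschitz_on_continuous_on continuous_on_subset by blast
qed

lemma continuous_on_minkowski [continuous_intros]:
  "continuous_on S f \<Longrightarrow> continuous_on S (\<lambda>x. N (f x))"
  using continuous_on_compose2[OF continuous_minkowski[of UNIV]] by auto

lemma compact_minkowski_ball: "compact {x. N x \<le> r}"
proof -
  obtain b where b: "b > 0" "\<And>x. norm x \<le> b * N x" using minkowski_norm_bounds by metis
  have "norm x \<le> b * r" if "N x \<le> r" for x using b that by (meson order_trans mult_left_mono less_imp_le)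
  then have "bounded {x. N x \<le> r}" unfolding bounded_iff by blast
  moreover have "closed {x. N x \<le> r}" by (intro closed_Collect_le continuous_intros)
  ultimately show ?thesis by (simp add: compact_eq_bounded_closed)
qed

lemma minkowski_combination:
  "0 \<le> a \<Longrightarrow> 0 \<le> b \<Longrightarrow> N (a *\<^sub>R x + b *\<^sub>R y) \<le> a * N x + b * N y"
  using minkowski_triangle[of "a *\<^sub>R x" "b *\<^sub>R y"] by (simp add: minkowski_scale)

text \<open>A supporting line at a boundary point, normalised so that its functional is bounded by the
  norm.\<close>

lemma minkowski_support:
  assumes "N p = 1"
  obtains a where "a \<bullet> p = 1" "\<And>x. a \<bullet> x \<le> N x"
proof -
  have "{p} \<inter> H = {}" using assms mem_H_iff by auto
  then obtain a b where ab: "a \<noteq> 0" "a \<bullet> p \<le> b" "\<And>x. x \<in> H \<Longrightarrow> b \<le> a \<bullet> x"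
    using separating_hyperplane_sets[of "{p}" H] convex_H zero_in_H by auto
  define c where "c = - a"
  have c: "c \<noteq> 0" "\<And>x. x \<in> H \<Longrightarrow> c \<bullet> x \<le> c \<bullet> p" using ab unfolding c_def by fastforce+
  have le: "c \<bullet> x \<le> (c \<bullet> p) * N x" for x
  proof (rule field_le_mult_one_interval)
    fix z :: real assume z: "0 < z" "z < 1"
    show "z * (c \<bullet> x) \<le> (c \<bullet> p) * N x"
    proof (cases "x = 0")
      case False
      then have pos: "N x > 0" by (rule minkowski_pos)
      have "N ((z / N x) *\<^sub>R x) < 1" using z pos by (simp add: minkowski_scale)
      then have "c \<bullet> ((z / N x) *\<^sub>R x) \<le> c \<bullet> p" using c(2) mem_H_iff by blast
      then show ?thesis using pos by (simp add: field_simps)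
    qed simp
  qed
  have "0 < c \<bullet> c" using c by simp
  also have "c \<bullet> c \<le> (c \<bullet> p) * N c" by (rule le)
  finally have cp: "c \<bullet> p > 0" using minkowski_nonneg[of c] by (simp add: zero_less_mult_iff)
  show ?thesis
  proof (rule that[of "inverse (c \<bullet> p) *\<^sub>R c"])
    show "inverse (c \<bullet> p) *\<^sub>R c \<bullet> p = 1" using cp by simp
    show "inverse (c \<bullet> p) *\<^sub>R c \<bullet> x \<le> N x" for x
      using le[of x] cp by (simp add: field_simps)
  qed
qed

end

section \<open>Inscribed hexagons and the critical determinant\<close>

context bcs
begin

text \<open>The six points \<open>\<plusminus>p\<close>, \<open>\<plusminus>q\<close>,
  \<open>\<plusminus>(q - p)\<close> are the vertices of an affinely regular hexagon inscribed in the
  boundary of \<open>H\<close>.\<close>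

definition hexad :: "real^2 \<Rightarrow> real^2 \<Rightarrow> bool" where
  "hexad p q \<longleftrightarrow> N p = 1 \<and> N q = 1 \<and> N (q - p) = 1"

lemma hexad_rotate: "hexad p q \<Longrightarrow> hexad q (q - p)"
  by (simp add: hexad_def)

lemma hexad_swap: "hexad p q \<Longrightarrow> hexad q p"
  by (simp add: hexad_def minkowski_minus_commute)

lemma hexad_cross_nonzero: "hexad p q \<Longrightarrow> cross2 p q \<noteq> 0"
proof
  assume h: "hexad p q" and c: "cross2 p q = 0"
  have "p \<noteq> 0" using h unfolding hexad_def by force
  then obtain c where q: "q = c *\<^sub>R p" using cross2_zero_imp_scale c by blast
  have "q - p = (c - 1) *\<^sub>R p" by (simp add: q algebra_simps)
  then have "N (q - p) = \<bar>c - 1\<bar> * N p" "N q = \<bar>c\<bar> * N p" by (simp_all only: q minkowski_scale)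
  then have "\<bar>c\<bar> = 1" "\<bar>c - 1\<bar> = 1" using h unfolding hexad_def by simp_all
  then show False by linarith
qed

text \<open>Between two neighbouring vertices of the hexagon the norm dominates both coordinates. Indeed
  \<open>a p + b q = (a + b) q - a (q - p)\<close>, and the reverse triangle inequality leaves \<open>(a
  + b) - a\<close>.\<close>

lemma sector_minkowski_ge:
  assumes "N p = 1" "N q = 1" "N (q - p) \<le> 1" "0 \<le> a" "0 \<le> b"
  shows "a \<le> N (a *\<^sub>R p + b *\<^sub>R q)" "b \<le> N (a *\<^sub>R p + b *\<^sub>R q)"
proof -
  have "a *\<^sub>R p + b *\<^sub>R q = (a + b) *\<^sub>R p + b *\<^sub>R (q - p)"
    "a *\<^sub>R p + b *\<^sub>R q = (a + b) *\<^sub>R q + a *\<^sub>R (p - q)"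
    by (simp_all add: algebra_simps)
  then have "N ((a+b) *\<^sub>R p) - N (b *\<^sub>R (q-p)) \<le> N (a *\<^sub>R p + b *\<^sub>R q)"
    "N ((a+b) *\<^sub>R q) - N (a *\<^sub>R (p - q)) \<le> N (a *\<^sub>R p + b *\<^sub>R q)"
    using minkowski_reverse_triangle by metis+
  moreover have "b * N (q - p) \<le> b" "a * N (p - q) \<le> a"
    using assms by (simp_all add: mult_left_le minkowski_minus_commute)
  ultimately show "a \<le> N (a *\<^sub>R p + b *\<^sub>R q)" "b \<le> N (a *\<^sub>R p + b *\<^sub>R q)"
    using assms by (simp_all add: minkowski_scale)
qed

text \<open>The six cones spanned by neighbouring vertices of the hexagon cover the plane, and in each
  of them integer coordinates with respect to the original basis are again integers.\<close>

lemma hexad_lattice_ge: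
  assumes h: "hexad p q" and mn: "m \<noteq> 0 \<or> n \<noteq> 0"
  shows "1 \<le> N (of_int m *\<^sub>R p + of_int n *\<^sub>R q)"
proof -
  have sec: "1 \<le> N (of_int i *\<^sub>R x + of_int j *\<^sub>R y)"
    if "hexad x y" "0 \<le> i" "0 \<le> j" "i > 0 \<or> j > 0" for x y and i j :: int
  proof -
    have "of_int i \<le> N (of_int i *\<^sub>R x + of_int j *\<^sub>R y)" "of_int j \<le> N (of_int i *\<^sub>R x + of_int j *\<^sub>R y)"
      using sector_minkowski_ge[of x y "of_int i" "of_int j"] that by (auto simp: hexad_def)
    moreover have "1 \<le> (of_int i :: real) \<or> 1 \<le> (of_int j :: real)" using that by auto
    ultimately show ?thesis by linarith
  qed
  have nonneg: "1 \<le> N (of_int m *\<^sub>R p + of_int n *\<^sub>R q)"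
    if n: "0 \<le> n" and mn: "m \<noteq> 0 \<or> n > 0" for m n :: int
  proof -
    have "N (of_int m *\<^sub>R p) \<ge> 1" if "n = 0" using that mn h by (simp add: minkowski_scale hexad_def)
    moreover have ?thesis if "m \<ge> 0" using sec[OF h, of m n] that n mn by linarith
    moreover have ?thesis if "m < 0" "n + m \<ge> 0"
    proof -
      have "of_int m *\<^sub>R p + of_int n *\<^sub>R q = of_int (n + m) *\<^sub>R q + of_int (- m) *\<^sub>R (q - p)"
        by (simp add: algebra_simps)
      then show ?thesis using sec[OF hexad_rotate[OF h], of "n+m" "-m"] that by simp
    qed
    moreover have ?thesis if "m < 0" "n + m \<le> 0" "n > 0"
    proof -
      have "of_int m *\<^sub>R p + of_int n *\<^sub>R q = of_int n *\<^sub>R (q - p) + of_int (- m - n) *\<^sub>R ((q - p) - q)"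
        by (simp add: algebra_simps)
      then show ?thesis using sec[OF hexad_rotate[OF hexad_rotate[OF h]], of n "-m-n"] that by simp
    qed
    ultimately show ?thesis using n by (cases "n = 0") (auto, linarith)
  qed
  show ?thesis
  proof (cases "n \<ge> 0")
    case True then show ?thesis using nonneg mn by auto
  next
    case False
    have eq: "of_int (- m) *\<^sub>R p + of_int (- n) *\<^sub>R q = - (of_int m *\<^sub>R p + of_int n *\<^sub>R q)" by simp
    have "1 \<le> N (of_int (- m) *\<^sub>R p + of_int (- n) *\<^sub>R q)" by (rule nonneg) (use False in auto)
    then show ?thesis unfolding eq by (simp only: minkowski_minus)
  qed
qed

lemma admissible_lat_iff:
  assumes "cross2 p q \<noteq> 0"
  shows "admissible H (lat p q) \<longleftrightarrow> (\<forall>z\<in>lat p q - {0}. 1 \<le> N z)"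
proof -
  have "lat p q \<inter> H = {0} \<longleftrightarrow> (\<forall>z\<in>lat p q - {0}. z \<notin> H)"
    using zero_in_lat[of p q] zero_in_H by blast
  then show ?thesis unfolding admissible_def using is_lattice_lat[OF assms]
    by (simp add: mem_H_iff not_less)
qed

lemma hexad_admissible: "hexad p q \<Longrightarrow> admissible H (lat p q)"
proof -
  assume h: "hexad p q"
  have "1 \<le> N z" if z0: "z \<in> lat p q - {0}" for z
  proof -
    obtain m n where z: "z = of_int m *\<^sub>R p + of_int n *\<^sub>R q" using z0 latE[of z p q] by blast
    have "m \<noteq> 0 \<or> n \<noteq> 0" using z0 z by auto
    then show ?thesis unfolding z by (rule hexad_lattice_ge[OF h])
  qed
  then show ?thesis using hexad_cross_nonzero[OF h] by (simp add: admissible_lat_iff)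
qed

text \<open>Among the chords of \<open>H\<close> that are translates of the segment from
  \<open>0\<close> to \<open>p\<close>, take the one farthest from the origin on the positive side. If
  one of its endpoints were interior, sliding the chord slightly along its own line would make both
  endpoints interior, and then the chord could be moved farther out.\<close>

lemma exists_hexad:
  assumes p: "N p = 1"
  obtains q where "hexad p q" "cross2 p q > 0"
    "\<And>x. N x \<le> 1 \<Longrightarrow> N (x - p) \<le> 1 \<Longrightarrow> cross2 p x \<le> cross2 p q"
proof -
  have p0: "p \<noteq> 0" using p by force
  obtain v where v: "cross2 p v > 0" using cross2_pos_exists[OF p0] by blast
  have Nv: "N v > 0" using cross2_nonzero[of p v] v minkowski_pos by auto
  define A where "A = {x. N x \<le> 1} \<inter> {x. N (x - p) \<le> 1}"
  have "compact A" unfolding A_def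
    by (intro compact_Int_closed compact_minkowski_ball closed_Collect_le continuous_intros)
  moreover have "p \<in> A" using p by (simp add: A_def)
  moreover have "continuous_on A (cross2 p)" by (intro continuous_intros)
  ultimately obtain q where q: "q \<in> A" "\<And>x. x \<in> A \<Longrightarrow> cross2 p x \<le> cross2 p q"
    by (metis continuous_attains_sup empty_iff)
  have improve: False if y: "N y < 1" "N (y - p) < 1" "cross2 p y \<ge> cross2 p q" for y
  proof -
    define e where "e = min (1 - N y) (1 - N (y - p)) / N v"
    have e: "e > 0" using y Nv by (simp add: e_def)
    have eN: "e * N v \<le> 1 - N y" "e * N v \<le> 1 - N (y - p)" using Nv by (simp_all add: e_def)
    have "N (y + e *\<^sub>R v) \<le> N y + e * N v" "N ((y - p) + e *\<^sub>R v) \<le> N (y - p) + e * N v"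
      using minkowski_triangle[of _ "e *\<^sub>R v"] e by (simp_all add: minkowski_scale)
    then have "y + e *\<^sub>R v \<in> A" using eN unfolding A_def by (simp add: algebra_simps)
    then have "cross2 p (y + e *\<^sub>R v) \<le> cross2 p q" by (rule q(2))
    moreover have "e * cross2 p v > 0" using e v by simp
    ultimately show False using y(3) by (simp add: cross2_algebra)
  qed
  have half: "N ((1/2) *\<^sub>R p) < 1" "N ((1/2) *\<^sub>R p - p) < 1"
  proof -
    have "(1/2) *\<^sub>R p - p = (-1/2) *\<^sub>R p" by (simp add: vec_eq_iff)
    then have "N ((1/2) *\<^sub>R p - p) = \<bar>-1/2\<bar> * N p" by (simp only: minkowski_scale)
    then show "N ((1/2) *\<^sub>R p - p) < 1" unfolding p by simp
    show "N ((1/2) *\<^sub>R p) < 1" by (simp add: minkowski_scale p)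
  qed
  have pos: "cross2 p q > 0"
    using improve[OF half] by (simp add: cross2_algebra not_le[symmetric]) blast
  have Nq: "N q \<le> 1" "N (q - p) \<le> 1" using q(1) by (simp_all add: A_def)
  have "N q = 1"
  proof (rule ccontr)
    assume "N q \<noteq> 1"
    then have lt: "N q < 1" using Nq by simp
    define e where "e = (1 - N q) / 2"
    have e: "0 < e" "e < 1" "N q + e < 1" using lt minkowski_nonneg[of q] by (auto simp: e_def field_simps)
    have "N (q + e *\<^sub>R p) < 1" using minkowski_triangle[of q "e *\<^sub>R p"] p e by (simp add: minkowski_scale)
    moreover have "N (q + e *\<^sub>R p - p) < 1"
    proof -
      have "q + e *\<^sub>R p - p = e *\<^sub>R q + (1 - e) *\<^sub>R (q - p)" by (simp add: algebra_simps)
      then have "N (q + e *\<^sub>R p - p) \<le> e * N q + (1 - e) * N (q - p)" using minkowski_combination e by simp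
      also have "\<dots> < e * 1 + (1 - e) * 1" using e lt Nq by (intro add_less_le_mono mult_strict_left_mono mult_left_mono) auto
      finally show ?thesis by simp
    qed
    ultimately show False using improve[of "q + e *\<^sub>R p"] by (simp add: cross2_algebra)
  qed
  moreover have "N (q - p) = 1"
  proof (rule ccontr)
    assume "N (q - p) \<noteq> 1"
    then have lt: "N (q - p) < 1" using Nq by simp
    define e where "e = (1 - N (q - p)) / 2"
    have e: "0 < e" "e < 1" "N (q - p) + e < 1" using lt minkowski_nonneg[of "q - p"] by (auto simp: e_def field_simps)
    have "N (q - e *\<^sub>R p - p) < 1"
      using minkowski_triangle_diff[of "q - p" "e *\<^sub>R p"] p e by (simp add: minkowski_scale algebra_simps)
    moreover have "N (q - e *\<^sub>R p) < 1"
    proof -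
      have "q - e *\<^sub>R p = (1 - e) *\<^sub>R q + e *\<^sub>R (q - p)" by (simp add: algebra_simps)
      then have "N (q - e *\<^sub>R p) \<le> (1 - e) * N q + e * N (q - p)" using minkowski_combination e by simp
      also have "\<dots> < (1 - e) * 1 + e * 1" using e lt Nq by (intro add_le_less_mono mult_strict_left_mono mult_left_mono) auto
      finally show ?thesis by simp
    qed
    ultimately show False using improve[of "q - e *\<^sub>R p"] by (simp add: cross2_algebra)
  qed
  ultimately show ?thesis using that[of q] pos p q(2) by (simp add: hexad_def A_def)
qed

text \<open>Write \<open>\<theta>\<close> for the ratio of the two heights. The line of \<open>y\<close>
  lies between the diameter through \<open>p\<close> and the chord from \<open>q - p\<close> to
  \<open>q\<close>; by convexity it meets \<open>H\<close> in an open chord of length at least \<open>2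
  - \<theta>\<close>, measured in multiples of \<open>p\<close>. As this exceeds \<open>1\<close>, every
  \<open>p\<close>-spaced sequence on that line enters \<open>H\<close>.\<close>

lemma row_meets_body:
  assumes h: "hexad p q" and d: "0 < cross2 p y" "cross2 p y < cross2 p q"
  shows "\<exists>m::int. N (y + of_int m *\<^sub>R p) < 1"
proof -
  define \<theta> where "\<theta> = cross2 p y / cross2 p q"
  have \<theta>: "0 < \<theta>" "\<theta> < 1" using d by (simp_all add: \<theta>_def)
  have "cross2 p (y - \<theta> *\<^sub>R q) = 0" using d by (simp add: cross2_algebra \<theta>_def)
  moreover have "p \<noteq> 0" using h unfolding hexad_def by force
  ultimately obtain s where "y - \<theta> *\<^sub>R q = s *\<^sub>R p" using cross2_zero_imp_scale by blast
  then have y: "y = \<theta> *\<^sub>R q + s *\<^sub>R p" by (simp add: algebra_simps)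
  \<comment> \<open>The translate closest to the midpoint of the chord, which has abscissa \<open>- \<theta>/2\<close>.\<close>
  define m where "m = - \<lfloor>s + \<theta>/2 + 1/2\<rfloor>"
  define w where "w = s + of_int m + \<theta>/2"
  have w: "-1/2 \<le> w" "w \<le> 1/2" unfolding w_def m_def by linarith+
  have "y + of_int m *\<^sub>R p = \<theta> *\<^sub>R ((1/2 + w) *\<^sub>R q + (1/2 - w) *\<^sub>R (q - p)) + ((1 - \<theta>) * w) *\<^sub>R p"
    by (simp add: y w_def vec_eq_iff forall_2 field_simps)
  then have "N (y + of_int m *\<^sub>R p) \<le> N (\<theta> *\<^sub>R ((1/2 + w) *\<^sub>R q + (1/2 - w) *\<^sub>R (q - p))) + N (((1 - \<theta>) * w) *\<^sub>R p)"
    using minkowski_triangle by metis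
  also have "\<dots> = \<theta> * N ((1/2 + w) *\<^sub>R q + (1/2 - w) *\<^sub>R (q - p)) + (1 - \<theta>) * \<bar>w\<bar>"
    using \<theta> h by (simp add: minkowski_scale hexad_def abs_mult)
  also have "\<dots> \<le> \<theta> * 1 + (1 - \<theta>) * (1/2)"
  proof (intro add_mono mult_left_mono)
    show "N ((1/2 + w) *\<^sub>R q + (1/2 - w) *\<^sub>R (q - p)) \<le> 1"
      using minkowski_combination[of "1/2+w" "1/2-w" q "q-p"] w h by (simp add: hexad_def)
  qed (use \<theta> w in auto)
  also have "\<dots> < 1" using \<theta> by (simp add: field_simps)
  finally show ?thesis by blast
qed

text \<open>A shortest nonzero lattice vector exists by discreteness and is primitive, hence extends to
  a basis by Bezout's identity.\<close>

lemma admissible_min_basis: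
  assumes "admissible H L"
  obtains x y where "L = lat x y" "cross2 x y > 0" "1 \<le> N x" "\<And>z. z \<in> L \<Longrightarrow> z \<noteq> 0 \<Longrightarrow> N x \<le> N z"
proof -
  have ad: "1 \<le> N z" if "z \<in> L" "z \<noteq> 0" for z
    using assms that unfolding admissible_def using mem_H_iff by fastforce
  obtain a b where ab: "cross2 a b \<noteq> 0" "L = lat a b"
    using assms is_latticeE unfolding admissible_def by metis
  define F where "F = {z \<in> L. z \<noteq> 0 \<and> N z \<le> N a}"
  have "finite F"
    by (rule finite_subset[OF _ finite_lat_bounded[OF ab(1) compact_imp_bounded[OF compact_minkowski_ball[of "N a"]]]])
      (auto simp: F_def ab)
  moreover have "a \<in> F" using ab gens_in_lat cross2_nonzero by (auto simp: F_def)
  ultimately obtain x where x: "x \<in> F" "\<And>z. z \<in> F \<Longrightarrow> N x \<le> N z"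
    by (metis arg_min_if_finite(1) arg_min_least empty_iff)
  have xmin: "N x \<le> N z" if "z \<in> L" "z \<noteq> 0" for z
    using x that unfolding F_def by (smt (verit) mem_Collect_eq)
  obtain m n where mn: "x = of_int m *\<^sub>R a + of_int n *\<^sub>R b"
    using x(1) latE[of x a b] unfolding F_def ab by blast
  have x0: "x \<noteq> 0" using x(1) by (simp add: F_def)
  define g where "g = gcd m n"
  have g0: "g > 0" using x0 mn by (auto simp: g_def)
  obtain m' n' where m'n': "m = g * m'" "n = g * n'" unfolding g_def by (meson dvdE gcd_dvd1 gcd_dvd2)
  \<comment> \<open>Dividing by the common factor gives a shorter lattice vector, so that factor is \<open>1\<close>.\<close>
  define x' where "x' = of_int m' *\<^sub>R a + of_int n' *\<^sub>R b"
  have xx': "x = of_int g *\<^sub>R x'" by (simp add: mn x'_def m'n' algebra_simps)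
  then have "x' \<noteq> 0" using x0 by auto
  then have "N x \<le> N x'" "N x' > 0" using xmin[of x'] minkowski_pos by (auto simp: x'_def ab lat_mem)
  then have "g \<le> 1" using xx' g0 by (simp add: minkowski_scale)
  then have "gcd m n = 1" using g0 unfolding g_def by linarith
  then obtain u v where uv: "u * m + v * n = 1" using bezout_int[of m n] by auto
  then have uvr: "of_int u * of_int m + of_int v * of_int n = (1::real)"
    by (metis of_int_1 of_int_add of_int_mult)
  define y where "y = of_int (-v) *\<^sub>R a + of_int u *\<^sub>R b"
  have cr: "cross2 x y = cross2 a b"
  proof -
    have "cross2 x y = (of_int u * of_int m + of_int v * of_int n) * cross2 a b"
      by (simp add: mn y_def cross2_algebra cross2_swap[of b a] algebra_simps)
    then show ?thesis by (simp add: uvr)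
  qed
  have "lat x y = L"
  proof
    show "lat x y \<subseteq> L" unfolding ab(2) by (rule lat_subset) (simp_all only: mn y_def lat_mem)
    have "of_int u *\<^sub>R x + of_int (- n) *\<^sub>R y = (of_int u * of_int m + of_int v * of_int n) *\<^sub>R a"
      "of_int v *\<^sub>R x + of_int m *\<^sub>R y = (of_int u * of_int m + of_int v * of_int n) *\<^sub>R b"
      by (simp_all add: mn y_def algebra_simps)
    then have "a \<in> lat x y" "b \<in> lat x y" using lat_mem uvr by (metis scaleR_one)+
    then show "L \<subseteq> lat x y" unfolding ab(2) by (rule lat_subset)
  qed
  moreover have "1 \<le> N x" using ad[of x] x(1) by (simp add: F_def)
  ultimately show ?thesis
    using that[of x y] that[of x "-y"] ab(1) cr xmin lat_uminus[of x y]
    by (cases "cross2 a b > 0") (auto simp: cross2_algebra)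
qed

text \<open>After scaling the shortest vector \<open>x\<close> to the boundary, the next row of lattice
  points cannot be closer to the line through \<open>x\<close> than the opposite side of the inscribed
  hexagon, since it would then enter \<open>H\<close>. The square of \<open>N x\<close> is the factor by
  which scaling changes covolumes.\<close>

lemma hexad_below_lattice:
  assumes "cross2 x y > 0" "N x > 0" "\<And>z. z \<in> lat x y \<Longrightarrow> z \<noteq> 0 \<Longrightarrow> N x \<le> N z"
  obtains q where "hexad (inverse (N x) *\<^sub>R x) q" "cross2 (inverse (N x) *\<^sub>R x) q > 0"
    "(N x)\<^sup>2 * cross2 (inverse (N x) *\<^sub>R x) q \<le> cross2 x y"
proof -
  define \<mu> where "\<mu> = N x"
  have \<mu>: "\<mu> > 0" using assms by (simp add: \<mu>_def)
  define p where "p = inverse \<mu> *\<^sub>R x"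
  have Np: "N p = 1" using \<mu> by (simp add: p_def minkowski_scale \<mu>_def)
  obtain q where q: "hexad p q" "cross2 p q > 0" using exists_hexad[OF Np] by blast
  have "cross2 p q \<le> cross2 p (inverse \<mu> *\<^sub>R y)"
  proof (rule ccontr)
    assume "\<not> ?thesis"
    then obtain m :: int where m: "N (inverse \<mu> *\<^sub>R y + of_int m *\<^sub>R p) < 1"
      using row_meets_body[OF q(1), of "inverse \<mu> *\<^sub>R y"] assms(1) \<mu> by (auto simp: p_def cross2_algebra)
    have "inverse \<mu> *\<^sub>R y + of_int m *\<^sub>R p = inverse \<mu> *\<^sub>R (of_int m *\<^sub>R x + y)"
      by (simp add: p_def algebra_simps)
    then have "inverse \<mu> * N (of_int m *\<^sub>R x + y) < 1" using m \<mu> by (simp add: minkowski_scale)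
    then have "N (of_int m *\<^sub>R x + y) < \<mu>" using \<mu> by (simp add: field_simps)
    moreover have "of_int m *\<^sub>R x + y \<in> lat x y" using lat_mem[of m x 1 y] by simp
    moreover have "cross2 x (of_int m *\<^sub>R x + y) \<noteq> 0" using assms(1) by (simp add: cross2_algebra)
    then have "of_int m *\<^sub>R x + y \<noteq> 0" using cross2_nonzero by blast
    ultimately show False using assms(3) by (fastforce simp: \<mu>_def)
  qed
  also have "\<dots> = cross2 x y / \<mu>\<^sup>2" by (simp add: p_def cross2_algebra field_simps power2_eq_square)
  finally have "\<mu>\<^sup>2 * cross2 p q \<le> cross2 x y" using \<mu> by (simp add: field_simps)
  then show ?thesis using that q unfolding p_def \<mu>_def by blast
qed

lemma minimal_hexad:
  obtains p q where "hexad p q" "cross2 p q > 0" "\<And>p' q'. hexad p' q' \<Longrightarrow> cross2 p q \<le> \<bar>cross2 p' q'\<bar>"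
proof -
  define Hx where "Hx = ({x. N x \<le> 1} \<times> {x. N x \<le> 1}) \<inter> {z. N (fst z) = 1 \<and> N (snd z) = 1 \<and> N (snd z - fst z) = 1}"
  have Hx: "z \<in> Hx \<longleftrightarrow> hexad (fst z) (snd z)" for z by (auto simp: Hx_def hexad_def mem_Times_iff)
  have "compact Hx" unfolding Hx_def
    by (intro compact_Int_closed compact_Times compact_minkowski_ball closed_Collect_conj closed_Collect_eq continuous_intros)
  moreover have "Hx \<noteq> {}"
  proof -
    define x where "x = (inverse (N (axis 1 1))) *\<^sub>R (axis 1 1 :: real^2)"
    have "N (axis 1 1) > 0" by (rule minkowski_pos) (simp add: axis_eq_0_iff)
    then have "N x = 1" by (simp add: x_def minkowski_scale)
    then obtain q where "hexad x q" using exists_hexad by blast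
    then have "(x,q) \<in> Hx" using Hx[of "(x,q)"] by simp
    then show ?thesis by blast
  qed
  moreover have "continuous_on Hx (\<lambda>z. \<bar>cross2 (fst z) (snd z)\<bar>)" by (intro continuous_intros)
  ultimately obtain z where z: "z \<in> Hx" "\<And>w. w \<in> Hx \<Longrightarrow> \<bar>cross2 (fst z) (snd z)\<bar> \<le> \<bar>cross2 (fst w) (snd w)\<bar>"
    using continuous_attains_inf[of Hx "\<lambda>z. \<bar>cross2 (fst z) (snd z)\<bar>"] by blast
  define p q where "p = fst z" "q = snd z"
  have h: "hexad p q" using z(1) unfolding Hx p_q_def .
  have min: "\<bar>cross2 p q\<bar> \<le> \<bar>cross2 p' q'\<bar>" if "hexad p' q'" for p' q'
    using z(2)[of "(p',q')"] Hx[of "(p',q')"] that unfolding p_q_def by simp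
  show ?thesis
  proof (cases "cross2 p q > 0")
    case True then show ?thesis using that[of p q] h min by auto
  next
    case False
    then have "cross2 q p > 0" "\<bar>cross2 p q\<bar> = cross2 q p"
      using hexad_cross_nonzero[OF h] cross2_swap[of p q] by linarith+
    then show ?thesis using that[of q p] hexad_swap[OF h] min by auto
  qed
qed

abbreviation \<Delta> :: real where "\<Delta> \<equiv> critical_determinant H"

text \<open>Lattices of hexagons are admissible, and every admissible lattice has at least the covolume
  of some hexagon; so the infimum over lattices is a minimum over the compact set of hexagons.\<close>

lemma critical_determinant_minimal_hexad:
  assumes h: "hexad p q" "cross2 p q > 0" "\<And>p' q'. hexad p' q' \<Longrightarrow> cross2 p q \<le> \<bar>cross2 p' q'\<bar>"
  shows "\<Delta> = cross2 p q" "\<And>L. admissible H L \<Longrightarrow> cross2 p q \<le> covolume L"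
proof -
  show le: "cross2 p q \<le> covolume L" if L: "admissible H L" for L
  proof -
    obtain x y where xy: "L = lat x y" "cross2 x y > 0" "1 \<le> N x" "\<And>z. z \<in> L \<Longrightarrow> z \<noteq> 0 \<Longrightarrow> N x \<le> N z"
      using admissible_min_basis[OF L] by metis
    obtain r where r: "hexad (inverse (N x) *\<^sub>R x) r" "cross2 (inverse (N x) *\<^sub>R x) r > 0"
      "(N x)\<^sup>2 * cross2 (inverse (N x) *\<^sub>R x) r \<le> cross2 x y"
      using hexad_below_lattice[of x y] xy by auto
    have "cross2 p q \<le> 1 * cross2 (inverse (N x) *\<^sub>R x) r" using h(3)[OF r(1)] r(2) by simp
    also have "\<dots> \<le> (N x)\<^sup>2 * cross2 (inverse (N x) *\<^sub>R x) r"
      using xy(3) r(2) by (intro mult_right_mono) auto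
    finally show ?thesis using r(3) xy by (simp add: covolume_lat)
  qed
  show "\<Delta> = cross2 p q" unfolding critical_determinant_def
    using h hexad_admissible[OF h(1)] le by (intro cInf_eq_minimum) (auto intro!: exI[of _ "lat p q"] simp: covolume_lat)
qed

lemma critical_determinant_le_hexad: "hexad p q \<Longrightarrow> \<Delta> \<le> \<bar>cross2 p q\<bar>"
  using minimal_hexad critical_determinant_minimal_hexad by metis

lemma critical_determinant_le_covolume: "admissible H L \<Longrightarrow> \<Delta> \<le> covolume L"
  using minimal_hexad critical_determinant_minimal_hexad by metis

text \<open>Requiring the signed determinant to be \<open>\<Delta>\<close>, not merely its absolute
  value, orients the hexagon: \<open>q\<close> follows \<open>p\<close> counterclockwise.\<close>

definition critical_hexad :: "real^2 \<Rightarrow> real^2 \<Rightarrow> bool" where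
  "critical_hexad p q \<longleftrightarrow> hexad p q \<and> cross2 p q = \<Delta>"

lemma exists_critical_hexad: obtains p q where "critical_hexad p q"
  unfolding critical_hexad_def using minimal_hexad critical_determinant_minimal_hexad by metis

lemma critical_determinant_pos: "\<Delta> > 0"
  using minimal_hexad critical_determinant_minimal_hexad by metis

lemma critical_hexad_lattice_critical: "critical_hexad p q \<Longrightarrow> lat p q \<in> critical_locus H"
  unfolding critical_locus_def critical_hexad_def
  using hexad_admissible critical_determinant_pos by (simp add: covolume_lat)

text \<open>A shortest vector of norm larger than \<open>1\<close> would allow a critical lattice to be
  shrunk.\<close>

lemma critical_basis:
  assumes "L \<in> critical_locus H"
  obtains x y where "L = lat x y" "cross2 x y = \<Delta>" "N x = 1" "\<And>z. z \<in> L \<Longrightarrow> z \<noteq> 0 \<Longrightarrow> 1 \<le> N z"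
proof -
  have L: "admissible H L" "covolume L = \<Delta>" using assms by (auto simp: critical_locus_def)
  obtain x y where xy: "L = lat x y" "cross2 x y > 0" "1 \<le> N x" "\<And>z. z \<in> L \<Longrightarrow> z \<noteq> 0 \<Longrightarrow> N x \<le> N z"
    using admissible_min_basis[OF L(1)] by metis
  have c: "cross2 x y = \<Delta>" using L xy by (simp add: covolume_lat)
  obtain r where r: "hexad (inverse (N x) *\<^sub>R x) r" "cross2 (inverse (N x) *\<^sub>R x) r > 0"
    "(N x)\<^sup>2 * cross2 (inverse (N x) *\<^sub>R x) r \<le> cross2 x y"
    using hexad_below_lattice[of x y] xy by auto
  have "(N x)\<^sup>2 * \<Delta> \<le> (N x)\<^sup>2 * cross2 (inverse (N x) *\<^sub>R x) r"
    using critical_determinant_le_hexad[OF r(1)] r(2) by (intro mult_left_mono) auto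
  then have "(N x)\<^sup>2 * \<Delta> \<le> 1 * \<Delta>" using r(3) c by simp
  then have "(N x)\<^sup>2 \<le> 1" using critical_determinant_pos by (simp only: mult_le_cancel_right)
  then have "N x = 1" using xy(3) by (smt (verit) one_power2 power2_le_imp_le power_mono)
  then show ?thesis using that xy c by auto
qed

end

section \<open>Flat critical configurations force a parallelogram\<close>

lemma parallelogramI:
  assumes c: "cross2 p q \<noteq> 0" and P: "\<And>X Y. X *\<^sub>R p + Y *\<^sub>R q \<in> P \<longleftrightarrow> \<bar>X\<bar> < 1 \<and> \<bar>Y\<bar> < 1"
  shows "parallelogram P"
proof -
  have c2: "cross2 (2 *\<^sub>R p) (2 *\<^sub>R q) \<noteq> 0" using c by (simp add: cross2_algebra)
  define A where "A = {- p - q + s *\<^sub>R (2 *\<^sub>R p) + t *\<^sub>R (2 *\<^sub>R q) |s t. 0 < s \<and> s < 1 \<and> 0 < t \<and> t < 1}"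
  have "P = A"
  proof (intro set_eqI iffI)
    fix x assume "x \<in> P"
    moreover obtain X Y where x: "x = X *\<^sub>R p + Y *\<^sub>R q" using cross2_cramer[OF c] by blast
    ultimately have "\<bar>X\<bar> < 1" "\<bar>Y\<bar> < 1" using P by auto
    moreover have "x = - p - q + ((X+1)/2) *\<^sub>R (2 *\<^sub>R p) + ((Y+1)/2) *\<^sub>R (2 *\<^sub>R q)"
      by (simp add: x vec_eq_iff field_simps)
    ultimately show "x \<in> A" unfolding A_def by (intro CollectI exI[of _ "(X+1)/2"] exI[of _ "(Y+1)/2"]) auto
  next
    fix x assume "x \<in> A"
    then obtain s t where st: "0 < s" "s < 1" "0 < t" "t < 1" "x = - p - q + s *\<^sub>R (2 *\<^sub>R p) + t *\<^sub>R (2 *\<^sub>R q)"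
      unfolding A_def by blast
    have "x = (2 * s - 1) *\<^sub>R p + (2 * t - 1) *\<^sub>R q" by (simp add: st algebra_simps)
    then show "x \<in> P" using P st by auto
  qed
  moreover have "2 *\<^sub>R p \<noteq> 2 *\<^sub>R q" using c by (auto simp: cross2_algebra)
  moreover have "independent {2 *\<^sub>R p, 2 *\<^sub>R q}"
  proof -
    have "2 *\<^sub>R q \<noteq> 0" using c2 cross2_nonzero by blast
    moreover have "2 *\<^sub>R p \<notin> span {2 *\<^sub>R q}"
    proof
      assume "2 *\<^sub>R p \<in> span {2 *\<^sub>R q}"
      then obtain k where "2 *\<^sub>R p = k *\<^sub>R (2 *\<^sub>R q)" by (auto simp: span_singleton)
      then have "cross2 (2 *\<^sub>R p) (2 *\<^sub>R q) = cross2 (k *\<^sub>R (2 *\<^sub>R q)) (2 *\<^sub>R q)" by simp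
      then show False using c2 by (simp add: cross2_algebra)
    qed
    ultimately show ?thesis by (intro independent_insertI) (auto simp: independent_insert independent_empty)
  qed
  ultimately show ?thesis unfolding parallelogram_def A_def by blast
qed

context bcs
begin

text \<open>If \<open>q\<close> lies on the boundary and inside a segment of the closed domain parallel
  to \<open>p\<close>, then this segment lies on a supporting line. A point \<open>x\<close> of the
  closed domain beyond that line would put \<open>q\<close> into the interior of the convex hull of
  \<open>x\<close>, the segment and the origin.\<close>

lemma flat_strip:
  assumes q: "1 \<le> N q" and p: "N (q - a *\<^sub>R p) \<le> 1" "N (q + b *\<^sub>R p) \<le> 1" "a > 0" "b > 0" "cross2 p q > 0"
  shows "\<bar>cross2 p x\<bar> \<le> cross2 p q * N x"
proof -
  have key: False if x: "N x \<le> 1" "cross2 p x > cross2 p q" for x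
  proof -
    define m where "m = min a b"
    have m: "m > 0" "m \<le> a" "m \<le> b" using p by (auto simp: m_def)
    define X where "X = cross2 x q / cross2 p q"
    define Y where "Y = cross2 p x / cross2 p q"
    have xeq: "x = X *\<^sub>R p + Y *\<^sub>R q" unfolding X_def Y_def using p by (intro cross2_cramer) auto
    have Y: "Y > 1" using x p by (simp add: Y_def)
    \<comment> \<open>The point \<open>q\<close> is written as a combination of \<open>x\<close> and a point of the segment with total weight below \<open>1\<close>; \<open>k\<close> keeps the weights positive when \<open>X = 0\<close>.\<close>
    define k where "k = \<bar>X\<bar> + 1"
    have k: "k > 0" "\<bar>X\<bar> \<le> k" by (simp_all add: k_def)
    define \<mu> where "\<mu> = m / (k + m * Y)"
    define \<nu> where "\<nu> = k / (k + m * Y)"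
    define u where "u = - (m * X) / k"
    have den: "k + m * Y > 0" using m Y k by (simp add: add_pos_pos)
    have \<mu>\<nu>: "\<mu> > 0" "\<nu> > 0" "\<mu> + \<nu> < 1" using den m Y k by (simp_all add: \<mu>_def \<nu>_def add_divide_distrib[symmetric])
    have "\<bar>u\<bar> = m * (\<bar>X\<bar> / k)" using m k by (simp add: u_def abs_mult)
    also have "\<dots> \<le> m * 1" using m k by (intro mult_left_mono) auto
    finally have u: "- a \<le> u" "u \<le> b" using m by auto
    have Nu: "N (q + u *\<^sub>R p) \<le> 1"
    proof -
      have ab: "(b - u) / (a + b) \<ge> 0" "(a + u) / (a + b) \<ge> 0" using u p by auto
      have ab1: "(b - u) / (a + b) + (a + u) / (a + b) = 1" using p by (simp add: add_divide_distrib[symmetric])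
      have "((b - u) / (a + b)) * (- a) + ((a + u) / (a + b)) * b = ((a + b) * u) / (a + b)"
        by (simp add: add_divide_distrib[symmetric] diff_divide_distrib[symmetric] algebra_simps)
      then have "((b - u) / (a + b)) * (- a) + ((a + u) / (a + b)) * b = u" using p by simp
      then have "q + u *\<^sub>R p = ((b - u) / (a + b) + (a + u) / (a + b)) *\<^sub>R q + (((b - u) / (a + b)) * (- a) + ((a + u) / (a + b)) * b) *\<^sub>R p"
        using ab1 by simp
      also have "\<dots> = ((b - u) / (a + b)) *\<^sub>R (q - a *\<^sub>R p) + ((a + u) / (a + b)) *\<^sub>R (q + b *\<^sub>R p)"
        unfolding scaleR_add_left scaleR_add_right scaleR_diff_right by simp
      finally have "N (q + u *\<^sub>R p) \<le> ((b - u) / (a + b)) * N (q - a *\<^sub>R p) + ((a + u) / (a + b)) * N (q + b *\<^sub>R p)"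
        using minkowski_combination ab by metis
      also have "\<dots> \<le> ((b - u) / (a + b)) * 1 + ((a + u) / (a + b)) * 1"
        using p ab by (intro add_mono mult_left_mono) auto
      finally show ?thesis using ab1 by simp
    qed
    have "\<mu> * X + \<nu> * u = 0" "\<mu> * Y + \<nu> = 1"
      using den k by (simp_all add: \<mu>_def \<nu>_def u_def add_divide_distrib[symmetric] add.commute)
    moreover have "\<mu> *\<^sub>R x + \<nu> *\<^sub>R (q + u *\<^sub>R p) = (\<mu> * Y + \<nu>) *\<^sub>R q + (\<mu> * X + \<nu> * u) *\<^sub>R p"
      by (simp add: xeq algebra_simps)
    ultimately have "q = \<mu> *\<^sub>R x + \<nu> *\<^sub>R (q + u *\<^sub>R p)" by simp
    then have "N q \<le> \<mu> * N x + \<nu> * N (q + u *\<^sub>R p)" using minkowski_combination \<mu>\<nu> by (metis less_imp_le)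
    also have "\<dots> \<le> \<mu> * 1 + \<nu> * 1" using \<mu>\<nu> x Nu by (intro add_mono mult_left_mono) auto
    finally show False using q \<mu>\<nu> by simp
  qed
  have pos: "cross2 p x \<le> cross2 p q * N x" for x
  proof (cases "x = 0")
    case False
    then have Nx: "N x > 0" by (rule minkowski_pos)
    have "N (inverse (N x) *\<^sub>R x) \<le> 1" using Nx by (simp add: minkowski_scale)
    then have "cross2 p (inverse (N x) *\<^sub>R x) \<le> cross2 p q" using key not_le by blast
    then show ?thesis using Nx by (simp add: cross2_algebra field_simps)
  qed (simp add: cross2_algebra)
  show ?thesis using pos[of x] pos[of "-x"] by (simp add: cross2_algebra)
qed

lemma ivt_level_one:
  assumes "N (f 0) < 1" "1 < N (f 1)" "continuous_on {0..1} f"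
  obtains t :: real where "0 < t" "t < 1" "N (f t) = 1"
proof -
  obtain t where t: "0 \<le> t" "t \<le> 1" "N (f t) = 1"
    using IVT'[of "\<lambda>t. N (f t)" 0 1 1] assms continuous_on_minkowski[OF assms(3)] by auto
  moreover have "t \<noteq> 0" "t \<noteq> 1" using t assms by auto
  ultimately show ?thesis using that[of t] by simp
qed

text \<open>Here \<open>c\<close> is the midpoint of an edge of half length \<open>h\<close> parallel to
  \<open>p\<close>, with all of \<open>H\<close> between this edge and its mirror image. If \<open>h <
  1\<close>, a hexagon of determinant smaller than \<open>\<Delta>\<close> arises by moving one vertex
  off the end of the edge: \<open>P\<close> is a boundary point beyond that end, at height \<open>y <
  1\<close>, and \<open>Q\<close> is the boundary point at height \<open>y - 1\<close> on the same side,
  so that \<open>P - Q\<close> stays on the edge. The support line at \<open>p\<close> is assumed to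
  lean so that the horizontal coordinate of \<open>Q\<close> is at most \<open>1\<close>; the other case
  is its mirror image.\<close>

lemma flat_edge_long:
  assumes p: "N p = 1" and top: "N (c + h *\<^sub>R p) \<le> 1" "N (c - h *\<^sub>R p) \<le> 1"
    "\<And>s. N (c + s *\<^sub>R p) \<le> 1 \<Longrightarrow> s \<le> h" and h: "1/2 \<le> h"
    and c: "\<bar>cross2 p c\<bar> = \<Delta>" and strip: "\<And>x. \<bar>cross2 p x\<bar> \<le> \<Delta> * N x"
    and a: "a \<bullet> p = 1" "\<And>x. a \<bullet> x \<le> N x" "a \<bullet> c \<le> 0"
  shows "1 \<le> h"
proof (rule ccontr)
  assume "\<not> 1 \<le> h"
  then have h1: "h < 1" by simp
  have mid: "N (c + s *\<^sub>R p) \<le> 1" if "\<bar>s\<bar> \<le> h" for s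
  proof -
    have "c + s *\<^sub>R p = ((h+s)/(2*h)) *\<^sub>R (c + h *\<^sub>R p) + ((h-s)/(2*h)) *\<^sub>R (c - h *\<^sub>R p)"
      using h by (simp add: vec_eq_iff field_simps)
    then have "N (c + s *\<^sub>R p) \<le> ((h+s)/(2*h)) * N (c + h *\<^sub>R p) + ((h-s)/(2*h)) * N (c - h *\<^sub>R p)"
      using minkowski_combination[of "(h+s)/(2*h)" "(h-s)/(2*h)"] that h by (simp add: abs_le_iff)
    also have "\<dots> \<le> ((h+s)/(2*h)) * 1 + ((h-s)/(2*h)) * 1"
      using that h top by (intro add_mono mult_left_mono) (auto simp: abs_le_iff)
    also have "\<dots> = 1" using h by (simp add: field_simps)
    finally show ?thesis .
  qed
  have Nc: "N c \<le> 1" using mid[of 0] h by simp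
  \<comment> \<open>Any abscissa strictly between \<open>h\<close> and \<open>1\<close> lies beyond the end of the edge but inside the diameter.\<close>
  define w where "w = (h + 1) / 2"
  have w: "h < w" "w < 1" using h1 by (simp_all add: w_def)
  have "N (w *\<^sub>R p + 0 *\<^sub>R c) < 1" using w h p by (simp add: minkowski_scale)
  moreover have "1 < N (w *\<^sub>R p + 1 *\<^sub>R c)" using top(3)[of w] w by (simp add: not_le[symmetric] add.commute) auto
  ultimately obtain y where y: "0 < y" "y < 1" "N (w *\<^sub>R p + y *\<^sub>R c) = 1"
    by (rule ivt_level_one) (intro continuous_intros)
  define P where "P = w *\<^sub>R p + y *\<^sub>R c"
  define e where "e = 1 - y"
  have e: "0 < e" "e < 1" using y by (simp_all add: e_def)
  have lo: "N (h *\<^sub>R p - e *\<^sub>R c) \<le> 1"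
  proof -
    have "h *\<^sub>R p - e *\<^sub>R c = ((1-e)/2) *\<^sub>R (c + h *\<^sub>R p) + ((1+e)/2) *\<^sub>R (h *\<^sub>R p - c)"
      by (simp add: vec_eq_iff field_simps)
    then have "N (h *\<^sub>R p - e *\<^sub>R c) \<le> ((1-e)/2) * N (c + h *\<^sub>R p) + ((1+e)/2) * N (h *\<^sub>R p - c)"
      using minkowski_combination[of "(1-e)/2" "(1+e)/2"] e by simp
    also have "\<dots> \<le> ((1-e)/2) * 1 + ((1+e)/2) * 1"
      using e top by (intro add_mono mult_left_mono) (auto simp: minkowski_minus_commute)
    finally show ?thesis by (simp add: field_simps)
  qed
  have hi: "1 \<le> N (2 *\<^sub>R p - e *\<^sub>R c)"
  proof -
    have "N (2 *\<^sub>R p) - N (e *\<^sub>R c) \<le> N (2 *\<^sub>R p - e *\<^sub>R c)"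
      using minkowski_reverse_triangle[of "2 *\<^sub>R p" "- (e *\<^sub>R c)"] by simp
    moreover have "e * N c \<le> 1" using e Nc minkowski_nonneg[of c] by (simp add: mult_le_one)
    ultimately show ?thesis using e p by (simp add: minkowski_scale)
  qed
  have "continuous_on {h..2} (\<lambda>X. N (X *\<^sub>R p - e *\<^sub>R c))" by (intro continuous_intros)
  then obtain X where X: "h \<le> X" "N (X *\<^sub>R p - e *\<^sub>R c) = 1"
    using IVT'[of "\<lambda>X. N (X *\<^sub>R p - e *\<^sub>R c)" h 1 2] lo hi h1 by auto
  define Q where "Q = X *\<^sub>R p - e *\<^sub>R c"
  have "X \<le> 1"
  proof -
    have "X - e * (a \<bullet> c) \<le> 1" using a(2)[of Q] X(2) a(1) by (simp add: Q_def inner_diff_right)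
    moreover have "e * (a \<bullet> c) \<le> 0" using e a(3) by (simp add: mult_nonneg_nonpos)
    ultimately show ?thesis by linarith
  qed
  have PQ: "P - Q = c + (w - X) *\<^sub>R p" by (simp add: P_def Q_def e_def algebra_simps)
  have "N (P - Q) \<le> 1" unfolding PQ using X \<open>X \<le> 1\<close> w h by (intro mid) auto
  moreover have "1 \<le> N (P - Q)"
  proof -
    have "\<bar>cross2 p (P - Q)\<bar> = \<Delta>" unfolding PQ using c by (simp add: cross2_algebra)
    then have "\<Delta> * 1 \<le> \<Delta> * N (P - Q)" using strip[of "P - Q"] by simp
    then show ?thesis using critical_determinant_pos by (simp only: mult_le_cancel_left_pos)
  qed
  ultimately have "hexad Q P" using X y unfolding hexad_def P_def Q_def by simp
  then have "\<Delta> \<le> \<bar>cross2 Q P\<bar>" by (rule critical_determinant_le_hexad)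
  also have "cross2 Q P = (X * y + e * w) * cross2 p c"
    by (simp add: P_def Q_def cross2_algebra cross2_swap[of c p] algebra_simps)
  also have "\<bar>(X * y + e * w) * cross2 p c\<bar> = (X * y + e * w) * \<Delta>"
    using X y e w h by (simp add: abs_mult c add_nonneg_nonneg)
  finally have "1 * \<Delta> \<le> (X * y + e * w) * \<Delta>" by simp
  then have "1 \<le> X * y + e * w" using critical_determinant_pos by (simp only: mult_le_cancel_right_pos)
  moreover have "X * y \<le> 1 * y" using \<open>X \<le> 1\<close> y by (intro mult_right_mono) auto
  moreover have "e * w < e * 1" using e w by (intro mult_strict_left_mono) auto
  ultimately show False by (simp add: e_def)
qed

text \<open>The maximal edge that contains the segment from \<open>q - p\<close> to \<open>q\<close> has
  length at least \<open>1\<close> in multiples of \<open>p\<close>, and at most \<open>2\<close>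
  because its two copies bound a centrally symmetric set in which the parallel diameter has length
  \<open>2\<close>. Criticality forces the value \<open>2\<close>, and then the two edges together with
  the support lines at \<open>p\<close> and \<open>- p\<close> enclose exactly \<open>H\<close>.\<close>

lemma flat_imp_parallelogram:
  assumes p: "N p = 1" and q: "N q \<le> 1" "N (q - p) \<le> 1" "cross2 p q = \<Delta>"
    and strip: "\<And>x. \<bar>cross2 p x\<bar> \<le> \<Delta> * N x"
  shows "parallelogram H"
proof -
  define I where "I = {s. N (q + s *\<^sub>R p) \<le> 1}"
  have "closed I" unfolding I_def by (intro closed_Collect_le continuous_intros)
  moreover have "\<bar>s\<bar> \<le> 2" if "s \<in> I" for s
  proof -
    have "s *\<^sub>R p = (q + s *\<^sub>R p) - q" by simp
    then have "N (s *\<^sub>R p) \<le> N (q + s *\<^sub>R p) + N q" using minkowski_triangle_diff by metis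
    then show ?thesis using that q p by (simp add: I_def minkowski_scale)
  qed
  then have "bounded I" unfolding bounded_iff by auto
  ultimately have cI: "compact I" by (simp add: compact_eq_bounded_closed)
  have mem: "0 \<in> I" "-1 \<in> I" using q by (simp_all add: I_def)
  obtain \<beta> where \<beta>: "\<beta> \<in> I" "\<And>s. s \<in> I \<Longrightarrow> s \<le> \<beta>" using compact_attains_sup[OF cI] mem by auto
  obtain \<alpha> where \<alpha>: "\<alpha> \<in> I" "\<And>s. s \<in> I \<Longrightarrow> \<alpha> \<le> s" using compact_attains_inf[OF cI] mem by auto
  define h where "h = (\<beta> - \<alpha>) / 2"
  have h: "1/2 \<le> h" using \<alpha>(2)[OF mem(2)] \<beta>(2)[OF mem(1)] by (simp add: h_def)
  define c where "c = q + ((\<alpha> + \<beta>) / 2) *\<^sub>R p"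
  have ch: "c + h *\<^sub>R p = q + \<beta> *\<^sub>R p" "c - h *\<^sub>R p = q + \<alpha> *\<^sub>R p"
    by (simp_all add: c_def h_def vec_eq_iff field_simps)
  have top: "N (c + h *\<^sub>R p) \<le> 1" "N (c - h *\<^sub>R p) \<le> 1"
    unfolding ch using \<alpha>(1) \<beta>(1) by (simp_all add: I_def)
  have maxi: "s \<le> h \<and> - h \<le> s" if "N (c + s *\<^sub>R p) \<le> 1" for s
  proof -
    have "c + s *\<^sub>R p = q + ((\<alpha> + \<beta>) / 2 + s) *\<^sub>R p" by (simp add: c_def algebra_simps)
    then have "(\<alpha> + \<beta>) / 2 + s \<in> I" using that by (simp add: I_def)
    from \<alpha>(2)[OF this] \<beta>(2)[OF this] show ?thesis by (simp add: h_def field_simps)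
  qed
  have cc: "cross2 p c = \<Delta>" by (simp add: c_def cross2_algebra q)
  obtain a where a: "a \<bullet> p = 1" "\<And>x. a \<bullet> x \<le> N x" using minkowski_support[OF p] by blast
  have "1 \<le> h"
  proof (cases "a \<bullet> c \<le> 0")
    case True
    then show ?thesis using flat_edge_long[OF p top _ h _ strip a] maxi cc critical_determinant_pos by auto
  next
    case False
    have eq: "- c + s *\<^sub>R p = - (c + (- s) *\<^sub>R p)" "- c - s *\<^sub>R p = - (c + s *\<^sub>R p)" for s by simp_all
    show ?thesis
    proof (rule flat_edge_long[OF p _ _ _ h _ strip a])
      show "N (- c + h *\<^sub>R p) \<le> 1" "N (- c - h *\<^sub>R p) \<le> 1"
        unfolding eq minkowski_minus using top by simp_all
      show "s \<le> h" if "N (- c + s *\<^sub>R p) \<le> 1" for s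
        using that maxi[of "-s"] unfolding eq minkowski_minus by simp
      show "\<bar>cross2 p (- c)\<bar> = \<Delta>" using cc critical_determinant_pos by (simp add: cross2_algebra)
      show "a \<bullet> (- c) \<le> 0" using False by simp
    qed
  qed
  moreover have "h \<le> 1"
  proof -
    have "N ((c + h *\<^sub>R p) - (c - h *\<^sub>R p)) \<le> 1 + 1" using minkowski_triangle_diff top by (smt (verit))
    moreover have "(c + h *\<^sub>R p) - (c - h *\<^sub>R p) = (2 * h) *\<^sub>R p" by (simp add: vec_eq_iff)
    ultimately show ?thesis using p h by (simp add: minkowski_scale)
  qed
  ultimately have h1: "h = 1" by simp
  have "a \<bullet> c = 0"
    using a(2)[of "c + h *\<^sub>R p"] a(2)[of "p - c"] top a(1)
    by (simp add: h1 inner_add_right inner_diff_right minkowski_minus_commute[of p c])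
  then have X: "\<bar>X\<bar> \<le> N (X *\<^sub>R p + Y *\<^sub>R c)" for X Y
    using a(2)[of "X *\<^sub>R p + Y *\<^sub>R c"] a(2)[of "- (X *\<^sub>R p + Y *\<^sub>R c)"] a(1) unfolding minkowski_minus
    by (simp add: inner_add_right inner_diff_right)
  have Y: "\<bar>Y\<bar> \<le> N (X *\<^sub>R p + Y *\<^sub>R c)" for X Y
    using strip[of "X *\<^sub>R p + Y *\<^sub>R c"] critical_determinant_pos by (simp add: cross2_algebra cc abs_mult)
  have le: "N (X *\<^sub>R p + Y *\<^sub>R c) \<le> max \<bar>X\<bar> \<bar>Y\<bar>" for X Y
  proof -
    have "X *\<^sub>R p + Y *\<^sub>R c = ((X+Y)/2) *\<^sub>R (c + p) - ((Y-X)/2) *\<^sub>R (p - c)"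
      by (simp add: vec_eq_iff field_simps)
    then have "N (X *\<^sub>R p + Y *\<^sub>R c) \<le> N (((X+Y)/2) *\<^sub>R (c + p)) + N (((Y-X)/2) *\<^sub>R (p - c))"
      using minkowski_triangle_diff by metis
    also have "\<dots> \<le> \<bar>(X+Y)/2\<bar> * 1 + \<bar>(Y-X)/2\<bar> * 1"
      unfolding minkowski_scale using top by (intro add_mono mult_left_mono) (auto simp: h1 minkowski_minus_commute[of p c])
    also have "\<dots> = (\<bar>X + Y\<bar> + \<bar>Y - X\<bar>) / 2" by simp
    also have "\<bar>X + Y\<bar> + \<bar>Y - X\<bar> = 2 * max \<bar>X\<bar> \<bar>Y\<bar>" by (simp add: max_def abs_if)
    finally show ?thesis by simp
  qed
  show ?thesis
  proof (rule parallelogramI[of p c])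
    show "cross2 p c \<noteq> 0" using cc critical_determinant_pos by simp
    show "X *\<^sub>R p + Y *\<^sub>R c \<in> H \<longleftrightarrow> \<bar>X\<bar> < 1 \<and> \<bar>Y\<bar> < 1" for X Y
      unfolding mem_H_iff using X[of X Y] Y[of Y X] le[of X Y] by linarith
  qed
qed

text \<open>Two hexagons on the same \<open>p\<close> with equal determinant have \<open>q\<close> and
  \<open>q'\<close> on one line parallel to \<open>p\<close>; if they differed, the closed domain would
  contain a chord longer than \<open>p\<close> on that line, hence a flat edge.\<close>

lemma critical_hexad_unique:
  assumes np: "\<not> parallelogram H" and h: "critical_hexad p q" "critical_hexad p q'"
  shows "q = q'"
proof -
  have key: False if h: "critical_hexad p q" "critical_hexad p q'" "q' = q + s *\<^sub>R p" "s > 0" for q q' s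
  proof -
    have "\<bar>cross2 p x\<bar> \<le> cross2 p q * N x" for x
      by (rule flat_strip[of q 1 p s])
        (use h critical_determinant_pos in \<open>auto simp: critical_hexad_def hexad_def\<close>)
    then have "parallelogram H"
      using h by (intro flat_imp_parallelogram[of p q]) (auto simp: critical_hexad_def hexad_def)
    then show False using np by simp
  qed
  have "p \<noteq> 0" "cross2 p (q' - q) = 0" using h by (auto simp: critical_hexad_def hexad_def cross2_algebra)
  then obtain s where "q' - q = s *\<^sub>R p" using cross2_zero_imp_scale by blast
  then have s: "q' = q + s *\<^sub>R p" "q = q' + (- s) *\<^sub>R p" by (simp_all add: algebra_simps)
  have "\<not> s > 0" using key[OF h s(1)] by blast
  moreover have "\<not> - s > 0" using key[OF h(2) h(1) s(2)] by blast
  ultimately show ?thesis using s(1) by simp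
qed

text \<open>A critical lattice contains a boundary point \<open>x\<close>, and the hexagon on
  \<open>x\<close> has the same determinant. The second basis vector can be chosen on the line of its
  chord. If it is not the endpoint of the chord, some lattice point is inner to the chord without being
  inner to \<open>H\<close>, and the chord is flat.\<close>

lemma critical_locus_eq_critical_hexads:
  assumes np: "\<not> parallelogram H"
  shows "critical_locus H = {lat p q |p q. critical_hexad p q}"
proof (intro equalityI subsetI)
  fix L assume "L \<in> critical_locus H"
  then obtain x y where xy: "L = lat x y" "cross2 x y = \<Delta>" "N x = 1" "\<And>z. z \<in> L \<Longrightarrow> z \<noteq> 0 \<Longrightarrow> 1 \<le> N z"
    using critical_basis by metis
  obtain q where q: "hexad x q" "cross2 x q = \<Delta>"
  proof -
    obtain q where q: "hexad x q" "cross2 x q > 0" "(N x)\<^sup>2 * cross2 x q \<le> cross2 x y"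
      using hexad_below_lattice[of x y] xy critical_determinant_pos by auto
    then show ?thesis using that[of q] critical_determinant_le_hexad[OF q(1)] xy by simp
  qed
  have x0: "x \<noteq> 0" using xy(3) by auto
  have "cross2 x (y - q) = 0" using q xy by (simp add: cross2_algebra)
  then obtain s where s: "y - q = s *\<^sub>R x" using cross2_zero_imp_scale x0 by blast
  \<comment> \<open>Shear the basis so that its second vector lies within one step of the endpoint \<open>q\<close>.\<close>
  define k where "k = - \<lfloor>s\<rfloor>"
  define y' where "y' = y + of_int k *\<^sub>R x"
  define t where "t = s + of_int k"
  have t: "0 \<le> t" "t < 1" unfolding t_def k_def by linarith+
  have y': "y' = q + t *\<^sub>R x" using s by (simp add: y'_def t_def algebra_simps)
  have L: "L = lat x y'" unfolding y'_def lat_shear by (rule xy)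
  show "L \<in> {lat p q |p q. critical_hexad p q}"
  proof (cases "t = 0")
    case True
    then show ?thesis using L y' q unfolding critical_hexad_def by auto
  next
    case False
    have "cross2 x y' = \<Delta>" by (simp add: y' cross2_algebra q)
    have "y' - x \<in> L" unfolding L using lat_mem[of "-1" x 1 y'] by simp
    moreover have "cross2 x (y' - x) \<noteq> 0"
      using \<open>cross2 x y' = \<Delta>\<close> critical_determinant_pos by (simp add: cross2_algebra)
    then have "y' - x \<noteq> 0" using cross2_nonzero by blast
    ultimately have Ny': "1 \<le> N (y' - x)" by (rule xy(4))
    have "\<bar>cross2 x z\<bar> \<le> cross2 x (y' - x) * N z" for z
    proof (rule flat_strip[OF Ny', of t x "1 - t"])
      show "N (y' - x - t *\<^sub>R x) \<le> 1" using q by (simp add: y' hexad_def)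
      show "N (y' - x + (1 - t) *\<^sub>R x) \<le> 1" using q by (simp add: y' hexad_def algebra_simps)
    qed (use t False q critical_determinant_pos in \<open>auto simp: y' cross2_algebra\<close>)
    then have "parallelogram H"
      using q xy by (intro flat_imp_parallelogram[of x q]) (auto simp: critical_hexad_def hexad_def y' cross2_algebra)
    then show ?thesis using np by simp
  qed
qed (use critical_hexad_lattice_critical in auto)

end

section \<open>Rotation of critical hexagons\<close>

text \<open>If \<open>p\<close>, \<open>q\<close> are positively oriented, this is the closed cone that
  they span.\<close>

definition sector :: "real^2 \<Rightarrow> real^2 \<Rightarrow> real^2 \<Rightarrow> bool" where
  "sector p q x \<longleftrightarrow> 0 \<le> cross2 p x \<and> 0 \<le> cross2 x q"

lemma sector_uminus: "sector (- p) (- q) (- x) \<longleftrightarrow> sector p q x"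
  by (simp add: sector_def cross2_algebra)

text \<open>Excluding parallelograms is what makes the critical hexagon through a boundary point unique.
  In the square it is not: the point \<open>(1, 0)\<close> and any \<open>(t, 1)\<close> with \<open>0
  \<le> t \<le> 1\<close> give one.\<close>

locale bcs_nonparallelogram = bcs +
  assumes np: "\<not> parallelogram H"
begin

lemma critical_hexad_rotate: "critical_hexad p q \<Longrightarrow> critical_hexad q (q - p)"
  using hexad_rotate[of p q] cross2_swap[of q p] by (simp add: critical_hexad_def cross2_algebra)

lemma critical_hexad_uminus: "critical_hexad p q \<Longrightarrow> critical_hexad (- p) (- q)"
  using critical_hexad_rotate[OF critical_hexad_rotate[OF critical_hexad_rotate, of p q]] by simp

lemma critical_hexad_rotate2: "critical_hexad p q \<Longrightarrow> critical_hexad (q - p) (- p)"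
  using critical_hexad_rotate[OF critical_hexad_rotate, of p q] by simp

lemma critical_hexad_back: "critical_hexad p q \<Longrightarrow> critical_hexad (p - q) p"
  using critical_hexad_uminus[OF critical_hexad_rotate2, of p q] by simp

lemmas critical_hexad_uniq = critical_hexad_unique[OF np]

lemma critical_hexad_inj: "critical_hexad p q \<Longrightarrow> critical_hexad p' q \<Longrightarrow> p = p'"
  using critical_hexad_uniq[OF critical_hexad_rotate critical_hexad_rotate, of p q p'] by simp

lemma critical_hexadD: "critical_hexad p q \<Longrightarrow> N p = 1" "critical_hexad p q \<Longrightarrow> N q = 1" "critical_hexad p q \<Longrightarrow> N (q - p) = 1"
  "critical_hexad p q \<Longrightarrow> cross2 p q = \<Delta>" "critical_hexad p q \<Longrightarrow> cross2 p q > 0"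
  using critical_determinant_pos by (auto simp: critical_hexad_def hexad_def)

lemma critical_hexad_coords:
  assumes h: "critical_hexad p q"
  obtains a b where "x = a *\<^sub>R p + b *\<^sub>R q"
    "cross2 p x = b * \<Delta>" "cross2 x q = a * \<Delta>"
proof -
  have "x = (cross2 x q / cross2 p q) *\<^sub>R p + (cross2 p x / cross2 p q) *\<^sub>R q"
    by (rule cross2_cramer) (use critical_hexadD(5)[OF h] in simp)
  then show ?thesis using that[of "cross2 x q / \<Delta>" "cross2 p x / \<Delta>"] critical_hexadD(4)[OF h] critical_determinant_pos
    by simp
qed

lemma sector_coords:
  assumes h: "critical_hexad p q" and x: "sector p q x" "N x = 1"
  obtains a b where "x = a *\<^sub>R p + b *\<^sub>R q" "0 \<le> a" "a \<le> 1" "0 \<le> b" "b \<le> 1" "1 \<le> a + b"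
    "cross2 p x = b * \<Delta>" "cross2 x q = a * \<Delta>"
proof -
  obtain a b where ab: "x = a *\<^sub>R p + b *\<^sub>R q" "cross2 p x = b * \<Delta>" "cross2 x q = a * \<Delta>"
    using critical_hexad_coords[OF h] by blast
  have pos: "0 \<le> a" "0 \<le> b"
    using x(1) critical_determinant_pos ab by (simp_all add: sector_def zero_le_mult_iff)
  have "a \<le> 1" "b \<le> 1"
    using sector_minkowski_ge[of p q a b] pos critical_hexadD[OF h] x ab by auto
  moreover have "1 \<le> a + b" using minkowski_combination[OF pos, of p q] critical_hexadD[OF h] x ab by simp
  ultimately show ?thesis using that pos ab by blast
qed

lemma sector_start: "critical_hexad p q \<Longrightarrow> sector p q x \<Longrightarrow> N x = 1 \<Longrightarrow> cross2 p x = 0 \<Longrightarrow> x = p"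
  using critical_determinant_pos by (elim sector_coords) auto

text \<open>In the basis \<open>p\<close>, \<open>q\<close> all four coordinates of \<open>p'\<close>
  and \<open>q'\<close> lie between \<open>0\<close> and \<open>1\<close>, and equality of the
  determinants reads \<open>a d - b c = 1\<close>. Hence \<open>a = d = 1\<close> and one of
  \<open>b\<close>, \<open>c\<close> vanishes; uniqueness of the hexagon through a given vertex finishes
  the argument.\<close>

lemma critical_hexad_nested:
  assumes h: "critical_hexad p q" and h': "critical_hexad p' q'" and s: "sector p q p'" "sector p q q'"
  shows "p' = p \<and> q' = q"
proof -
  obtain a b where ab: "p' = a *\<^sub>R p + b *\<^sub>R q" "0 \<le> a" "a \<le> 1" "0 \<le> b" "b \<le> 1" "1 \<le> a + b"
    using sector_coords[OF h s(1) critical_hexadD(1)[OF h']] by metis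
  obtain c d where cd: "q' = c *\<^sub>R p + d *\<^sub>R q" "0 \<le> c" "c \<le> 1" "0 \<le> d" "d \<le> 1" "1 \<le> c + d"
    using sector_coords[OF h s(2) critical_hexadD(2)[OF h']] by metis
  have "cross2 p' q' = (a * d - b * c) * cross2 p q"
    by (simp add: ab cd cross2_algebra cross2_swap[of q p] algebra_simps)
  then have det: "a * d - b * c = 1"
    using critical_hexadD(4)[OF h] critical_hexadD(4)[OF h'] critical_determinant_pos by simp
  have "a * d \<le> a" "a * d \<le> d" "0 \<le> b * c" using ab cd by (simp_all add: mult_left_le mult_left_le_one_le)
  then have "a = 1" "d = 1" "b * c = 0" using det ab cd by linarith+
  then consider "b = 0" | "c = 0" by auto
  then show ?thesis
  proof cases
    case 1
    then have "p' = p" using ab \<open>a = 1\<close> by simp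
    then show ?thesis using critical_hexad_uniq h h' by blast
  next
    case 2
    then have "q' = q" using cd \<open>d = 1\<close> by simp
    then show ?thesis using critical_hexad_inj h h' by blast
  qed
qed

text \<open>The map from a vertex to the next one preserves the cyclic order: if \<open>p'\<close> lies
  between \<open>p\<close> and \<open>q\<close>, then \<open>q'\<close> lies between \<open>q\<close>
  and \<open>q - p\<close>. In any other position two neighbouring vertices of one hexagon would be
  nested between two neighbouring vertices of the other.\<close>

lemma critical_hexad_sector_step:
  assumes h: "critical_hexad p q" and h': "critical_hexad p' q'" and s: "sector p q p'"
  shows "sector q (q - p) q'"
proof -
  obtain a b where ab: "p' = a *\<^sub>R p + b *\<^sub>R q" "0 \<le> a" "a \<le> 1" "0 \<le> b" "b \<le> 1" "1 \<le> a + b"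
    using sector_coords[OF h s(1) critical_hexadD(1)[OF h']] by metis
  obtain c d where cd: "q' = c *\<^sub>R p + d *\<^sub>R q" using critical_hexad_coords[OF h] by metis
  have D: "cross2 p q = \<Delta>" "cross2 q p = - \<Delta>" "\<Delta> > 0"
    using critical_hexadD(4)[OF h] cross2_swap[of q p] critical_determinant_pos by auto
  have "cross2 p' q' = (a * d - b * c) * cross2 p q"
    by (simp add: ab cd cross2_algebra cross2_swap[of q p] algebra_simps)
  then have det: "a * d - b * c = 1"
    using critical_hexadD(4)[OF h] critical_hexadD(4)[OF h'] critical_determinant_pos by simp
  have nz: "cross2 p q \<noteq> 0" using D by simp
  have r': "q' - p' = (c - a) *\<^sub>R p + (d - b) *\<^sub>R q" by (simp add: ab cd algebra_simps)
  have crosses: "cross2 (x *\<^sub>R p + y *\<^sub>R q) (z *\<^sub>R p + w *\<^sub>R q) = (x * w - y * z) * \<Delta>" for x y z w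
    by (simp add: cross2_algebra D algebra_simps)
  have sec: "sector p q (x *\<^sub>R p + y *\<^sub>R q)" if "0 \<le> x" "0 \<le> y" for x y
    using that D by (simp add: sector_def cross2_algebra)
  have sec3: "sector (q - p) (- p) (x *\<^sub>R p + y *\<^sub>R q)" if "0 \<le> y" "x + y \<le> 0" for x y
  proof -
    have "cross2 (q - p) (x *\<^sub>R p + y *\<^sub>R q) = - (x + y) * \<Delta>" "cross2 (x *\<^sub>R p + y *\<^sub>R q) (- p) = y * \<Delta>"
      by (simp_all add: cross2_algebra D algebra_simps)
    then show ?thesis using that D by (simp add: sector_def mult_nonpos_nonneg)
  qed
  have "c \<le> 0"
  proof (rule ccontr)
    assume "\<not> c \<le> 0"
    then have c: "c > 0" by simp
    have "a * d \<ge> 1" using det ab c by (smt (verit) mult_nonneg_nonneg)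
    then have "d > 0" using ab by (smt (verit) mult_nonneg_nonpos)
    then have "sector p q q'" using c sec cd by simp
    then have "q' = q" using critical_hexad_nested[OF h h' s] by simp
    then have "c *\<^sub>R p + d *\<^sub>R q = 0 *\<^sub>R p + 1 *\<^sub>R q" using cd by simp
    then show False using cross2_basis_unique(1)[OF nz] c by blast
  qed
  moreover have "0 \<le> c + d"
  proof (rule ccontr)
    assume "\<not> 0 \<le> c + d"
    then have neg: "c + d < 0" by simp
    have r_contra: False if "q' = q - p"
    proof -
      have "c *\<^sub>R p + d *\<^sub>R q = (-1) *\<^sub>R p + 1 *\<^sub>R q" using that cd by simp
      then show False using cross2_basis_unique[OF nz, of c d "-1" 1] neg by auto
    qed
    \<comment> \<open>The pairs that would be nested are \<open>(q', q' - p')\<close>, \<open>(p' - q', p')\<close> and \<open>(- q', p' - q')\<close>.\<close>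
    consider "0 \<le> d" "b \<le> d" | "0 \<le> d" "d < b" | "d < 0" by linarith
    then show False
    proof cases
      case 1
      then have "sector (q - p) (- p) q'" "sector (q - p) (- p) (q' - p')"
        unfolding r' using cd neg ab by (auto intro!: sec3)
      then have "q' = q - p" using critical_hexad_nested[OF critical_hexad_rotate2[OF h] critical_hexad_rotate[OF h']] by simp
      then show False by (rule r_contra)
    next
      case 2
      have "sector p q (- (q' - p'))"
      proof -
        have "- (q' - p') = (a - c) *\<^sub>R p + (b - d) *\<^sub>R q" unfolding r' by (simp add: algebra_simps)
        then show ?thesis using sec[of "a - c" "b - d"] 2 ab \<open>c \<le> 0\<close> by simp
      qed
      moreover have "critical_hexad (- (q' - p')) p'" using critical_hexad_uminus[OF critical_hexad_rotate2[OF h']] by simp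
      ultimately have "- (q' - p') = p \<and> p' = q" using critical_hexad_nested[OF h] s by blast
      then have "q' = q - p" by (auto simp: algebra_simps)
      then show False by (rule r_contra)
    next
      case 3
      have "sector p q (- q')"
      proof -
        have "- q' = (- c) *\<^sub>R p + (- d) *\<^sub>R q" by (simp add: cd)
        then show ?thesis using sec[of "- c" "- d"] 3 \<open>c \<le> 0\<close> by simp
      qed
      moreover have "sector p q (- (q' - p'))"
      proof -
        have "- (q' - p') = (a - c) *\<^sub>R p + (b - d) *\<^sub>R q" unfolding r' by (simp add: algebra_simps)
        then show ?thesis using sec[of "a - c" "b - d"] 3 ab \<open>c \<le> 0\<close> by simp
      qed
      ultimately have "- q' = p" using critical_hexad_nested[OF h critical_hexad_uminus[OF critical_hexad_rotate[OF h']]] by simp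
      then have "q' = - p" by auto
      then have "c *\<^sub>R p + d *\<^sub>R q = (-1) *\<^sub>R p + 0 *\<^sub>R q" using cd by simp
      then show False using cross2_basis_unique(2)[OF nz] 3 by blast
    qed
  qed
  moreover have "cross2 q q' = - c * \<Delta>" "cross2 q' (q - p) = (c + d) * \<Delta>"
    by (simp_all add: cd cross2_algebra D algebra_simps)
  ultimately show ?thesis using D by (simp add: sector_def mult_nonpos_nonneg)
qed

text \<open>Coordinates in the sectors of the first hexagon turn the claim into \<open>(1 - a) (c + d -
  1) \<le> b d\<close>, which follows factor by factor from \<open>a + b \<ge> 1\<close> and \<open>c
  \<le> 1\<close>. Consequently the determinant is a convex function of the time when both vertices move
  linearly, and so stays below its values at the ends.\<close>

lemma critical_hexad_increments_cross_nonneg: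
  assumes h: "critical_hexad p q" and h': "critical_hexad p' q'" and s: "sector p q p'"
  shows "0 \<le> cross2 (p' - p) (q' - q)"
proof -
  obtain a b where ab: "p' = a *\<^sub>R p + b *\<^sub>R q" "0 \<le> a" "a \<le> 1" "0 \<le> b" "b \<le> 1" "1 \<le> a + b"
    using sector_coords[OF h s(1) critical_hexadD(1)[OF h']] by metis
  obtain c d where cd: "q' = c *\<^sub>R q + d *\<^sub>R (q - p)" "0 \<le> c" "c \<le> 1" "0 \<le> d" "d \<le> 1" "1 \<le> c + d"
    using sector_coords[OF critical_hexad_rotate[OF h] critical_hexad_sector_step[OF h h' s] critical_hexadD(2)[OF h']] by metis
  have "cross2 (p' - p) (q' - q) = ((a - 1) * (c + d - 1) + b * d) * cross2 p q"
    by (simp add: ab cd cross2_algebra cross2_swap[of q p] algebra_simps)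
  moreover have "(1 - a) * (c + d - 1) \<le> b * d" using ab cd by (intro mult_mono) auto
  then have "0 \<le> (a - 1) * (c + d - 1) + b * d" by (simp add: algebra_simps)
  ultimately show ?thesis using critical_hexadD(5)[OF h] by simp
qed

definition critical_points :: "(real^2) set" where "critical_points = {p. \<exists>q. critical_hexad p q}"

text \<open>Both endpoints of a gap may themselves be critical; only the open cone is free of critical
  points. The notion is used for positively oriented \<open>u\<close>, \<open>v\<close>.\<close>

definition gap :: "real^2 \<Rightarrow> real^2 \<Rightarrow> bool" where
  "gap u v \<longleftrightarrow> \<not> (\<exists>x\<in>critical_points. cross2 u x > 0 \<and> cross2 x v > 0)"

text \<open>Rotation by one vertex carries gaps to gaps, because it is an order-preserving bijection of
  the set of critical points: a critical point between \<open>q0\<close> and \<open>q1\<close> would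
  have its predecessor between \<open>p0\<close> and \<open>p1\<close>.\<close>

lemma gap_step:
  assumes h0: "critical_hexad p0 q0" and h1: "critical_hexad p1 q1" and s: "sector p0 q0 p1" and pos: "cross2 p0 p1 > 0"
    and gap: "gap p0 p1"
  shows "cross2 q0 q1 > 0" "gap q0 q1"
proof -
  have s1: "sector q0 (q0 - p0) q1" by (rule critical_hexad_sector_step[OF h0 h1 s])
  have "q1 \<noteq> q0" using critical_hexad_inj h0 h1 pos by (force simp: cross2_algebra)
  then have "cross2 q0 q1 \<noteq> 0" using sector_start[OF critical_hexad_rotate[OF h0] s1 critical_hexadD(2)[OF h1]] by blast
  then show pos1: "cross2 q0 q1 > 0" using s1 by (simp add: sector_def)
  show "gap q0 q1" unfolding gap_def
  proof
    assume "\<exists>x\<in>critical_points. cross2 q0 x > 0 \<and> cross2 x q1 > 0"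
    then obtain x y where x: "critical_hexad x y" "cross2 q0 x > 0" "cross2 x q1 > 0" by (auto simp: critical_points_def)
    have D: "cross2 p0 q0 = \<Delta>" "cross2 q0 p0 = - \<Delta>" "\<Delta> > 0"
      using critical_hexadD(4)[OF h0] cross2_swap[of q0 p0] critical_determinant_pos by auto
    have "x = (cross2 x q1 / cross2 q0 q1) *\<^sub>R q0 + (cross2 q0 x / cross2 q0 q1) *\<^sub>R q1"
      using pos1 by (intro cross2_cramer) simp
    then have "cross2 x (q0 - p0) =
        (cross2 x q1 / cross2 q0 q1) * cross2 q0 (q0 - p0) + (cross2 q0 x / cross2 q0 q1) * cross2 q1 (q0 - p0)"
      by (metis cross2_algebra(1,5))
    also have "\<dots> \<ge> 0"
      using x pos1 s1 D by (intro add_nonneg_nonneg mult_nonneg_nonneg) (auto simp: sector_def cross2_algebra)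
    finally have sx: "sector q0 (q0 - p0) x" using x by (simp add: sector_def)
    have sy: "sector (q0 - p0) (- p0) y"
      using critical_hexad_sector_step[OF critical_hexad_rotate[OF h0] x(1) sx] by simp
    have "sector (- p0) (- q0) (y - x)"
      using critical_hexad_sector_step[OF critical_hexad_rotate2[OF h0] critical_hexad_rotate[OF x(1)] sy] by simp
    then have sp': "sector p0 q0 (x - y)" using sector_uminus[of p0 q0 "x - y"] by simp
    have hp': "critical_hexad (x - y) x" by (rule critical_hexad_back[OF x(1)])
    have "0 \<le> cross2 q1 y"
    proof -
      obtain a b where ab: "q1 = a *\<^sub>R q0 + b *\<^sub>R (q0 - p0)" "0 \<le> a" "0 \<le> b"
        using sector_coords[OF critical_hexad_rotate[OF h0] s1 critical_hexadD(2)[OF h1]] by metis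
      obtain c d where cd: "y = c *\<^sub>R (q0 - p0) + d *\<^sub>R (- p0)" "0 \<le> c" "0 \<le> d"
        using sector_coords[OF critical_hexad_rotate2[OF h0] sy critical_hexadD(2)[OF x(1)]] by metis
      have "cross2 q1 y = (a * c + a * d + b * d) * \<Delta>"
        by (simp add: ab(1) cd(1) cross2_algebra D algebra_simps)
      then show ?thesis using ab cd D by simp
    qed
    then have "sector x y q1" using x by (simp add: sector_def)
    then have "sector y (y - x) (q1 - p1)" by (rule critical_hexad_sector_step[OF x(1) critical_hexad_rotate[OF h1]])
    then have "sector (y - x) (- x) (- p1)"
      using critical_hexad_sector_step[OF critical_hexad_rotate[OF x(1)] critical_hexad_rotate2[OF h1]] by simp
    then have s2: "sector (x - y) x p1" using sector_uminus[of "x - y" x p1] by simp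
    have "cross2 p0 (x - y) \<noteq> 0"
    proof
      assume "cross2 p0 (x - y) = 0"
      then have "x - y = p0" using sector_start[OF h0 sp' critical_hexadD(1)[OF hp']] by blast
      then have "x = q0" using critical_hexad_uniq h0 hp' by auto
      then show False using x by (simp add: cross2_algebra)
    qed
    moreover have "cross2 (x - y) p1 \<noteq> 0"
    proof
      assume "cross2 (x - y) p1 = 0"
      then have "p1 = x - y" using sector_start[OF hp' s2 critical_hexadD(1)[OF h1]] by blast
      then have "x = q1" using critical_hexad_uniq h1 hp' by auto
      then show False using x by (simp add: cross2_algebra)
    qed
    ultimately have "cross2 p0 (x - y) > 0" "cross2 (x - y) p1 > 0"
      using sp' s2 by (auto simp: sector_def)
    then show False using gap hp' by (auto simp: gap_def critical_points_def)
  qed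
qed

lemma six_sectors:
  assumes h: "critical_hexad p q"
  obtains p' q' where "critical_hexad p' q'" "sector p' q' x"
    "p' \<in> {p, q, q - p, - p, - q, p - q}"
proof -
  obtain a b where ab: "x = a *\<^sub>R p + b *\<^sub>R q" "cross2 p x = b * \<Delta>" "cross2 x q = a * \<Delta>"
    using critical_hexad_coords[OF h] by metis
  have D: "cross2 p q = \<Delta>" "cross2 q p = - \<Delta>" "\<Delta> > 0"
    using critical_hexadD(4)[OF h] cross2_swap[of q p] critical_determinant_pos by auto
  have cr: "cross2 q x = - a * \<Delta>" "cross2 x (q - p) = (a + b) * \<Delta>"
    "cross2 (q - p) x = - (a + b) * \<Delta>" "cross2 x (- p) = b * \<Delta>"
    "cross2 (- p) x = - b * \<Delta>" "cross2 x (- q) = - a * \<Delta>"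
    "cross2 (- q) x = a * \<Delta>" "cross2 x (p - q) = - (a + b) * \<Delta>"
    "cross2 (p - q) x = (a + b) * \<Delta>" "cross2 x p = - b * \<Delta>"
    by (simp_all add: ab(1) cross2_algebra D algebra_simps)
  consider "0 \<le> a" "0 \<le> b" | "a \<le> 0" "0 \<le> a + b" | "0 \<le> b" "a + b \<le> 0"
    | "a \<le> 0" "b \<le> 0" | "0 \<le> a" "a + b \<le> 0" | "b \<le> 0" "0 \<le> a + b"
    by linarith
  then show ?thesis
  proof cases
    case 1 then show ?thesis using that[OF h] ab D by (simp add: sector_def)
  next
    case 2 then show ?thesis using that[OF critical_hexad_rotate[OF h]] cr D by (simp add: sector_def mult_nonpos_nonneg)
  next
    case 3 then show ?thesis using that[OF critical_hexad_rotate2[OF h]] cr D by (simp add: sector_def mult_nonpos_nonneg)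
  next
    case 4 then show ?thesis using that[OF critical_hexad_uminus[OF h]] cr D by (simp add: sector_def mult_nonpos_nonneg)
  next
    case 5 then show ?thesis using that[OF critical_hexad_uminus[OF critical_hexad_rotate[OF h]]] cr D by (simp add: sector_def mult_nonpos_nonneg)
  next
    case 6 then show ?thesis using that[OF critical_hexad_back[OF h]] cr D by (simp add: sector_def mult_nonpos_nonneg)
  qed
qed

end

section \<open>Critical boundary points of an irreducible domain\<close>

context bcs
begin

text \<open>The boundary arc from \<open>p\<close> to \<open>q\<close>, obtained by projecting the
  segment radially.\<close>

definition arc :: "real^2 \<Rightarrow> real^2 \<Rightarrow> real \<Rightarrow> real^2" where
  "arc p q t = inverse (N ((1 - t) *\<^sub>R p + t *\<^sub>R q)) *\<^sub>R ((1 - t) *\<^sub>R p + t *\<^sub>R q)"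

lemma arc_denominator_pos: "cross2 p q > 0 \<Longrightarrow> N ((1 - t) *\<^sub>R p + t *\<^sub>R q) > 0"
proof (rule minkowski_pos, rule notI)
  assume c: "cross2 p q > 0" and z: "(1 - t) *\<^sub>R p + t *\<^sub>R q = 0"
  have "(1 - t) *\<^sub>R p + t *\<^sub>R q = 0 *\<^sub>R p + 0 *\<^sub>R q" using z by simp
  then show False using cross2_basis_unique[of p q "1 - t" t 0 0] c by auto
qed

lemma minkowski_arc: "cross2 p q > 0 \<Longrightarrow> N (arc p q t) = 1"
  using arc_denominator_pos[of p q t] by (simp add: arc_def minkowski_scale)

lemma continuous_on_arc: "cross2 p q > 0 \<Longrightarrow> continuous_on S (arc p q)"
  unfolding arc_def using arc_denominator_pos[of p q]
  by (intro continuous_intros) (simp add: less_imp_neq[THEN not_sym])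

lemma arc_ends: "N p = 1 \<Longrightarrow> arc p q 0 = p" "N q = 1 \<Longrightarrow> arc p q 1 = q"
  by (simp_all add: arc_def)

lemma cross2_arc:
  assumes "cross2 p q > 0"
  obtains k where "k > 0" "cross2 (arc p q s) (arc p q t) = (t - s) * k"
proof -
  define k where "k = inverse (N ((1 - s) *\<^sub>R p + s *\<^sub>R q)) * inverse (N ((1 - t) *\<^sub>R p + t *\<^sub>R q)) * cross2 p q"
  have eq: "cross2 ((1 - s) *\<^sub>R p + s *\<^sub>R q) ((1 - t) *\<^sub>R p + t *\<^sub>R q) = (t - s) * cross2 p q"
    by (simp add: cross2_algebra cross2_swap[of q p] algebra_simps)
  have "cross2 (arc p q s) (arc p q t) = (t - s) * k"
    unfolding arc_def k_def by (simp only: cross2_algebra(5,6) eq) simp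
  moreover have "k > 0" using arc_denominator_pos[OF assms] assms by (simp add: k_def)
  ultimately show ?thesis using that by blast
qed

lemma cross2_arc_pos_iff: "cross2 p q > 0 \<Longrightarrow> cross2 (arc p q s) (arc p q t) > 0 \<longleftrightarrow> s < t"
  using cross2_arc[of p q s t] by (metis diff_gt_0_iff_gt zero_less_mult_pos2 mult_pos_pos)

lemma arc_covers_sector:
  assumes c: "cross2 p q > 0" and x: "sector p q x" "N x = 1"
  obtains t where "0 \<le> t" "t \<le> 1" "x = arc p q t"
proof -
  define a where "a = cross2 x q / cross2 p q"
  define b where "b = cross2 p x / cross2 p q"
  have xab: "x = a *\<^sub>R p + b *\<^sub>R q" unfolding a_def b_def by (rule cross2_cramer) (use c in simp)
  have ab: "0 \<le> a" "0 \<le> b" using x c by (simp_all add: a_def b_def sector_def)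
  have "x \<noteq> 0" using x by force
  then have "a + b \<noteq> 0" using xab ab by (auto simp: add_nonneg_eq_0_iff)
  then have s: "a + b > 0" using ab by simp
  define t where "t = b / (a + b)"
  have t: "0 \<le> t" "t \<le> 1" using ab s by (simp_all add: t_def)
  have "1 - t = a / (a + b)" using s by (simp add: t_def field_simps)
  then have "(1 - t) *\<^sub>R p + t *\<^sub>R q = inverse (a + b) *\<^sub>R x"
    by (simp add: xab t_def scaleR_add_right divide_inverse mult.commute)
  then have "arc p q t = x" using x s by (simp add: arc_def minkowski_scale)
  then show ?thesis using that t by blast
qed

lemma mem_cone_between:
  assumes "cross2 u v > 0" "cross2 u x > 0" "cross2 x v > 0" "0 \<le> cross2 p u" "0 \<le> cross2 p v"
  shows "0 \<le> cross2 p x"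
proof -
  have "x = (cross2 x v / cross2 u v) *\<^sub>R u + (cross2 u x / cross2 u v) *\<^sub>R v"
    using assms by (intro cross2_cramer) simp
  then have "cross2 p x = (cross2 x v / cross2 u v) * cross2 p u + (cross2 u x / cross2 u v) * cross2 p v"
    by (metis cross2_algebra(3,6))
  then show ?thesis using assms by simp
qed

end

context bcs_nonparallelogram
begin

lemma compact_critical_hexad: "compact {z. critical_hexad (fst z) (snd z)}"
proof -
  have "{z. critical_hexad (fst z) (snd z)} = ({x. N x \<le> 1} \<times> {x. N x \<le> 1}) \<inter>
      {z. N (fst z) = 1 \<and> N (snd z) = 1 \<and> N (snd z - fst z) = 1 \<and> cross2 (fst z) (snd z) = \<Delta>}"
    by (auto simp: critical_hexad_def hexad_def mem_Times_iff)
  also have "compact \<dots>"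
    by (intro compact_Int_closed compact_Times compact_minkowski_ball closed_Collect_conj closed_Collect_eq continuous_intros)
  finally show ?thesis .
qed

lemma compact_critical_points: "compact critical_points"
proof -
  have "critical_points = fst ` {z. critical_hexad (fst z) (snd z)}" by (auto simp: critical_points_def image_iff)
  then show ?thesis by (simp add: compact_continuous_image[OF _ compact_critical_hexad] continuous_on_fst continuous_on_id)
qed

lemma critical_hexad_in_critical_points: "critical_hexad p q \<Longrightarrow> p \<in> critical_points"
  by (auto simp: critical_points_def)

text \<open>If \<open>p\<close>, \<open>p0\<close>, \<open>x\<close>, \<open>q\<close> follow each other
  counterclockwise, then \<open>x\<close> also comes before the successor of \<open>p0\<close>, since
  that successor is not before \<open>q\<close>.\<close>

lemma sector_advance:
  assumes h: "critical_hexad p q" and h0: "critical_hexad p0 q0" and s: "sector p q p0" "sector p q x" and x: "N x = 1" "0 \<le> cross2 p0 x"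
  shows "sector p0 q0 x"
proof -
  have sq: "sector q (q - p) q0" by (rule critical_hexad_sector_step[OF h h0 s(1)])
  obtain a b where ab: "x = a *\<^sub>R p + b *\<^sub>R q" "0 \<le> a" "0 \<le> b"
    by (rule sector_coords[OF h s(2) x(1)])
  obtain d e where de: "q0 = d *\<^sub>R q + e *\<^sub>R (q - p)" "0 \<le> d" "0 \<le> e"
    by (rule sector_coords[OF critical_hexad_rotate[OF h] sq critical_hexadD(2)[OF h0]])
  have "cross2 x q0 = (a * d + a * e + b * e) * cross2 p q"
    by (simp add: ab de cross2_algebra cross2_swap[of q p] algebra_simps)
  then show ?thesis using x(2) ab de critical_hexadD(5)[OF h] by (simp add: sector_def)
qed

text \<open>Critical points form a compact set, so on the arc between two neighbouring critical vertices
  there is a last one before \<open>x\<close> and a first one after \<open>x\<close>.\<close>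

lemma gap_around:
  assumes h: "critical_hexad p q" and x: "N x = 1" "sector p q x" "x \<notin> critical_points"
  obtains p0 p1 q0 where "critical_hexad p0 q0" "p1 \<in> critical_points" "sector p0 q0 p1" "gap p0 p1" "cross2 p0 x > 0" "cross2 x p1 > 0"
proof -
  have c: "cross2 p q > 0" by (rule critical_hexadD[OF h])
  obtain s where s: "0 \<le> s" "s \<le> 1" "x = arc p q s" using arc_covers_sector[OF c x(2,1)] by blast
  have "closed (arc p q -` critical_points)"
    using compact_critical_points continuous_on_arc[OF c] by (intro closed_vimage) (auto simp: compact_imp_closed)
  then have cT: "compact ({a..b} \<inter> arc p q -` critical_points)" for a b by (intro compact_Int_closed) auto
  have ends: "0 \<in> {0..s} \<inter> arc p q -` critical_points" "1 \<in> {s..1} \<inter> arc p q -` critical_points"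
    using s arc_ends critical_hexadD[OF h] critical_hexad_in_critical_points[OF h] critical_hexad_in_critical_points[OF critical_hexad_rotate[OF h]] by auto
  obtain t0 where t0: "t0 \<in> {0..s} \<inter> arc p q -` critical_points" "\<And>t. t \<in> {0..s} \<inter> arc p q -` critical_points \<Longrightarrow> t \<le> t0"
    using compact_attains_sup[OF cT[of 0 s]] ends by blast
  obtain t1 where t1: "t1 \<in> {s..1} \<inter> arc p q -` critical_points" "\<And>t. t \<in> {s..1} \<inter> arc p q -` critical_points \<Longrightarrow> t1 \<le> t"
    using compact_attains_inf[OF cT[of s 1]] ends by blast
  have m0: "0 \<le> t0" "t0 \<le> s" "arc p q t0 \<in> critical_points" and m1: "s \<le> t1" "t1 \<le> 1" "arc p q t1 \<in> critical_points"
    using t0(1) t1(1) by simp_all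
  have max0: "t \<le> t0" if "0 \<le> t" "t \<le> s" "arc p q t \<in> critical_points" for t by (rule t0(2)) (use that in simp)
  have min1: "t1 \<le> t" if "s \<le> t" "t \<le> 1" "arc p q t \<in> critical_points" for t by (rule t1(2)) (use that in simp)
  have "t0 \<noteq> s" "t1 \<noteq> s" using m0(3) m1(3) x(3) s(3) by metis+
  then have lt: "t0 < s" "s < t1" using m0 m1 by simp_all
  define p0 p1 where "p0 = arc p q t0" "p1 = arc p q t1"
  have pE: "p0 \<in> critical_points" "p1 \<in> critical_points" using m0 m1 by (simp_all add: p0_p1_def)
  obtain q0 where q0: "critical_hexad p0 q0" using pE(1) unfolding critical_points_def by blast
  have cr: "cross2 p0 x > 0" "cross2 x p1 > 0" "cross2 p0 p1 > 0"
    using lt c by (simp_all add: p0_p1_def s(3) cross2_arc_pos_iff)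
  have arc_sec: "sector p q (arc p q t)" if t: "0 \<le> t" "t \<le> 1" for t
  proof -
    have "0 \<le> cross2 (arc p q 0) (arc p q t)" "0 \<le> cross2 (arc p q t) (arc p q 1)"
    proof -
      obtain k where "k > 0" "cross2 (arc p q 0) (arc p q t) = (t - 0) * k" by (rule cross2_arc[OF c])
      then show "0 \<le> cross2 (arc p q 0) (arc p q t)" using t by simp
      obtain k where "k > 0" "cross2 (arc p q t) (arc p q 1) = (1 - t) * k" by (rule cross2_arc[OF c])
      then show "0 \<le> cross2 (arc p q t) (arc p q 1)" using t by simp
    qed
    then show ?thesis using arc_ends critical_hexadD[OF h] by (simp add: sector_def)
  qed
  have sec: "sector p q p0" "sector p q p1" using m0 m1 s(1,2) by (simp_all add: p0_p1_def arc_sec)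
  have "sector p0 q0 p1"
    by (rule sector_advance[OF h q0 sec]) (use cr(3) minkowski_arc[OF c] in \<open>simp_all add: p0_p1_def\<close>)
  moreover have "gap p0 p1" unfolding gap_def
  proof
    assume "\<exists>y\<in>critical_points. cross2 p0 y > 0 \<and> cross2 y p1 > 0"
    then obtain y where y: "y \<in> critical_points" "cross2 p0 y > 0" "cross2 y p1 > 0" by blast
    have "0 \<le> cross2 p y"
      by (rule mem_cone_between[of p0 p1]) (use sec y(2,3) cr in \<open>simp_all add: sector_def\<close>)
    moreover have "0 \<le> cross2 (- q) y"
      by (rule mem_cone_between[of p0 p1])
        (use sec y(2,3) cr in \<open>simp_all add: sector_def cross2_algebra cross2_swap[of p0 q] cross2_swap[of p1 q]\<close>)
    ultimately have "sector p q y" by (simp add: sector_def cross2_algebra cross2_swap[of y q])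
    moreover have "N y = 1" using y(1) critical_hexadD(1)[of y] unfolding critical_points_def by blast
    ultimately obtain t where t: "0 \<le> t" "t \<le> 1" "y = arc p q t" using arc_covers_sector[OF c] by blast
    have "t0 < t" "t < t1" using y c by (simp_all add: t p0_p1_def cross2_arc_pos_iff)
    moreover have "t \<le> t0 \<or> t1 \<le> t"
      using max0[of t] min1[of t] t(1,2) y(1) unfolding t(3) by linarith
    ultimately show False by linarith
  qed
  ultimately show ?thesis using that[OF q0 pE(2)] cr by blast
qed

text \<open>Suppose that every gap is spanned by a straight boundary segment. A boundary point
  \<open>x\<close> that is not critical lies in a gap from \<open>p0\<close> to \<open>p1\<close>, and
  rotation gives two more gaps. On the three boundary segments the hexagons over \<open>p0\<close> and
  \<open>p1\<close> can be interpolated linearly through hexagons. Along the interpolation their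
  determinant is convex: it equals \<open>\<Delta>\<close> minus a nonnegative multiple of \<open>t (1 -
  t)\<close>. Being at least \<open>\<Delta>\<close>, it equals \<open>\<Delta>\<close>, and
  \<open>x\<close> is critical after all.\<close>

lemma all_critical:
  assumes G: "\<And>u v t. N u = 1 \<Longrightarrow> N v = 1 \<Longrightarrow> cross2 u v > 0 \<Longrightarrow> gap u v \<Longrightarrow> 0 \<le> t \<Longrightarrow> t \<le> 1 \<Longrightarrow>
      N ((1 - t) *\<^sub>R u + t *\<^sub>R v) \<ge> 1"
    and x: "N x = 1"
  shows "x \<in> critical_points"
proof (rule ccontr)
  assume xE: "x \<notin> critical_points"
  obtain p q where h: "critical_hexad p q" and sx: "sector p q x" using exists_critical_hexad six_sectors[of _ _ x] by metis
  obtain p0 p1 q0 where h0: "critical_hexad p0 q0" and p1: "p1 \<in> critical_points" and s: "sector p0 q0 p1" and gap: "gap p0 p1"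
    and cr: "cross2 p0 x > 0" "cross2 x p1 > 0"
    using gap_around[OF h x sx xE] by metis
  obtain q1 where h1: "critical_hexad p1 q1" using p1 by (auto simp: critical_points_def)
  have "cross2 p0 p1 \<noteq> 0"
  proof
    assume "cross2 p0 p1 = 0"
    then have "p1 = p0" using sector_start[OF h0 s critical_hexadD(1)[OF h1]] by blast
    then show False using cr cross2_swap[of x p0] by simp
  qed
  then have c01: "cross2 p0 p1 > 0" using s by (simp add: sector_def)
  note g1 = gap_step[OF h0 h1 s c01 gap]
  have s1: "sector q0 (q0 - p0) q1" by (rule critical_hexad_sector_step[OF h0 h1 s])
  note g2 = gap_step[OF critical_hexad_rotate[OF h0] critical_hexad_rotate[OF h1] s1 g1]
  have one: "N ((1 - t) *\<^sub>R u + t *\<^sub>R v) = 1"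
    if "N u = 1" "N v = 1" "cross2 u v > 0" "gap u v" "0 \<le> t" "t \<le> 1" for u v t
    using G[OF that] minkowski_combination[of "1 - t" t u v] that by simp
  define a where "a = cross2 x p1 / cross2 p0 p1"
  define t where "t = cross2 p0 x / cross2 p0 p1"
  have xat: "x = a *\<^sub>R p0 + t *\<^sub>R p1" unfolding a_def t_def by (rule cross2_cramer) (use c01 in simp)
  have at: "a > 0" "t > 0" using cr c01 by (simp_all add: a_def t_def)
  have "a + t = 1"
  proof -
    have "x = (a + t) *\<^sub>R ((1 - t / (a + t)) *\<^sub>R p0 + (t / (a + t)) *\<^sub>R p1)"
    proof -
      have "(a + t) * (1 - t / (a + t)) = a" "(a + t) * (t / (a + t)) = t" using at by (simp_all add: field_simps)
      then show ?thesis by (simp only: xat scaleR_add_right scaleR_scaleR)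
    qed
    then have "N x = (a + t) * N ((1 - t / (a + t)) *\<^sub>R p0 + (t / (a + t)) *\<^sub>R p1)"
      using at by (metis minkowski_scale abs_of_pos add_pos_pos)
    also have "\<dots> = a + t" using one[OF critical_hexadD(1)[OF h0] critical_hexadD(1)[OF h1] c01 gap, of "t / (a + t)"] at by simp
    finally show ?thesis using x by simp
  qed
  then have a: "a = 1 - t" "t \<le> 1" using at by simp_all
  define y where "y = (1 - t) *\<^sub>R q0 + t *\<^sub>R q1"
  have x2: "x = (1 - t) *\<^sub>R p0 + t *\<^sub>R p1" using xat a by simp
  have yx: "y - x = (1 - t) *\<^sub>R (q0 - p0) + t *\<^sub>R (q1 - p1)" by (simp add: y_def x2 algebra_simps)
  have hex: "hexad x y"
    unfolding hexad_def yx using x at a one[OF critical_hexadD(2)[OF h0] critical_hexadD(2)[OF h1] g1]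
      one[OF critical_hexadD(3)[OF h0] critical_hexadD(3)[OF h1] g2] by (simp add: y_def)
  have c1: "0 \<le> cross2 p1 q0" using s by (simp add: sector_def)
  have c2: "0 \<le> cross2 p0 q1"
  proof -
    obtain d e where de: "q1 = d *\<^sub>R q0 + e *\<^sub>R (q0 - p0)" "0 \<le> d" "0 \<le> e"
      using sector_coords[OF critical_hexad_rotate[OF h0] s1 critical_hexadD(2)[OF h1]] by metis
    have "cross2 p0 q1 = (d + e) * cross2 p0 q0" by (simp add: de(1) cross2_algebra algebra_simps)
    then show ?thesis using de critical_hexadD(5)[OF h0] by simp
  qed
  have "cross2 x y = (1-t)*(1-t) * cross2 p0 q0 + t*t * cross2 p1 q1 + t*(1-t) * (cross2 p0 q1 + cross2 p1 q0)"
    by (simp add: x2 y_def cross2_algebra algebra_simps)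
  then have exp: "cross2 x y = (1-t)*(1-t) * \<Delta> + t*t * \<Delta> + t*(1-t) * (cross2 p0 q1 + cross2 p1 q0)"
    by (simp add: critical_hexadD(4)[OF h0] critical_hexadD(4)[OF h1])
  have nonneg: "0 \<le> cross2 x y"
    unfolding exp using c1 c2 at a critical_determinant_pos by (intro add_nonneg_nonneg mult_nonneg_nonneg) auto
  have "cross2 (p1 - p0) (q1 - q0) = 2 * \<Delta> - (cross2 p0 q1 + cross2 p1 q0)"
    by (simp add: cross2_algebra critical_hexadD(4)[OF h0] critical_hexadD(4)[OF h1])
  then have "cross2 p0 q1 + cross2 p1 q0 \<le> 2 * \<Delta>"
    using critical_hexad_increments_cross_nonneg[OF h0 h1 s] by simp
  then have "t*(1-t) * (cross2 p0 q1 + cross2 p1 q0) \<le> t*(1-t) * (2 * \<Delta>)"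
    using at a by (intro mult_left_mono) auto
  then have "cross2 x y \<le> \<Delta>" unfolding exp by (simp add: algebra_simps)
  moreover have "\<Delta> \<le> cross2 x y" using critical_determinant_le_hexad[OF hex] nonneg by simp
  ultimately have "critical_hexad x y" using hex by (simp add: critical_hexad_def)
  then show False using xE by (auto simp: critical_points_def)
qed

end

lemma minkowski_antimono:
  assumes "bcs_domain H" "bcs_domain H'" "H' \<subseteq> H"
  shows "minkowski H x \<le> minkowski H' x"
proof (rule field_le_epsilon)
  fix e :: real assume e: "e > 0"
  interpret A: bcs H by unfold_locales fact
  interpret B: bcs H' by unfold_locales fact
  have pos: "minkowski H' x + e > 0" using e B.minkowski_nonneg[of x] by simp
  have "inverse (minkowski H' x + e) *\<^sub>R x \<in> H'" using B.minkowski_less_iff[OF pos, of x] e by simp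
  then have "minkowski H x < minkowski H' x + e" using A.minkowski_less_iff[OF pos, of x] assms(3) by auto
  then show "minkowski H x \<le> minkowski H' x + e" by simp
qed

lemma bcs_domain_Int_strip:
  assumes "bcs_domain H" "m > 0"
  shows "bcs_domain {x \<in> H. \<bar>k \<bullet> x\<bar> < m}" (is "bcs_domain ?S")
proof -
  interpret bcs H by unfold_locales fact
  have S: "?S = H \<inter> {x. k \<bullet> x < m} \<inter> {x. k \<bullet> x > - m}" by auto
  have "open ?S" unfolding S by (intro open_Int open_H open_halfspace_lt open_halfspace_gt)
  moreover have "convex ?S" unfolding S by (intro convex_Int convex_H convex_halfspace_lt convex_halfspace_gt)
  moreover have "0 \<in> ?S" using zero_in_H assms by simp
  moreover have "- x \<in> ?S" if "x \<in> ?S" for x using that uminus_H by auto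
  then have "uminus ` ?S = ?S" by (metis (no_types, lifting) image_subset_iff subsetI subset_antisym minus_minus image_eqI)
  moreover have "bounded ?S" using bounded_H by (rule bounded_subset) auto
  ultimately show ?thesis unfolding bcs_domain_def symmetric_domain_def
    using convex_connected by auto
qed

context bcs_nonparallelogram
begin

text \<open>Suppose that the segment from \<open>u\<close> to \<open>v\<close> enters the open domain,
  and let \<open>k\<close> be the functional with value \<open>1\<close> at \<open>u\<close> and
  \<open>v\<close>. Its maximum \<open>M\<close> on the closed domain exceeds \<open>1\<close>, and
  where its value exceeds \<open>1\<close> the closed domain lies in the open cone of \<open>u\<close>
  and \<open>v\<close>. Cutting off the points with \<open>\<bar>k \<bullet> x\<bar> \<ge> m\<close>,
  for \<open>m < M\<close> close to \<open>M\<close>, lowers the critical determinant by irreducibility,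
  so a critical hexagon of the truncated domain has a vertex in the part removed. As \<open>m\<close>
  tends to \<open>M\<close>, these hexagons accumulate at a critical hexagon of \<open>H\<close> with a
  vertex in the open cone.\<close>

lemma irreducible_no_gap:
  assumes irr: "irreducible_domain H"
    and uv: "N u = 1" "N v = 1" "cross2 u v > 0" and t: "0 \<le> t" "t \<le> 1" "N ((1 - t) *\<^sub>R u + t *\<^sub>R v) < 1"
  shows "\<not> gap u v"
proof -
  define k :: "real^2" where "k = inverse (cross2 u v) *\<^sub>R vector [v$2 - u$2, u$1 - v$1]"
  have f: "k \<bullet> x = (cross2 x v + cross2 u x) / cross2 u v" for x
  proof -
    have "k \<bullet> x = inverse (cross2 u v) * ((v$2 - u$2) * x$1 + (u$1 - v$1) * x$2)"
      by (simp add: k_def inner_vec_def sum_2 distrib_left)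
    also have "(v$2 - u$2) * x$1 + (u$1 - v$1) * x$2 = cross2 x v + cross2 u x"
      by (simp add: cross2_def algebra_simps)
    finally show ?thesis by (simp add: divide_inverse mult.commute)
  qed
  have fuv: "k \<bullet> u = 1" "k \<bullet> v = 1" using uv by (simp_all add: f cross2_algebra)
  have "continuous_on {x. N x \<le> 1} (\<lambda>x. k \<bullet> x)" by (intro continuous_intros)
  moreover have "0 \<in> {x. N x \<le> 1}" by simp
  then have "{x. N x \<le> 1} \<noteq> {}" by blast
  ultimately obtain x0 where x0: "N x0 \<le> 1" "\<And>x. N x \<le> 1 \<Longrightarrow> k \<bullet> x \<le> k \<bullet> x0"
    using continuous_attains_sup[OF compact_minkowski_ball[of 1]] by (metis (mono_tags, lifting) mem_Collect_eq)
  define M where "M = k \<bullet> x0"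
  have fM1: "k \<bullet> x \<le> M * N x" for x
  proof (cases "x = 0")
    case False
    then have Nx: "N x > 0" by (rule minkowski_pos)
    have "N (inverse (N x) *\<^sub>R x) \<le> 1" using Nx by (simp add: minkowski_scale)
    then have "k \<bullet> (inverse (N x) *\<^sub>R x) \<le> M" unfolding M_def by (rule x0(2))
    then show ?thesis using Nx by (simp add: field_simps)
  qed simp
  have fM: "\<bar>k \<bullet> x\<bar> \<le> M * N x" for x using fM1[of x] fM1[of "- x"] by simp
  have M1: "M > 1"
  proof -
    define w where "w = (1 - t) *\<^sub>R u + t *\<^sub>R v"
    have kw: "k \<bullet> w = 1" by (simp add: w_def inner_add_right fuv)
    then have "1 \<le> M * N w" using fM1[of w] by simp
    moreover have "N w > 0" using kw by (intro minkowski_pos) auto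
    moreover have "N w < 1" using t by (simp add: w_def)
    ultimately show ?thesis by (smt (verit) mult_left_le_one_le mult_le_cancel_right2)
  qed
  have cone: "cross2 u x > 0 \<and> cross2 x v > 0" if x: "N x \<le> 1" "k \<bullet> x > 1" for x
  proof -
    define a where "a = cross2 x v / cross2 u v"
    define b where "b = cross2 u x / cross2 u v"
    have xab: "x = a *\<^sub>R u + b *\<^sub>R v" unfolding a_def b_def by (rule cross2_cramer) (use uv in simp)
    have ab: "a + b > 1" using x(2) by (simp add: f a_def b_def add_divide_distrib)
    have "N (a *\<^sub>R u) \<le> N x + N (b *\<^sub>R v)" "N (b *\<^sub>R v) \<le> N x + N (a *\<^sub>R u)"
      using minkowski_triangle_diff[of x "b *\<^sub>R v"] minkowski_triangle_diff[of x "a *\<^sub>R u"] by (simp_all add: xab)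
    then have "\<bar>a\<bar> \<le> 1 + \<bar>b\<bar>" "\<bar>b\<bar> \<le> 1 + \<bar>a\<bar>" using x(1) uv by (simp_all add: minkowski_scale)
    then have "a > 0" "b > 0" using ab by linarith+
    then show ?thesis using uv by (auto simp: a_def b_def zero_less_divide_iff)
  qed
  \<comment> \<open>Instead of a limit of hexagons, \<open>g\<close> is maximised over a compact set: \<open>g z \<ge> m\<close> says that \<open>fst z\<close> reaches the part cut off at level \<open>m\<close> while the other two vertices have norm at least \<open>m / M\<close>.\<close>
  define Z where "Z = {z. N (fst z) \<le> 1 \<and> N (snd z) \<le> 1 \<and> N (snd z - fst z) \<le> 1 \<and> \<bar>cross2 (fst z) (snd z)\<bar> \<le> \<Delta>}"
  define g where "g z = min (k \<bullet> fst z) (min (M * N (snd z)) (M * N (snd z - fst z)))" for z :: "(real^2) \<times> (real^2)"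
  have "compact Z"
  proof -
    have "Z = ({x. N x \<le> 1} \<times> {x. N x \<le> 1}) \<inter> {z. N (snd z - fst z) \<le> 1 \<and> \<bar>cross2 (fst z) (snd z)\<bar> \<le> \<Delta>}"
      by (auto simp: Z_def mem_Times_iff)
    also have "compact \<dots>"
      by (intro compact_Int_closed compact_Times compact_minkowski_ball closed_Collect_conj closed_Collect_le continuous_intros)
    finally show ?thesis .
  qed
  moreover have "continuous_on Z g" unfolding g_def by (intro continuous_intros)
  moreover have near: "\<exists>z\<in>Z. m \<le> g z" if m: "1 < m" "m < M" for m
  proof -
    define H' where "H' = {x \<in> H. \<bar>k \<bullet> x\<bar> < m}"
    have H': "bcs_domain H'" unfolding H'_def using bcs m by (intro bcs_domain_Int_strip) auto
    interpret B: bcs H' by unfold_locales (rule H')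
    have "H' \<subset> H"
    proof -
      have "(m / M) *\<^sub>R x0 \<in> H" using x0(1) m minkowski_nonneg[of x0]
        by (simp add: mem_H_iff minkowski_scale) (smt (verit) divide_less_eq_1_pos mult_left_le zero_le_divide_iff)
      moreover have "(m / M) *\<^sub>R x0 \<notin> H'" using m M1 by (simp add: H'_def M_def[symmetric])
      moreover have "H' \<subseteq> H" by (auto simp: H'_def)
      ultimately show ?thesis by blast
    qed
    then have lt: "B.\<Delta> < \<Delta>" using irr H' unfolding irreducible_domain_def by blast
    have le: "N y \<le> minkowski H' y" for y by (rule minkowski_antimono[OF bcs H']) (auto simp: H'_def)
    have dich: "N y = 1 \<or> m \<le> \<bar>k \<bullet> y\<bar>" "m \<le> M * N y" "N y \<le> 1" if y: "minkowski H' y = 1" for y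
    proof -
      show l: "N y \<le> 1" using le[of y] y by simp
      have "y \<notin> H'" using y B.mem_H_iff by auto
      then show d: "N y = 1 \<or> m \<le> \<bar>k \<bullet> y\<bar>" using l by (auto simp: H'_def mem_H_iff)
      then show "m \<le> M * N y" using fM[of y] m by auto
    qed
    obtain p q where pq: "B.critical_hexad p q" using B.exists_critical_hexad by blast
    have good: "\<exists>z\<in>Z. m \<le> g z" if h: "B.hexad p q" "\<bar>cross2 p q\<bar> \<le> \<Delta>" "m \<le> \<bar>k \<bullet> p\<bar>" for p q
    proof -
      have "\<exists>z\<in>Z. m \<le> g z" if "minkowski H' p = 1" "minkowski H' q = 1" "minkowski H' (q - p) = 1" "\<bar>cross2 p q\<bar> \<le> \<Delta>" "m \<le> k \<bullet> p" for p q
        using that dich by (intro bexI[of _ "(p,q)"]) (auto simp: g_def Z_def)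
      from this[of p q] this[of "-p" "-q"] show ?thesis
        using h by (cases "k \<bullet> p \<ge> 0") (auto simp: B.hexad_def cross2_algebra B.minkowski_minus_commute[of p q])
    qed
    have c: "\<bar>cross2 p q\<bar> \<le> \<Delta>" "\<not> hexad p q"
      using pq lt B.critical_determinant_pos critical_determinant_le_hexad[of p q] by (auto simp: B.critical_hexad_def)
    have hB: "B.hexad p q" using pq by (simp add: B.critical_hexad_def)
    have "m \<le> \<bar>k \<bullet> p\<bar> \<or> m \<le> \<bar>k \<bullet> q\<bar> \<or> m \<le> \<bar>k \<bullet> (q - p)\<bar>"
      using c(2) hB dich(1)[of p] dich(1)[of q] dich(1)[of "q - p"] by (auto simp: B.hexad_def hexad_def)
    moreover have "\<bar>cross2 q (q - p)\<bar> \<le> \<Delta>" "\<bar>cross2 (q - p) (- p)\<bar> \<le> \<Delta>"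
      using c(1) cross2_swap[of q p] by (simp_all add: cross2_algebra)
    moreover have "B.hexad (q - p) (- p)" using B.hexad_rotate[OF B.hexad_rotate[OF hB]] by simp
    ultimately show ?thesis using good[OF hB c(1)] good[OF B.hexad_rotate[OF hB]] good[of "q - p" "- p"] by blast
  qed
  moreover have "Z \<noteq> {}" using near[of "(1 + M) / 2"] M1 by auto
  ultimately obtain z where z: "z \<in> Z" "\<And>w. w \<in> Z \<Longrightarrow> g w \<le> g z"
    using continuous_attains_sup[of Z g] by blast
  have "M \<le> g z"
  proof (rule ccontr)
    assume "\<not> M \<le> g z"
    define m where "m = max ((1 + M) / 2) ((g z + M) / 2)"
    have m: "1 < m" "m < M" "g z < m" using M1 \<open>\<not> M \<le> g z\<close> by (auto simp: m_def less_max_iff_disj field_simps)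
    obtain w where "w \<in> Z" "m \<le> g w" using near[OF m(1,2)] by blast
    then show False using z(2)[of w] m(3) by simp
  qed
  then have gz: "M \<le> k \<bullet> fst z" "M * 1 \<le> M * N (snd z)" "M * 1 \<le> M * N (snd z - fst z)" by (simp_all add: g_def)
  then have "M * 1 \<le> M * N (fst z)" using fM1[of "fst z"] by simp
  then have "N (fst z) = 1" "N (snd z) = 1" "N (snd z - fst z) = 1"
    using gz M1 z(1) by (auto simp: Z_def intro!: antisym)
  then have hex: "hexad (fst z) (snd z)" by (simp add: hexad_def)
  then have "\<bar>cross2 (fst z) (snd z)\<bar> = \<Delta>"
    using critical_determinant_le_hexad z(1) by (fastforce simp: Z_def)
  then have "critical_hexad (fst z) (snd z) \<or> critical_hexad (fst z) (fst z - snd z)"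
    using hex by (auto simp: critical_hexad_def hexad_def abs_if cross2_algebra minkowski_minus_commute[of "fst z" "snd z"] split: if_splits)
  then have "fst z \<in> critical_points" by (auto simp: critical_points_def)
  moreover have "cross2 u (fst z) > 0 \<and> cross2 (fst z) v > 0"
    using cone[of "fst z"] gz(1) M1 z(1) by (auto simp: Z_def)
  ultimately show ?thesis by (auto simp: gap_def)
qed

lemma irreducible_all_critical:
  assumes "irreducible_domain H" "N x = 1"
  obtains y where "critical_hexad x y"
proof -
  have "x \<in> critical_points"
    by (rule all_critical[OF _ assms(2)]) (use irreducible_no_gap[OF assms(1)] in force)
  then show ?thesis using that by (auto simp: critical_points_def)
qed

end

section \<open>The topology of the space of lattices\<close>

lemma continuous_on_column: "continuous_on S f \<Longrightarrow> continuous_on S (\<lambda>x. column i (f x :: real^2^2))"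
  unfolding column_def by (intro continuous_intros)

lemma continuous_on_cols:
  assumes "continuous_on S f" "continuous_on S g"
  shows "continuous_on S (\<lambda>x. cols (f x) (g x))"
  unfolding cols_def
proof (intro continuous_on_vec_lambda)
  show "continuous_on S (\<lambda>x. if j = 1 then f x $ i else g x $ i)" for i j :: 2
    using assms by (cases "j = 1") (auto intro!: continuous_on_component)
qed

text \<open>For fixed integer coordinates the lattice point depends continuously on the matrix.\<close>

lemma openin_lattices_meeting:
  assumes "open U"
  shows "openin lattice_space {L. is_lattice L \<and> L \<inter> U \<noteq> {}}"
proof -
  define T where "T = (\<Union>(m::int). \<Union>(n::int).
    (\<lambda>g::real^2^2. of_int m *\<^sub>R column 1 g + of_int n *\<^sub>R column 2 g) -` U)"
  have "open T" unfolding T_def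
    by (intro open_UN ballI open_vimage assms continuous_intros continuous_on_column)
  moreover have "{g \<in> GL2. lattice_of g \<in> {L. is_lattice L \<and> L \<inter> U \<noteq> {}}} = GL2 \<inter> T"
  proof -
    have "lattice_of g \<inter> U \<noteq> {} \<longleftrightarrow> g \<in> T" for g
      unfolding T_def lattice_of_columns lat_def by blast
    then show ?thesis unfolding is_lattice_def by blast
  qed
  ultimately show ?thesis by (auto simp: openin_lattice_space openin_open_Int)
qed

text \<open>Locally in the matrix, Cramer's rule bounds the integer coordinates of all lattice points in
  \<open>C\<close>, so only finitely many closed conditions have to be avoided.\<close>

lemma openin_lattices_missing:
  assumes "compact C"
  shows "openin lattice_space {L. is_lattice L \<and> L \<inter> C = {}}"
proof -
  define S where "S = {g \<in> GL2. lattice_of g \<inter> C = {}}"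
  obtain R where R: "R > 0" "\<And>x. x \<in> C \<Longrightarrow> norm x \<le> R"
    using assms compact_imp_bounded bounded_pos by metis
  have "\<forall>g0\<in>S. \<exists>T. open T \<and> g0 \<in> T \<and> T \<subseteq> S"
  proof
    fix g0 assume g0: "g0 \<in> S"
    define d where "d = \<bar>cross2 (column 1 g0) (column 2 g0)\<bar> / 2"
    define B where "B = norm (column 1 g0) + norm (column 2 g0) + 1"
    have d: "d > 0" using g0 by (simp add: S_def GL2_columns d_def)
    define W where "W = {g :: real^2^2. d < \<bar>cross2 (column 1 g) (column 2 g)\<bar> \<and> norm (column 1 g) < B \<and> norm (column 2 g) < B}"
    have "open W" unfolding W_def
      by (intro open_Collect_conj open_Collect_less continuous_intros continuous_on_column)
    define k where "k = \<lceil>2 * R * B / d\<rceil>"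
    define T where "T = W \<inter> (\<Inter>m\<in>{-k..k}. \<Inter>n\<in>{-k..k}.
      (\<lambda>g::real^2^2. of_int m *\<^sub>R column 1 g + of_int n *\<^sub>R column 2 g) -` (- C))"
    have "open T" unfolding T_def
      by (intro open_Int \<open>open W\<close> open_INT ballI open_vimage open_Compl compact_imp_closed assms
          continuous_intros continuous_on_column) auto
    moreover have "g0 \<in> T"
    proof -
      have "g0 \<in> W" using d norm_ge_zero[of "column 1 g0"] norm_ge_zero[of "column 2 g0"]
        by (simp add: W_def d_def B_def add_nonneg_pos add_pos_nonneg)
      moreover have "of_int m *\<^sub>R column 1 g0 + of_int n *\<^sub>R column 2 g0 \<notin> C" for m n
        using g0 lat_mem[of m "column 1 g0" n "column 2 g0"] by (auto simp: S_def lattice_of_columns)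
      ultimately show ?thesis by (simp add: T_def)
    qed
    moreover have "T \<subseteq> S"
    proof
      fix g assume g: "g \<in> T"
      define p q where "p = column 1 g" "q = column 2 g"
      have W: "d < \<bar>cross2 p q\<bar>" "norm p < B" "norm q < B" using g by (simp_all add: T_def W_def p_q_def)
      have bound: "m \<in> {-k..k}" if "\<bar>of_int m * cross2 p q\<bar> \<le> 2 * R * B" for m :: int
      proof -
        have "\<bar>of_int m\<bar> * d \<le> \<bar>of_int m\<bar> * \<bar>cross2 p q\<bar>" using W by (intro mult_left_mono) auto
        then have "\<bar>of_int m\<bar> * d \<le> 2 * R * B" using that by (simp add: abs_mult)
        then have "of_int \<bar>m\<bar> \<le> 2 * R * B / d" using d by (simp add: field_simps)
        then have "\<bar>m\<bar> \<le> k" unfolding k_def by linarith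
        then show ?thesis by auto
      qed
      have "x \<notin> C" if x: "x \<in> lat p q" for x
      proof
        assume xC: "x \<in> C"
        obtain m n where mn: "x = of_int m *\<^sub>R p + of_int n *\<^sub>R q" using x by (rule latE)
        have le: "2 * norm x * norm y \<le> 2 * R * B" if "norm y < B" for y :: "real^2"
          using R xC that by (intro mult_mono) (auto intro: order_trans[OF norm_ge_zero])
        have "cross2 x q = of_int m * cross2 p q" "cross2 p x = of_int n * cross2 p q"
          by (simp_all add: mn cross2_algebra)
        then have "\<bar>of_int m * cross2 p q\<bar> \<le> 2 * R * B" "\<bar>of_int n * cross2 p q\<bar> \<le> 2 * R * B"
          using abs_cross2_le[of x q] abs_cross2_le[of x p] cross2_swap[of x p] le[of p] le[of q] W by linarith+
        then have "m \<in> {-k..k}" "n \<in> {-k..k}" using bound by auto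
        then have "of_int m *\<^sub>R p + of_int n *\<^sub>R q \<notin> C" using g by (auto simp: T_def p_q_def)
        then show False using xC mn by simp
      qed
      moreover have "cross2 p q \<noteq> 0" using W d by auto
      ultimately show "g \<in> S" by (auto simp: S_def GL2_columns lattice_of_columns p_q_def)
    qed
    ultimately show "\<exists>T. open T \<and> g0 \<in> T \<and> T \<subseteq> S" by blast
  qed
  then have "open S" using open_subopen[of S] by blast
  moreover have "{g \<in> GL2. lattice_of g \<in> {L. is_lattice L \<and> L \<inter> C = {}}} = GL2 \<inter> S"
    by (auto simp: S_def is_lattice_def)
  ultimately show ?thesis by (auto simp: openin_lattice_space openin_open_Int)
qed

text \<open>Two distinct lattices are separated by a small ball around a point of one of them that is
  missing from the other: meeting the open ball and missing the closed ball are disjoint open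
  conditions.\<close>

lemma Hausdorff_lattice_space: "Hausdorff_space lattice_space"
proof -
  have sep: "\<exists>U V. openin lattice_space U \<and> openin lattice_space V \<and> L \<in> U \<and> L' \<in> V \<and> disjnt U V"
    if L: "is_lattice L" "is_lattice L'" and v: "v \<in> L" "v \<notin> L'" for L L' v
  proof -
    obtain p q where pq: "cross2 p q \<noteq> 0" "L' = lat p q" using is_latticeE[OF L(2)] by metis
    define F where "F = L' \<inter> cball v 1"
    have "finite F" unfolding F_def pq(2) by (rule finite_lat_bounded[OF pq(1)]) simp
    then have "open (- F)" using finite_imp_closed by blast
    moreover have "v \<in> - F" using v by (simp add: F_def)
    ultimately obtain e where e: "e > 0" "cball v e \<subseteq> - F" using open_contains_cball by blast
    define r where "r = min e 1"
    have r: "r > 0" "cball v r \<subseteq> cball v e" "cball v r \<subseteq> cball v 1" using e by (auto simp: r_def)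
    have miss: "L' \<inter> cball v r = {}" using e(2) r(2,3) unfolding F_def by blast
    define U where "U = {L. is_lattice L \<and> L \<inter> ball v r \<noteq> {}}"
    define V where "V = {L. is_lattice L \<and> L \<inter> cball v r = {}}"
    have "openin lattice_space U" "openin lattice_space V"
      unfolding U_def V_def by (rule openin_lattices_meeting, simp) (rule openin_lattices_missing, simp)
    moreover have "v \<in> L \<inter> ball v r" using v r by simp
    then have "L \<in> U" using L unfolding U_def by blast
    moreover have "L' \<in> V" using L miss unfolding V_def by blast
    moreover have "disjnt U V" unfolding disjnt_def U_def V_def using ball_subset_cball by blast
    ultimately show ?thesis by blast
  qed
  show ?thesis unfolding Hausdorff_space_def topspace_lattice_space
  proof (intro allI impI, elim conjE)
    fix L L' assume LL: "L \<in> Collect is_lattice" "L' \<in> Collect is_lattice" "L \<noteq> L'"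
    then consider v where "v \<in> L" "v \<notin> L'" | v where "v \<in> L'" "v \<notin> L" by blast
    then show "\<exists>U V. openin lattice_space U \<and> openin lattice_space V \<and> L \<in> U \<and> L' \<in> V \<and> disjnt U V"
    proof cases
      case 1
      show ?thesis by (rule sep[OF _ _ 1]) (use LL in simp_all)
    next
      case 2
      obtain U V where "openin lattice_space U" "openin lattice_space V" "L' \<in> U" "L \<in> V" "disjnt U V"
        using sep[OF _ _ 2] LL(1,2) by auto
      then show ?thesis by (intro exI[of _ V] exI[of _ U]) (auto simp: disjnt_sym)
    qed
  qed
qed

text \<open>Inadmissibility means meeting the open set \<open>K - {0}\<close>.\<close>

lemma closedin_admissible:
  assumes "bcs_domain K"
  shows "closedin lattice_space {L. admissible K L}"
proof -
  interpret bcs K by unfold_locales fact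
  have "openin lattice_space {L. is_lattice L \<and> L \<inter> (K - {0}) \<noteq> {}}"
    by (intro openin_lattices_meeting open_Diff open_H) auto
  moreover have "topspace lattice_space - {L. admissible K L} = {L. is_lattice L \<and> L \<inter> (K - {0}) \<noteq> {}}"
  proof -
    have "0 \<in> L" if "is_lattice L" for L using that is_latticeE zero_in_lat by metis
    then show ?thesis unfolding topspace_lattice_space admissible_def using zero_in_H by blast
  qed
  ultimately show ?thesis by (auto simp: closedin_def topspace_lattice_space admissible_def)
qed

section \<open>The critical locus as a circle\<close>

text \<open>A path and the standard parametrisation of the circle that make the same identifications are
  both quotient maps from a compact interval onto Hausdorff spaces, so their images are
  homeomorphic.\<close>

lemma homeomorphic_circle_if_closed_path:
  assumes X: "Hausdorff_space X" and F: "continuous_map (top_of_set {0..1::real}) X F" "F ` {0..1} = topspace X"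
    and id: "\<And>s t. 0 \<le> s \<Longrightarrow> s \<le> t \<Longrightarrow> t \<le> 1 \<Longrightarrow> F s = F t \<longleftrightarrow> s = t \<or> s = 0 \<and> t = 1"
  shows "X homeomorphic_space top_of_set (sphere (0::real^2) 1)"
proof -
  let ?I = "top_of_set {0..1::real}" and ?S = "top_of_set (sphere (0::real^2) 1)"
  define c :: "real \<Rightarrow> real^2" where "c t = vector [cos (2 * pi * t), sin (2 * pi * t)]" for t
  have norm_sq: "norm x = 1 \<longleftrightarrow> (x$1)\<^sup>2 + (x$2)\<^sup>2 = 1" for x :: "real^2"
    by (simp add: norm_eq_1 inner_vec_def sum_2 power2_eq_square)
  have c_vec: "c t = (\<chi> i. if i = 1 then cos (2 * pi * t) else sin (2 * pi * t))" for t
    by (simp add: c_def vec_eq_iff forall_2)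
  have "continuous_on S c" for S
    unfolding c_vec
  proof (rule continuous_on_vec_lambda)
    show "continuous_on S (\<lambda>t. if i = 1 then cos (2 * pi * t) else sin (2 * pi * t))" for i :: 2
      by (cases "i = 1") (auto intro!: continuous_intros)
  qed
  moreover have im: "c ` {0..1} = sphere 0 1"
  proof
    show "c ` {0..1} \<subseteq> sphere 0 1" by (auto simp: norm_sq c_def)
    show "sphere 0 1 \<subseteq> c ` {0..1}"
    proof
      fix x :: "real^2" assume "x \<in> sphere 0 1"
      then have "(x$1)\<^sup>2 + (x$2)\<^sup>2 = 1" by (simp add: norm_sq)
      then obtain t where t: "0 \<le> t" "t < 2 * pi" "x$1 = cos t" "x$2 = sin t" using sincos_total_2pi by metis
      then have "x = c (t / (2 * pi))" by (simp add: c_def vec_eq_iff forall_2)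
      then show "x \<in> c ` {0..1}" using t by (intro image_eqI[of _ _ "t / (2 * pi)"]) (auto simp: field_simps)
    qed
  qed
  ultimately have cont: "continuous_map ?I ?S c" by (auto simp: continuous_map_in_subtopology)
  have cid: "c s = c t \<longleftrightarrow> s = t \<or> s = 0 \<and> t = 1" if "0 \<le> s" "s \<le> t" "t \<le> 1" for s t
  proof
    assume "c s = c t"
    then have "cos (2 * pi * s) = cos (2 * pi * t)" "sin (2 * pi * s) = sin (2 * pi * t)"
      by (simp_all add: c_def vec_eq_iff forall_2)
    then obtain n where "2 * pi * s = 2 * pi * t + 2 * pi * of_int n" using sin_cos_eq_iff by metis
    then have "2 * pi * s = 2 * pi * (t + of_int n)" by (simp add: distrib_left)
    then have st: "s = t + of_int n" by simp
    then have "-1 \<le> (of_int n :: real)" "of_int n \<le> (0::real)" using that by linarith+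
    then have "n = 0 \<or> n = -1" by linarith
    then show "s = t \<or> s = 0 \<and> t = 1" using st that by auto
  next
    show "s = t \<or> s = 0 \<and> t = 1 \<Longrightarrow> c s = c t" by (auto simp: c_def)
  qed
  have same: "F s = F t \<longleftrightarrow> c s = c t" if "s \<in> {0..1}" "t \<in> {0..1}" for s t
    using id[of s t] id[of t s] cid[of s t] cid[of t s] that by (cases "s \<le> t") auto
  have comp: "compact_space ?I" by (simp add: compact_space_subtopology)
  have qF: "quotient_map ?I X F"
    using T1_Spaces.continuous_imp_quotient_map[OF F(1) comp X] F(2) by simp
  have qc: "quotient_map ?I ?S c"
    using T1_Spaces.continuous_imp_quotient_map[OF cont comp] im by (simp add: Hausdorff_space_subtopology)
  obtain f where f: "continuous_map X ?S f" "\<And>t. t \<in> topspace ?I \<Longrightarrow> f (F t) = c t"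
    by (rule quotient_map_lift_exists[OF qF cont]) (use same in simp_all)
  obtain g where g: "continuous_map ?S X g" "\<And>t. t \<in> topspace ?I \<Longrightarrow> g (c t) = F t"
    by (rule quotient_map_lift_exists[OF qc F(1)]) (use same in simp_all)
  have "homeomorphic_maps X ?S f g"
    unfolding homeomorphic_maps_def
  proof (intro conjI ballI f(1) g(1))
    fix x assume "x \<in> topspace X"
    then obtain t where "t \<in> {0..1}" "x = F t" using F(2) by blast
    then show "g (f x) = x" using f(2)[of t] g(2)[of t] by simp
  next
    fix y assume "y \<in> topspace ?S"
    then have "y \<in> c ` {0..1}" using im by simp
    then obtain t where "t \<in> {0..1}" "y = c t" by blast
    then show "f (g y) = y" using f(2)[of t] g(2)[of t] by simp
  qed
  then show ?thesis by (auto simp: homeomorphic_space_def)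
qed

context bcs_nonparallelogram
begin

definition next_point :: "real^2 \<Rightarrow> real^2" where
  "next_point p = (SOME q. critical_hexad p q)"

lemma next_point_eq: "critical_hexad p q \<Longrightarrow> next_point p = q"
  unfolding next_point_def by (metis someI critical_hexad_uniq)

text \<open>The graph of the map is compact, which gives continuity.\<close>

lemma continuous_on_next_point: "continuous_on critical_points next_point"
proof -
  let ?Z = "{z. critical_hexad (fst z) (snd z)}"
  have "continuous_on (fst ` ?Z) (\<lambda>x. (x, next_point x))"
  proof (rule continuous_on_inv[OF _ compact_critical_hexad])
    show "continuous_on ?Z fst" by (intro continuous_on_fst continuous_on_id)
    show "\<forall>z\<in>?Z. (fst z, next_point (fst z)) = z"
      using next_point_eq by (metis mem_Collect_eq prod.collapse)
  qed
  moreover have "fst ` ?Z = critical_points" by (auto simp: critical_points_def image_iff)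
  ultimately have "continuous_on critical_points (\<lambda>x. (x, next_point x))" by simp
  from continuous_on_snd[OF this] show ?thesis by simp
qed

definition sector_lattice :: "real^2 \<Rightarrow> real^2 \<Rightarrow> (real^2) set \<Rightarrow> bool" where
  "sector_lattice a b L \<longleftrightarrow> (\<exists>p q. critical_hexad p q \<and> sector a b p \<and> lat p q = L)"

lemma sector_lattice_step:
  "critical_hexad a b \<Longrightarrow> sector_lattice a b L \<Longrightarrow> sector_lattice b (b - a) L"
  unfolding sector_lattice_def by (metis critical_hexad_sector_step critical_hexad_rotate lat_rotate)

text \<open>Rotating the hexagon of a critical lattice step by step moves its first vertex through the
  six sectors of any fixed critical hexagon.\<close>

lemma sector_lattice_any:
  assumes h: "critical_hexad a b" and L: "L \<in> critical_locus H"
  shows "sector_lattice a b L"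
proof -
  obtain p q where pq: "critical_hexad p q" "L = lat p q" using L critical_locus_eq_critical_hexads[OF np] by blast
  obtain a' b' where ab': "critical_hexad a' b'" "sector a' b' p" "a' \<in> {a, b, b - a, - a, - b, a - b}"
    using six_sectors[OF h] by metis
  have SL: "sector_lattice a' b' L" unfolding sector_lattice_def using pq ab' by blast
  have 1: "critical_hexad b (b - a)" "critical_hexad (b - a) (- a)" "critical_hexad (- a) (- b)" "critical_hexad (- b) (a - b)" "critical_hexad (a - b) a"
    using critical_hexad_rotate[OF h] critical_hexad_rotate2[OF h] critical_hexad_uminus[OF h] critical_hexad_uminus[OF critical_hexad_rotate[OF h]] critical_hexad_back[OF h]
    by simp_all
  have s: "sector_lattice (b - a) (- a) L \<Longrightarrow> sector_lattice (- a) (- b) L"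
    "sector_lattice (- a) (- b) L \<Longrightarrow> sector_lattice (- b) (a - b) L"
    "sector_lattice (- b) (a - b) L \<Longrightarrow> sector_lattice (a - b) a L"
    "sector_lattice (a - b) a L \<Longrightarrow> sector_lattice a b L"
    "sector_lattice b (b - a) L \<Longrightarrow> sector_lattice (b - a) (- a) L"
    using sector_lattice_step[OF 1(2)] sector_lattice_step[OF 1(3)] sector_lattice_step[OF 1(4)]
      sector_lattice_step[OF 1(5)] sector_lattice_step[OF 1(1)] by simp_all
  consider "a' = a" | "a' = b" | "a' = b - a" | "a' = - a" | "a' = - b" | "a' = a - b" using ab'(3) by blast
  then show ?thesis
  proof cases
    case 1 then have "b' = b" using critical_hexad_uniq h ab'(1) by blast
    then show ?thesis using SL 1 by simp
  next
    case 2 then have "b' = b - a" using critical_hexad_uniq 1(1) ab'(1) by blast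
    then show ?thesis using SL 2 s by simp
  next
    case 3 then have "b' = - a" using critical_hexad_uniq 1(2) ab'(1) by blast
    then show ?thesis using SL 3 s by simp
  next
    case 4 then have "b' = - b" using critical_hexad_uniq 1(3) ab'(1) by blast
    then show ?thesis using SL 4 s by simp
  next
    case 5 then have "b' = a - b" using critical_hexad_uniq 1(4) ab'(1) by blast
    then show ?thesis using SL 5 s by simp
  next
    case 6 then have "b' = a" using critical_hexad_uniq 1(5) ab'(1) by blast
    then show ?thesis using SL 6 s by simp
  qed
qed

text \<open>In the basis \<open>p\<close>, \<open>q\<close> the boundary point \<open>p'\<close> of the
  same lattice has integer coordinates between \<open>0\<close> and \<open>1\<close>. The sum \<open>p +
  q\<close> is impossible by uniqueness of hexagons, and \<open>p' = q\<close> is possible only at the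
  two ends of the sector.\<close>

lemma sector_lattice_unique:
  assumes h0: "critical_hexad p0 q0" and h: "critical_hexad p q" "critical_hexad p' q'" and s: "sector p0 q0 p" "sector p0 q0 p'"
    and le: "0 \<le> cross2 p p'" and eq: "lat p q = lat p' q'"
  shows "p = p' \<or> p = p0 \<and> p' = q0"
proof -
  have s': "sector p q p'" by (rule sector_advance[OF h0 h(1) s critical_hexadD(1)[OF h(2)] le])
  have "p' \<in> lat p q" unfolding eq by (rule gens_in_lat)
  then obtain m n :: int where mn: "p' = of_int m *\<^sub>R p + of_int n *\<^sub>R q" by (rule latE)
  obtain a b where ab: "p' = a *\<^sub>R p + b *\<^sub>R q" "0 \<le> a" "a \<le> 1" "0 \<le> b" "b \<le> 1" "1 \<le> a + b"
    by (rule sector_coords[OF h(1) s' critical_hexadD(1)[OF h(2)]])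
  have nz: "cross2 p q \<noteq> 0" using critical_hexadD(5)[OF h(1)] by simp
  have "of_int m = a" "of_int n = b"
    using cross2_basis_unique[OF nz, of "of_int m" "of_int n" a b] mn ab(1) by simp_all
  then have "0 \<le> m" "m \<le> 1" "0 \<le> n" "n \<le> 1" "1 \<le> m + n" using ab by linarith+
  then consider "m = 1" "n = 0" | "m = 1" "n = 1" | "m = 0" "n = 1" by linarith
  then show ?thesis
  proof cases
    case 1 then show ?thesis using mn by simp
  next
    case 2
    then have "critical_hexad p (p + q)" using critical_hexadD[OF h(1)] critical_hexadD(1)[OF h(2)] mn
      by (simp add: critical_hexad_def hexad_def cross2_algebra)
    then have "p + q = q" using critical_hexad_uniq h(1) by blast
    then show ?thesis using critical_hexadD(1)[OF h(1)] by simp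
  next
    case 3
    then have p': "p' = q" using mn by simp
    have "sector q0 (q0 - p0) q" by (rule critical_hexad_sector_step[OF h0 h(1) s(1)])
    then have "cross2 q q0 = 0" using s(2) cross2_swap[of q q0] by (simp add: p' sector_def)
    then have "q = q0"
      using sector_start[OF critical_hexad_rotate[OF h0] \<open>sector q0 (q0 - p0) q\<close> critical_hexadD(2)[OF h(1)]] cross2_swap[of q q0] by simp
    then show ?thesis using critical_hexad_inj h0 h(1) p' by blast
  qed
qed

text \<open>Let the first vertex run along the boundary from \<open>p\<close> to its successor
  \<open>q\<close>. The lattice of its critical hexagon then runs through every critical lattice,
  without repetition except that it returns at \<open>q\<close> to the lattice of
  \<open>p\<close>.\<close>

lemma critical_locus_circle:
  assumes all: "\<And>x. N x = 1 \<Longrightarrow> x \<in> critical_points"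
  shows "subtopology lattice_space (critical_locus H) homeomorphic_space top_of_set (sphere (0 :: real^2) 1)"
proof -
  obtain p q where h: "critical_hexad p q" by (rule exists_critical_hexad)
  have c: "cross2 p q > 0" by (rule critical_hexadD[OF h])
  let ?c = "arc p q"
  have hc: "critical_hexad (?c t) (next_point (?c t))" for t
    using all[OF minkowski_arc[OF c, of t]] next_point_eq by (auto simp: critical_points_def)
  have sec: "sector p q (?c t)" if "t \<in> {0..1}" for t
  proof -
    obtain k where k: "k > 0" "cross2 (?c 0) (?c t) = (t - 0) * k" by (rule cross2_arc[OF c])
    obtain k' where k': "k' > 0" "cross2 (?c t) (?c 1) = (1 - t) * k'" by (rule cross2_arc[OF c])
    show ?thesis using k k' that arc_ends critical_hexadD[OF h] by (simp add: sector_def)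
  qed
  define F where "F t = lat (?c t) (next_point (?c t))" for t
  have crit: "F t \<in> critical_locus H" for t unfolding F_def by (rule critical_hexad_lattice_critical[OF hc])
  have sub: "critical_locus H \<subseteq> topspace lattice_space"
    by (auto simp: critical_locus_def admissible_def topspace_lattice_space)
  show ?thesis
  proof (rule homeomorphic_circle_if_closed_path)
    show "Hausdorff_space (subtopology lattice_space (critical_locus H))"
      by (rule Hausdorff_space_subtopology[OF Hausdorff_lattice_space])
    have "continuous_on {0..1} (\<lambda>t. next_point (?c t))"
      by (rule continuous_on_compose2[OF continuous_on_next_point continuous_on_arc[OF c]]) (use hc in \<open>auto simp: critical_points_def\<close>)
    then have "continuous_on {0..1} (\<lambda>t. cols (?c t) (next_point (?c t)))"
      by (intro continuous_on_cols continuous_on_arc[OF c])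
    moreover have "cols (?c t) (next_point (?c t)) \<in> GL2" for t
      using critical_hexadD(5)[OF hc] by (simp add: cols_GL2 less_imp_neq[THEN not_sym])
    ultimately have "continuous_map (top_of_set {0..1}) (top_of_set GL2) (\<lambda>t. cols (?c t) (next_point (?c t)))"
      by (auto simp: continuous_map_in_subtopology)
    then have "continuous_map (top_of_set {0..1}) lattice_space (lattice_of \<circ> (\<lambda>t. cols (?c t) (next_point (?c t))))"
      using quotient_imp_continuous_map[OF quotient_map_lattice_of] continuous_map_compose by blast
    moreover have "lattice_of \<circ> (\<lambda>t. cols (?c t) (next_point (?c t))) = F"
      by (auto simp: F_def lattice_of_cols)
    ultimately show "continuous_map (top_of_set {0..1}) (subtopology lattice_space (critical_locus H)) F"
      using crit by (auto simp: continuous_map_in_subtopology)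
    show "F ` {0..1} = topspace (subtopology lattice_space (critical_locus H))"
    proof
      show "F ` {0..1} \<subseteq> topspace (subtopology lattice_space (critical_locus H))" using crit sub by auto
      show "topspace (subtopology lattice_space (critical_locus H)) \<subseteq> F ` {0..1}"
      proof
        fix L assume "L \<in> topspace (subtopology lattice_space (critical_locus H))"
        then have "sector_lattice p q L" using sector_lattice_any[OF h] by simp
        then obtain x y where xy: "critical_hexad x y" "sector p q x" "lat x y = L" by (auto simp: sector_lattice_def)
        obtain t where t: "0 \<le> t" "t \<le> 1" "x = ?c t" using arc_covers_sector[OF c xy(2) critical_hexadD(1)[OF xy(1)]] by blast
        then have "F t = L" using xy next_point_eq by (simp add: F_def)
        then show "L \<in> F ` {0..1}" using t by auto
      qed
    qed
    show "F s = F t \<longleftrightarrow> s = t \<or> s = 0 \<and> t = 1" if st: "0 \<le> s" "s \<le> t" "t \<le> 1" for s t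
    proof
      assume eq: "F s = F t"
      obtain k where k: "k > 0" "cross2 (?c s) (?c t) = (t - s) * k" by (rule cross2_arc[OF c])
      have inj: "a = b" if "?c a = ?c b" for a b
        using cross2_arc_pos_iff[OF c, of a b] cross2_arc_pos_iff[OF c, of b a] that by (simp add: cross2_algebra)
      have "?c s = ?c t \<or> ?c s = p \<and> ?c t = q"
        by (rule sector_lattice_unique[OF h hc hc]) (use sec st k eq in \<open>auto simp: F_def\<close>)
      then show "s = t \<or> s = 0 \<and> t = 1"
        using inj[of s t] inj[of s 0] inj[of t 1] arc_ends critical_hexadD[OF h] by auto
    next
      have "next_point p = q" "next_point q = q - p" using next_point_eq h critical_hexad_rotate[OF h] by auto
      then have "F 0 = F 1" using arc_ends critical_hexadD[OF h] by (simp add: F_def lat_rotate)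
      then show "s = t \<or> s = 0 \<and> t = 1 \<Longrightarrow> F s = F t" by auto
    qed
  qed
qed

end

section \<open>Irreducible subdomains with the same critical determinant\<close>

lemma critical_determinant_mono:
  assumes "bcs_domain H" "bcs_domain H'" "H' \<subseteq> H"
  shows "critical_determinant H' \<le> critical_determinant H"
proof -
  interpret A: bcs H by unfold_locales fact
  interpret B: bcs H' by unfold_locales fact
  obtain p q where "A.critical_hexad p q" by (rule A.exists_critical_hexad)
  then have L: "admissible H (lat p q)" "covolume (lat p q) = A.\<Delta>"
    using A.critical_hexad_lattice_critical by (auto simp: critical_locus_def)
  then have "admissible H' (lat p q)"
    using assms(3) zero_in_lat B.zero_in_H by (auto simp: admissible_def)
  then show ?thesis using B.critical_determinant_le_covolume L by metis
qed

context bcs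
begin

text \<open>A domain of bounded diameter that is too thin in some direction is contained in a strip, and
  a rectangular lattice adapted to the strip has too small a covolume.\<close>

lemma ball_subset_body:
  assumes R: "R > 0" "H \<subseteq> ball 0 R"
  shows "ball 0 (\<Delta> / R) \<subseteq> H"
proof (rule ccontr)
  assume "\<not> ?thesis"
  then obtain x where "x \<in> ball 0 (\<Delta> / R)" "x \<notin> H" by blast
  then have x: "norm x < \<Delta> / R" "x \<notin> H" by simp_all
  have Nx: "1 \<le> N x" using x(2) mem_H_iff by auto
  define p where "p = inverse (N x) *\<^sub>R x"
  have Np: "N p = 1" using Nx by (simp add: p_def minkowski_scale)
  have np: "norm p \<le> norm x" using Nx mult_left_mono[OF Nx norm_ge_zero[of x]] by (simp add: p_def divide_simps)
  obtain a where a: "a \<bullet> p = 1" "\<And>y. a \<bullet> y \<le> N y" using minkowski_support[OF Np] by blast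
  have a0: "norm a > 0" using a(1) by auto
  have strip: "\<bar>a \<bullet> y\<bar> < 1" if "y \<in> H" for y
    using a(2)[of y] a(2)[of "- y"] that mem_H_iff by simp
  define b :: "real^2" where "b = vector [- a$2, a$1]"
  have ab: "cross2 a b = (norm a)\<^sup>2" "a \<bullet> b = 0" "norm b = norm a"
    by (simp_all add: b_def cross2_def norm_eq_sqrt_inner inner_vec_def sum_2 power2_eq_square)
  define u where "u = inverse ((norm a)\<^sup>2) *\<^sub>R a"
  define v where "v = (R / norm a) *\<^sub>R b"
  have cuv: "cross2 u v = R / norm a"
    using a0 by (simp add: u_def v_def cross2_algebra ab)
  have "admissible H (lat u v)"
  proof -
    have "z = 0" if z: "z \<in> lat u v" "z \<in> H" for z
    proof -
      obtain m n where mn: "z = of_int m *\<^sub>R u + of_int n *\<^sub>R v" using z(1) by (rule latE)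
      have "a \<bullet> u = 1" using a0 by (simp add: u_def dot_square_norm)
      moreover have "a \<bullet> v = 0" by (simp add: v_def ab)
      ultimately have "a \<bullet> z = of_int m" by (simp add: mn inner_add_right)
      then have m: "m = 0" using strip[OF z(2)] by simp
      have "norm z < R" using z(2) R by auto
      moreover have "norm z = \<bar>of_int n\<bar> * R" using a0 R by (simp add: mn m v_def ab abs_mult)
      ultimately have "\<bar>of_int n\<bar> * R < 1 * R" by simp
      then have "\<bar>of_int n :: real\<bar> < 1" using R(1) by (simp only: mult_less_cancel_right_pos)
      then have "n = 0" by simp
      then show ?thesis using mn m by simp
    qed
    then show ?thesis unfolding admissible_def
      using is_lattice_lat[of u v] cuv a0 R zero_in_lat zero_in_H by auto
  qed
  then have "\<Delta> \<le> covolume (lat u v)" by (rule critical_determinant_le_covolume)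
  also have "\<dots> = R / norm a" using cuv a0 R by (subst covolume_lat) auto
  also have "\<dots> \<le> R * norm x"
  proof -
    have "1 \<le> norm a * norm p" using a(1) Cauchy_Schwarz_ineq2[of a p] by simp
    also have "\<dots> \<le> norm a * norm x" using np by (intro mult_left_mono) auto
    finally show ?thesis using a0 R by (simp add: field_simps)
  qed
  also have "\<dots> < \<Delta>" using x(1) R by (simp add: field_simps)
  finally show False by simp
qed

end

lemma chain_avoids_finite:
  assumes "finite F" "C \<noteq> {}" and chain: "\<And>X Y. X \<in> C \<Longrightarrow> Y \<in> C \<Longrightarrow> X \<subseteq> Y \<or> Y \<subseteq> X"
    and "\<And>z. z \<in> F \<Longrightarrow> \<exists>X\<in>C. z \<notin> X"
  shows "\<exists>X\<in>C. F \<inter> X = {}"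
  using assms(1,4)
proof (induction F)
  case empty then show ?case using assms(2) by auto
next
  case (insert z F)
  obtain X where X: "X \<in> C" "F \<inter> X = {}" using insert by auto
  obtain Y where Y: "Y \<in> C" "z \<notin> Y" using insert.prems by auto
  show ?case using chain[OF X(1) Y(1)]
  proof
    assume "X \<subseteq> Y" then show ?thesis using X Y by (intro bexI[of _ X]) auto
  next
    assume "Y \<subseteq> X" then show ?thesis using X Y by (intro bexI[of _ Y]) auto
  qed
qed

text \<open>A common inscribed ball makes the intersection of the chain nondegenerate. If its critical
  determinant were smaller, then a critical lattice of the intersection, enlarged a little, would still
  have covolume below \<open>critical_determinant K\<close>. Only finitely many of its nonzero points
  lie in \<open>K\<close>, and each of them is missing from some member of the chain. So a single member
  avoids all of them, and the enlarged lattice would be admissible for it.\<close>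

lemma chain_lower_bound:
  assumes K: "bcs_domain K" and C: "C \<noteq> {}"
    and mem: "\<And>X. X \<in> C \<Longrightarrow> bcs_domain X \<and> X \<subseteq> K \<and> critical_determinant X = critical_determinant K"
    and chain: "\<And>X Y. X \<in> C \<Longrightarrow> Y \<in> C \<Longrightarrow> X \<subseteq> Y \<or> Y \<subseteq> X"
  defines "U \<equiv> interior (\<Inter>C)"
  shows "bcs_domain U" "critical_determinant U = critical_determinant K"
proof -
  interpret K: bcs K by unfold_locales fact
  obtain R where R: "R > 0" "K \<subseteq> ball 0 R" by (rule K.circumradius)
  define r where "r = K.\<Delta> / R"
  have r: "r > 0" using K.critical_determinant_pos R by (simp add: r_def)
  have ball: "ball 0 r \<subseteq> \<Inter>C"
  proof (rule Inter_greatest)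
    fix X assume X: "X \<in> C"
    interpret X: bcs X using mem[OF X] by unfold_locales auto
    show "ball 0 r \<subseteq> X" using X.ball_subset_body[OF R(1)] R(2) mem[OF X] by (auto simp: r_def)
  qed
  have convC: "convex (\<Inter>C)" using mem by (intro convex_Inter) (auto simp: bcs_domain_def)
  have symC: "uminus ` \<Inter>C = \<Inter>C"
  proof -
    have "- x \<in> \<Inter>C" if x: "x \<in> \<Inter>C" for x
    proof
      fix X assume X: "X \<in> C"
      interpret X: bcs X using mem[OF X] by unfold_locales auto
      show "- x \<in> X" using x X X.uminus_H by blast
    qed
    then show ?thesis by (metis image_subset_iff subsetI subset_antisym minus_minus image_eqI)
  qed
  have UC: "U \<subseteq> \<Inter>C" unfolding U_def by (rule interior_subset)
  have U0: "ball 0 r \<subseteq> U" unfolding U_def using ball by (simp add: interior_maximal)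
  have UK: "U \<subseteq> K" using UC C mem by blast
  show bU: "bcs_domain U" unfolding bcs_domain_def symmetric_domain_def
  proof (intro conjI)
    show "open U" unfolding U_def by simp
    show c: "convex U" unfolding U_def by (rule convex_interior[OF convC])
    show "connected U" by (rule convex_connected[OF c])
    show "U \<noteq> {}" using U0 r centre_in_ball[of 0 r] by blast
    show "uminus ` U = U" unfolding U_def by (metis interior_negations symC)
    show "bounded U" using bounded_subset[OF K.bounded_H UK] .
  qed
  interpret U: bcs U by unfold_locales fact
  have shrink: "minkowski U z \<le> 1" if z: "z \<in> \<Inter>C" for z
  proof (rule field_le_mult_one_interval)
    fix s :: real assume s: "0 < s" "s < 1"
    have "ball (s *\<^sub>R z) ((1 - s) * r) \<subseteq> \<Inter>C"
    proof
      fix y assume y: "y \<in> ball (s *\<^sub>R z) ((1 - s) * r)"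
      define w where "w = inverse (1 - s) *\<^sub>R (y - s *\<^sub>R z)"
      have "norm (y - s *\<^sub>R z) < (1 - s) * r" using y by (simp add: dist_norm norm_minus_commute)
      then have "inverse (1 - s) * norm (y - s *\<^sub>R z) < r" using s by (simp add: field_simps)
      moreover have "norm w = inverse (1 - s) * norm (y - s *\<^sub>R z)" using s unfolding w_def norm_scaleR by simp
      ultimately have "norm w < r" by simp
      then have "w \<in> \<Inter>C" using ball by auto
      then have "s *\<^sub>R z + (1 - s) *\<^sub>R w \<in> \<Inter>C" using convexD[OF convC z] s by simp
      then show "y \<in> \<Inter>C" using s by (simp add: w_def)
    qed
    then have "s *\<^sub>R z \<in> U" unfolding U_def using s r by (meson centre_in_ball mem_interior diff_gt_0_iff_gt mult_pos_pos)
    then show "s * minkowski U z \<le> 1" using s U.mem_H_iff U.minkowski_scale by simp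
  qed
  have "U.\<Delta> \<le> K.\<Delta>" by (rule critical_determinant_mono[OF K bU UK])
  moreover have "\<not> U.\<Delta> < K.\<Delta>"
  proof
    assume lt: "U.\<Delta> < K.\<Delta>"
    obtain p q where pq: "U.critical_hexad p q" by (rule U.exists_critical_hexad)
    have hp: "U.hexad p q" "cross2 p q = U.\<Delta>" "U.\<Delta> > 0" using pq U.critical_determinant_pos by (auto simp: U.critical_hexad_def)
    \<comment> \<open>The scaled covolume is the mean of the two critical determinants.\<close>
    define t where "t = sqrt ((1 + K.\<Delta> / U.\<Delta>) / 2)"
    have ratio: "K.\<Delta> / U.\<Delta> > 1" using lt hp by simp
    have t1: "t > 1" using ratio by (simp add: t_def)
    have "t * t = (1 + K.\<Delta> / U.\<Delta>) / 2" unfolding t_def using ratio by (subst real_sqrt_mult_self) simp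
    then have "t * t * U.\<Delta> = (U.\<Delta> + K.\<Delta>) / 2" using hp by (simp add: field_simps)
    then have t2: "t * t * U.\<Delta> < K.\<Delta>" using lt by simp
    define L where "L = lat (t *\<^sub>R p) (t *\<^sub>R q)"
    have cr: "cross2 (t *\<^sub>R p) (t *\<^sub>R q) = t * t * U.\<Delta>" using hp by (simp add: cross2_algebra)
    have nz: "cross2 (t *\<^sub>R p) (t *\<^sub>R q) \<noteq> 0" unfolding cr using t1 hp by simp
    have out: "\<exists>X\<in>C. z \<notin> X" if z: "z \<in> L" "z \<noteq> 0" for z
    proof -
      have "inverse t *\<^sub>R z \<in> lat p q" using z(1) lat_scale[of t z p q] t1 by (simp add: L_def)
      then have "1 \<le> minkowski U (inverse t *\<^sub>R z)"
        using U.admissible_lat_iff[of p q] U.hexad_admissible[OF hp(1)] hp z t1 by auto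
      then have "t \<le> minkowski U z" using t1 by (simp add: U.minkowski_scale field_simps)
      then show ?thesis using shrink[of z] t1 by auto
    qed
    define F where "F = L \<inter> K - {0}"
    have "finite F" unfolding F_def L_def using finite_lat_bounded[OF nz K.bounded_H] by simp
    moreover have "\<exists>X\<in>C. z \<notin> X" if "z \<in> F" for z using out that by (simp add: F_def)
    ultimately obtain X where X: "X \<in> C" "F \<inter> X = {}" using chain_avoids_finite[of F C] C chain by metis
    interpret X: bcs X using mem[OF X(1)] by unfold_locales auto
    have "L \<inter> X = {0}"
      using X(2) mem[OF X(1)] zero_in_lat X.zero_in_H unfolding F_def L_def by blast
    then have "admissible X L" using is_lattice_lat[OF nz] by (simp add: admissible_def L_def)
    then have "X.\<Delta> \<le> covolume L" by (rule X.critical_determinant_le_covolume)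
    also have "covolume L = t * t * U.\<Delta>" unfolding L_def covolume_lat[OF nz] cr using t1 hp by simp
    also have "\<dots> < K.\<Delta>" by (rule t2)
    finally show False using mem[OF X(1)] by simp
  qed
  ultimately show "critical_determinant U = critical_determinant K" by simp
qed

text \<open>Irreducible means minimal for inclusion among the domains with a given critical determinant,
  so Zorn's lemma applies.\<close>

lemma exists_irreducible_subdomain:
  assumes K: "bcs_domain K"
  obtains H where "irreducible_domain H" "H \<subseteq> K" "critical_determinant H = critical_determinant K"
proof -
  define A where "A = {H. bcs_domain H \<and> H \<subseteq> K \<and> critical_determinant H = critical_determinant K}"
  have "\<exists>M\<in>A. \<forall>X\<in>A. X \<subseteq> M \<longrightarrow> X = M"
  proof (rule predicate_Zorn[of A "\<lambda>X Y. Y \<subseteq> X"])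
    show "partial_order_on A (relation_of (\<lambda>X Y. Y \<subseteq> X) A)"
      by (rule partial_order_on_relation_ofI) auto
  next
    fix C assume C: "C \<in> Chains (relation_of (\<lambda>X Y. Y \<subseteq> X) A)"
    then have sub: "X \<in> A" if "X \<in> C" for X using that by (auto simp: Chains_def relation_of_def)
    have chain: "X \<subseteq> Y \<or> Y \<subseteq> X" if "X \<in> C" "Y \<in> C" for X Y
      using C that by (auto simp: Chains_def relation_of_def)
    show "\<exists>U\<in>A. \<forall>X\<in>C. U \<subseteq> X"
    proof (cases "C = {}")
      case True
      then show ?thesis using K by (intro bexI[of _ K]) (auto simp: A_def)
    next
      case False
      have mem: "bcs_domain X \<and> X \<subseteq> K \<and> critical_determinant X = critical_determinant K" if "X \<in> C" for X
        using sub[OF that] by (simp add: A_def)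
      note U = chain_lower_bound[OF K False mem chain]
      have "interior (\<Inter>C) \<subseteq> \<Inter>C" by (rule interior_subset)
      then have "\<forall>X\<in>C. interior (\<Inter>C) \<subseteq> X" by blast
      moreover have "interior (\<Inter>C) \<in> A" using U calculation False mem by (auto simp: A_def)
      ultimately show ?thesis by blast
    qed
  qed
  then obtain M where M: "M \<in> A" "\<And>X. X \<in> A \<Longrightarrow> X \<subseteq> M \<Longrightarrow> X = M" by blast
  have "critical_determinant H' < critical_determinant M" if H': "bcs_domain H'" "H' \<subset> M" for H'
  proof -
    have "critical_determinant H' \<le> critical_determinant M"
      by (rule critical_determinant_mono) (use H' M(1) in \<open>auto simp: A_def\<close>)
    moreover have "critical_determinant H' \<noteq> critical_determinant M"
      using M(2)[of H'] M(1) H' by (auto simp: A_def)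
    ultimately show ?thesis by simp
  qed
  then have "irreducible_domain M" using M(1) by (simp add: irreducible_domain_def A_def)
  then show ?thesis using that M(1) by (simp add: A_def)
qed

section \<open>Parallelograms inside larger domains\<close>

lemma cross2_nonzero_of_independent:
  assumes "u \<noteq> v" "independent {u, v}"
  shows "cross2 u v \<noteq> 0"
proof
  assume "cross2 u v = 0"
  moreover have "u \<noteq> 0" using assms(2) dependent_zero[of "{u,v}"] by auto
  ultimately obtain k where "v = k *\<^sub>R u" using cross2_zero_imp_scale by blast
  then have "v \<in> span {u}" by (simp add: span_mul span_base)
  moreover have "v \<notin> span {u}" using assms by (simp add: insert_commute[of u v] independent_insert)
  ultimately show False by blast
qed

text \<open>Central symmetry forces the centre of the parallelogram to be the origin.\<close>

lemma parallelogramE: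
  assumes P: "bcs_domain P" "parallelogram P"
  obtains p q where "cross2 p q \<noteq> 0" "\<And>X Y. X *\<^sub>R p + Y *\<^sub>R q \<in> P \<longleftrightarrow> \<bar>X\<bar> < 1 \<and> \<bar>Y\<bar> < 1"
proof -
  interpret bcs P by unfold_locales fact
  obtain c u v where uv: "u \<noteq> v" "independent {u, v}"
    and Pdef: "P = {c + s *\<^sub>R u + t *\<^sub>R v |s t. 0 < s \<and> s < 1 \<and> 0 < t \<and> t < 1}"
    using P(2) unfolding parallelogram_def by blast
  have nz: "cross2 u v \<noteq> 0" using uv by (rule cross2_nonzero_of_independent)
  obtain \<alpha> \<beta> where c: "c = \<alpha> *\<^sub>R u + \<beta> *\<^sub>R v" using cross2_cramer[OF nz] by blast
  have mem: "x *\<^sub>R u + y *\<^sub>R v \<in> P \<longleftrightarrow> \<alpha> < x \<and> x < \<alpha> + 1 \<and> \<beta> < y \<and> y < \<beta> + 1" for x y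
  proof -
    have "x *\<^sub>R u + y *\<^sub>R v = c + s *\<^sub>R u + t *\<^sub>R v \<longleftrightarrow> x = \<alpha> + s \<and> y = \<beta> + t" for s t
    proof -
      have "c + s *\<^sub>R u + t *\<^sub>R v = (\<alpha> + s) *\<^sub>R u + (\<beta> + t) *\<^sub>R v" by (simp add: c algebra_simps)
      then show ?thesis using cross2_basis_unique[OF nz, of x y "\<alpha> + s" "\<beta> + t"] by auto
    qed
    then have "x *\<^sub>R u + y *\<^sub>R v \<in> P \<longleftrightarrow> (\<exists>s t. x = \<alpha> + s \<and> y = \<beta> + t \<and> 0 < s \<and> s < 1 \<and> 0 < t \<and> t < 1)"
      unfolding Pdef by blast
    also have "\<dots> \<longleftrightarrow> \<alpha> < x \<and> x < \<alpha> + 1 \<and> \<beta> < y \<and> y < \<beta> + 1"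
    proof
      assume "\<alpha> < x \<and> x < \<alpha> + 1 \<and> \<beta> < y \<and> y < \<beta> + 1"
      then show "\<exists>s t. x = \<alpha> + s \<and> y = \<beta> + t \<and> 0 < s \<and> s < 1 \<and> 0 < t \<and> t < 1"
        by (intro exI[of _ "x - \<alpha>"] exI[of _ "y - \<beta>"]) auto
    qed auto
    finally show ?thesis .
  qed
  have sym: "\<alpha> < - x \<and> - x < \<alpha> + 1 \<and> \<beta> < - y \<and> - y < \<beta> + 1"
    if "\<alpha> < x" "x < \<alpha> + 1" "\<beta> < y" "y < \<beta> + 1" for x y
  proof -
    have "- (x *\<^sub>R u + y *\<^sub>R v) \<in> P" using uminus_H mem[of x y] that by blast
    then show ?thesis using mem[of "- x" "- y"] by simp
  qed
  have half: "a = - 1/2" if "\<And>x. a < x \<Longrightarrow> x < a + 1 \<Longrightarrow> a < - x \<and> - x < a + 1" for a :: real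
  proof (rule ccontr)
    assume "a \<noteq> - 1/2"
    then consider "2 * a + 1 > 0" | "2 * a + 1 < 0" by linarith
    then show False
    proof cases
      case 1
      define x where "x = max (a + 1/2) (- a)"
      have "a < x" "x < a + 1" using 1 by (auto simp: x_def)
      then show False using that[of x] by (auto simp: x_def)
    next
      case 2
      define x where "x = min (a + 1/2) (- a - 1)"
      have "a < x" "x < a + 1" using 2 by (auto simp: x_def)
      then show False using that[of x] by (auto simp: x_def)
    qed
  qed
  have \<alpha>: "\<alpha> = - 1/2" by (rule half) (use sym[of _ "\<beta> + 1/2"] in auto)
  have \<beta>: "\<beta> = - 1/2" by (rule half) (use sym[of "\<alpha> + 1/2"] in auto)
  show ?thesis
  proof (rule that[of "(1/2) *\<^sub>R u" "(1/2) *\<^sub>R v"])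
    show "cross2 ((1/2) *\<^sub>R u) ((1/2) *\<^sub>R v) \<noteq> 0" using nz by (simp add: cross2_algebra)
    show "X *\<^sub>R (1/2) *\<^sub>R u + Y *\<^sub>R (1/2) *\<^sub>R v \<in> P \<longleftrightarrow> \<bar>X\<bar> < 1 \<and> \<bar>Y\<bar> < 1" for X Y
      using mem[of "X/2" "Y/2"] by (auto simp: \<alpha> \<beta>)
  qed
qed

context bcs
begin

text \<open>The open square with sides centred at \<open>\<plusminus>p\<close> and
  \<open>\<plusminus>q\<close>, together with its open sides at \<open>\<plusminus>p\<close>, belongs to
  the open domain, and \<open>x\<close> lies on the side at \<open>q\<close>. The translate of the
  segment from \<open>0\<close> to \<open>x\<close> that starts at \<open>- p\<close> ends in the closed
  square. Moving it backwards along its own line by a small multiple of \<open>x\<close> brings both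
  endpoints into the interior.\<close>

lemma overhanging_chord:
  assumes open_sq: "\<And>X Y. \<bar>X\<bar> < 1 \<Longrightarrow> \<bar>Y\<bar> < 1 \<Longrightarrow> N (X *\<^sub>R p + Y *\<^sub>R q) < 1"
    and side: "\<And>t. \<bar>t\<bar> < 1 \<Longrightarrow> N (p + t *\<^sub>R q) < 1"
    and x: "x = a *\<^sub>R p + q" "0 \<le> a" "a \<le> 1" "N x = 1"
  obtains v where "N v < 1" "N (v - x) < 1" "cross2 x v = cross2 p q"
proof -
  have Np: "N p < 1" using side[of 0] by simp
  define e where "e = (1 - N p) / 2"
  have e: "0 < e" "e < 1" "N p + e < 1" using Np minkowski_nonneg[of p] by (auto simp: e_def field_simps)
  define v where "v = x - p - e *\<^sub>R x"
  have "N v < 1"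
  proof (cases "a = 0")
    case True
    have "v = - (p + (e - 1) *\<^sub>R q)" by (simp add: v_def x True algebra_simps)
    then show ?thesis using side[of "e - 1"] e by (simp only: minkowski_minus)
  next
    case False
    have "v = ((1 - e) * a - 1) *\<^sub>R p + (1 - e) *\<^sub>R q" by (simp add: v_def x algebra_simps)
    moreover have "\<bar>(1 - e) * a - 1\<bar> < 1" "\<bar>1 - e\<bar> < 1"
    proof -
      have "0 < (1 - e) * a" "(1 - e) * a \<le> 1" using False x e by (auto simp: mult_le_one)
      then show "\<bar>(1 - e) * a - 1\<bar> < 1" by linarith
      show "\<bar>1 - e\<bar> < 1" using e by auto
    qed
    ultimately show ?thesis using open_sq by metis
  qed
  moreover have "N (v - x) < 1"
  proof -
    have "v - x = - (p + e *\<^sub>R x)" by (simp add: v_def)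
    then have "N (v - x) \<le> N p + e * N x" using minkowski_triangle[of p "e *\<^sub>R x"] e by (simp only: minkowski_minus minkowski_scale)
    then show ?thesis using x(4) e by simp
  qed
  moreover have "cross2 x v = cross2 p q"
    by (simp add: v_def cross2_algebra x(1) cross2_swap[of q p])
  ultimately show ?thesis using that by blast
qed

text \<open>A chord parallel to \<open>x\<close> of the same length and with interior endpoints can be
  moved outwards, so the extremal inscribed chord has strictly larger determinant than
  \<open>y\<close>.\<close>

lemma row_meets_body_of_chord:
  assumes x: "N x = 1" and v: "N v < 1" "N (v - x) < 1" and y: "0 < cross2 x y" "cross2 x y \<le> \<bar>cross2 x v\<bar>"
  shows "\<exists>m::int. N (y + of_int m *\<^sub>R x) < 1"
proof -
  have key: ?thesis if v: "N v < 1" "N (v - x) < 1" and y: "cross2 x y \<le> cross2 x v" for v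
  proof -
    obtain w where w: "hexad x w" "cross2 x w > 0"
      "\<And>v. N v \<le> 1 \<Longrightarrow> N (v - x) \<le> 1 \<Longrightarrow> cross2 x v \<le> cross2 x w"
      using exists_hexad[OF x] by metis
    define d where "d = min (1 - N v) (1 - N (v - x))"
    have d: "d > 0" "d \<le> 1 - N v" "d \<le> 1 - N (v - x)" using v by (simp_all add: d_def)
    have dv: "d * N v \<le> d" using d v by (simp add: mult_left_le)
    have "N (v + d *\<^sub>R v) \<le> N v + d * N v" using minkowski_triangle[of v "d *\<^sub>R v"] d by (simp add: minkowski_scale)
    moreover have "N (v - x + d *\<^sub>R v) \<le> N (v - x) + d * N v"
      using minkowski_triangle[of "v - x" "d *\<^sub>R v"] d by (simp add: minkowski_scale)
    moreover have "N (v + d *\<^sub>R v - x) = N (v - x + d *\<^sub>R v)" by (simp add: algebra_simps)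
    ultimately have "N (v + d *\<^sub>R v) \<le> 1" "N (v + d *\<^sub>R v - x) \<le> 1" using d dv by linarith+
    then have "cross2 x (v + d *\<^sub>R v) \<le> cross2 x w" by (rule w(3))
    moreover have "0 < d * cross2 x v" using d assms(4) y by (intro mult_pos_pos) auto
    ultimately have "cross2 x v < cross2 x w" by (simp add: cross2_algebra)
    then show ?thesis using row_meets_body[OF w(1) assms(4)] y by simp
  qed
  show ?thesis
  proof (cases "cross2 x v \<ge> 0")
    case True then show ?thesis using key[OF v] y by simp
  next
    case False
    have "N (x - v) < 1" "N (x - v - x) < 1" using v by (simp_all add: minkowski_minus_commute[of x v])
    then show ?thesis using key[of "x - v"] False y by (simp add: cross2_algebra)
  qed
qed

end

text \<open>Normalise \<open>H\<close> to the unit square. A point of \<open>K\<close> with first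
  coordinate of modulus at least \<open>1\<close> makes both open vertical sides of the square interior
  to \<open>K\<close>. A critical lattice of \<open>K\<close> is also critical for \<open>H\<close>,
  hence contains a boundary point \<open>x\<close> of the square, which must now lie on a horizontal
  side. Parallel to \<open>x\<close> there is a chord of \<open>K\<close> with interior endpoints at
  determinant \<open>\<bar>cross2 p q\<bar> \<ge> \<Delta>\<close>, and the next row of the lattice
  enters \<open>K\<close>.\<close>

lemma no_overhang:
  assumes K: "bcs_domain K" and H: "bcs_domain H" "H \<subseteq> K" "critical_determinant H = critical_determinant K"
    and nz: "cross2 p q \<noteq> 0" and sq: "\<And>X Y. X *\<^sub>R p + Y *\<^sub>R q \<in> H \<longleftrightarrow> \<bar>X\<bar> < 1 \<and> \<bar>Y\<bar> < 1"
    and z: "X *\<^sub>R p + Y *\<^sub>R q \<in> K"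
  shows "\<bar>X\<bar> < 1"
proof (rule ccontr)
  assume "\<not> \<bar>X\<bar> < 1"
  interpret K: bcs K by unfold_locales fact
  interpret H: bcs H by unfold_locales fact
  have open_sq: "K.N (X *\<^sub>R p + Y *\<^sub>R q) < 1" if "\<bar>X\<bar> < 1" "\<bar>Y\<bar> < 1" for X Y
    using sq[of X Y] that H(2) K.mem_H_iff by blast
  have closed_sq: "K.N (X *\<^sub>R p + Y *\<^sub>R q) \<le> 1" if XY: "\<bar>X\<bar> \<le> 1" "\<bar>Y\<bar> \<le> 1" for X Y
  proof (rule field_le_mult_one_interval)
    fix s :: real assume s: "0 < s" "s < 1"
    have "\<bar>s * X\<bar> < 1" "\<bar>s * Y\<bar> < 1"
      using XY s by (simp_all add: abs_mult) (smt (verit) mult_left_le)+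
    then have "K.N (s *\<^sub>R (X *\<^sub>R p + Y *\<^sub>R q)) < 1" using open_sq[of "s * X" "s * Y"] by (simp add: scaleR_add_right)
    then show "s * K.N (X *\<^sub>R p + Y *\<^sub>R q) \<le> 1" using s by (simp add: K.minkowski_scale)
  qed
  have side: "K.N (p + t *\<^sub>R q) < 1" if t: "\<bar>t\<bar> < 1" for t
  proof -
    have "\<exists>X Y. X *\<^sub>R p + Y *\<^sub>R q \<in> K \<and> X \<ge> 1"
    proof (cases "X \<ge> 1")
      case True then show ?thesis using z by blast
    next
      case False
      then have "- X \<ge> 1" using \<open>\<not> \<bar>X\<bar> < 1\<close> by auto
      moreover have "(- X) *\<^sub>R p + (- Y) *\<^sub>R q \<in> K" using K.uminus_H[OF z] by simp
      ultimately show ?thesis by blast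
    qed
    then obtain X Y where z: "X *\<^sub>R p + Y *\<^sub>R q \<in> K" and X: "X \<ge> 1" by blast
    \<comment> \<open>A weight so small that the remaining part \<open>w\<close> of the convex combination stays in the closed square.\<close>
    define l where "l = (1 - \<bar>t\<bar>) / (1 + X + \<bar>Y\<bar>)"
    have den: "1 + X + \<bar>Y\<bar> > 1" using X by simp
    have l: "0 < l" "l * (1 + X + \<bar>Y\<bar>) = 1 - \<bar>t\<bar>" using t den by (simp_all add: l_def)
    have lX: "l \<le> l * X" using l(1) X by simp
    have lY: "l * \<bar>Y\<bar> \<ge> 0" using l(1) by simp
    have sum: "l + l * X + l * \<bar>Y\<bar> = 1 - \<bar>t\<bar>" using l(2) by (simp add: algebra_simps)
    have l1: "l < 1" using lX lY sum l(1) by linarith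
    define w where "w = ((1 - l * X) / (1 - l)) *\<^sub>R p + ((t - l * Y) / (1 - l)) *\<^sub>R q"
    have "\<bar>l * Y\<bar> = l * \<bar>Y\<bar>" using l(1) by (simp add: abs_mult)
    then have "\<bar>t - l * Y\<bar> \<le> 1 - l" "\<bar>1 - l * X\<bar> \<le> 1 - l" using sum lX lY l(1) by linarith+
    then have "\<bar>(1 - l * X) / (1 - l)\<bar> \<le> 1" "\<bar>(t - l * Y) / (1 - l)\<bar> \<le> 1" using l1 by simp_all
    then have Nw: "K.N w \<le> 1" unfolding w_def by (rule closed_sq)
    have "(1 - l) *\<^sub>R w = (1 - l * X) *\<^sub>R p + (t - l * Y) *\<^sub>R q" using l1 by (simp add: w_def scaleR_add_right)
    then have "p + t *\<^sub>R q = l *\<^sub>R (X *\<^sub>R p + Y *\<^sub>R q) + (1 - l) *\<^sub>R w" by (simp add: algebra_simps)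
    then have "K.N (p + t *\<^sub>R q) \<le> l * K.N (X *\<^sub>R p + Y *\<^sub>R q) + (1 - l) * K.N w"
      using K.minkowski_combination[of l "1 - l"] l(1) l1 by simp
    also have "\<dots> < l * 1 + (1 - l) * 1"
      using l(1) l1 Nw z K.mem_H_iff by (intro add_less_le_mono mult_strict_left_mono mult_left_mono) auto
    finally show ?thesis by simp
  qed
  have le: "K.\<Delta> \<le> \<bar>cross2 p q\<bar>"
  proof -
    have "z = 0" if z: "z \<in> lat p q" "z \<in> H" for z
    proof -
      obtain m n where mn: "z = of_int m *\<^sub>R p + of_int n *\<^sub>R q" using z(1) by (rule latE)
      then have "\<bar>of_int m :: real\<bar> < 1" "\<bar>of_int n :: real\<bar> < 1" using sq z(2) by blast+
      then have "m = 0" "n = 0" by simp_all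
      then show ?thesis using mn by simp
    qed
    then have "admissible H (lat p q)"
      using is_lattice_lat[OF nz] zero_in_lat[of p q] H.zero_in_H unfolding admissible_def by blast
    then show ?thesis using H.critical_determinant_le_covolume covolume_lat[OF nz] H(3) by metis
  qed
  obtain b d where "K.critical_hexad b d" by (rule K.exists_critical_hexad)
  define L where "L = lat b d"
  have L: "admissible K L" "covolume L = K.\<Delta>"
    using K.critical_hexad_lattice_critical[OF \<open>K.critical_hexad b d\<close>] by (auto simp: critical_locus_def L_def)
  then have "L \<in> critical_locus H"
    using H H.zero_in_H zero_in_lat by (auto simp: critical_locus_def admissible_def L_def)
  then obtain x y where xy: "L = lat x y" "cross2 x y = H.\<Delta>" "H.N x = 1"
    using H.critical_basis by metis
  have K1: "1 \<le> K.N z" if "z \<in> L" "z \<noteq> 0" for z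
    using L(1) that K.mem_H_iff unfolding admissible_def by fastforce
  have x0: "x \<noteq> 0" using xy(3) by auto
  have Kx: "K.N x = 1"
    using K1[of x] gens_in_lat[of x y] x0 minkowski_antimono[OF K H(1,2), of x] xy by auto
  obtain X Y where x: "x = X *\<^sub>R p + Y *\<^sub>R q" using cross2_cramer[OF nz] by blast
  have bounds: "\<bar>X\<bar> \<le> 1 \<and> \<bar>Y\<bar> \<le> 1"
  proof -
    have "\<bar>s * X\<bar> < 1 \<and> \<bar>s * Y\<bar> < 1" if s: "0 < s" "s < 1" for s
    proof -
      have "s *\<^sub>R x \<in> H" using s xy(3) by (simp add: H.mem_H_iff H.minkowski_scale)
      then show ?thesis using sq[of "s * X" "s * Y"] by (simp add: x scaleR_add_right)
    qed
    then have "s * \<bar>X\<bar> \<le> 1 \<and> s * \<bar>Y\<bar> \<le> 1" if "0 < s" "s < 1" for s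
      using that by (force simp: abs_mult)
    then show ?thesis by (blast intro: field_le_mult_one_interval)
  qed
  have Y1: "\<bar>Y\<bar> = 1"
  proof (rule ccontr)
    assume "\<bar>Y\<bar> \<noteq> 1"
    then have Y: "\<bar>Y\<bar> < 1" using bounds by simp
    have "x \<notin> H" using xy(3) H.mem_H_iff by simp
    then have "\<bar>X\<bar> = 1" using sq[of X Y] Y bounds by (auto simp: x)
    then consider "X = 1" | "X = -1" by linarith
    then show False
    proof cases
      case 1 then show ?thesis using side[OF Y] Kx by (simp add: x)
    next
      case 2
      then have "x = - (p + (- Y) *\<^sub>R q)" by (simp add: x)
      then show ?thesis using side[of "- Y"] Y Kx by (simp only: K.minkowski_minus) simp
    qed
  qed
  \<comment> \<open>Reflecting both coordinates puts \<open>x\<close> on the upper side of the square, in its right half.\<close>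
  define s :: real where "s = (if X \<ge> 0 then 1 else -1)"
  have s: "s * s = 1" "\<bar>s\<bar> = 1" "X = \<bar>X\<bar> * s" by (auto simp: s_def)
  have Ys: "Y * Y = 1" using Y1 by (metis abs_mult_self_eq mult_1)
  obtain v where v: "K.N v < 1" "K.N (v - x) < 1" "cross2 x v = cross2 (s *\<^sub>R p) (Y *\<^sub>R q)"
  proof (rule K.overhanging_chord[of "s *\<^sub>R p" "Y *\<^sub>R q" x "\<bar>X\<bar>"])
    show "K.N (X' *\<^sub>R s *\<^sub>R p + Y' *\<^sub>R Y *\<^sub>R q) < 1" if "\<bar>X'\<bar> < 1" "\<bar>Y'\<bar> < 1" for X' Y'
      using open_sq[of "X' * s" "Y' * Y"] that s Y1 by (simp add: abs_mult)
    show "K.N (s *\<^sub>R p + t *\<^sub>R Y *\<^sub>R q) < 1" if "\<bar>t\<bar> < 1" for t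
    proof -
      have "s *\<^sub>R p + t *\<^sub>R Y *\<^sub>R q = s *\<^sub>R (p + (s * t * Y) *\<^sub>R q)" using s(1) by (simp add: scaleR_add_right mult.assoc[symmetric])
      then have "K.N (s *\<^sub>R p + t *\<^sub>R Y *\<^sub>R q) = K.N (p + (s * t * Y) *\<^sub>R q)" using s(2) by (simp only: K.minkowski_scale)
      then show ?thesis using side[of "s * t * Y"] that s Y1 by (simp add: abs_mult)
    qed
    show "x = \<bar>X\<bar> *\<^sub>R s *\<^sub>R p + Y *\<^sub>R q" using s(3) by (simp add: x)
    show "\<bar>X\<bar> \<le> 1" using bounds by simp
  qed (use Kx in auto)
  have "\<bar>cross2 x v\<bar> = \<bar>cross2 p q\<bar>" using v(3) s(2) Y1 by (simp add: cross2_algebra abs_mult)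
  then have "\<exists>m::int. K.N (y + of_int m *\<^sub>R x) < 1"
    using le xy(2) H(3) K.critical_determinant_pos by (intro K.row_meets_body_of_chord[OF Kx v(1,2)]) auto
  then obtain m :: int where m: "K.N (y + of_int m *\<^sub>R x) < 1" by blast
  have "y + of_int m *\<^sub>R x \<in> L" using lat_mem[of m x 1 y] by (simp add: xy(1) add.commute)
  moreover have "cross2 x (y + of_int m *\<^sub>R x) \<noteq> 0" using xy(2) H.critical_determinant_pos by (simp add: cross2_algebra)
  then have "y + of_int m *\<^sub>R x \<noteq> 0" using cross2_nonzero by blast
  ultimately show False using K1 m by fastforce
qed

text \<open>So shrinking a domain without changing its critical determinant never produces a
  parallelogram strictly inside it.\<close>

lemma parallelogram_if_contains_parallelogram:
  assumes K: "bcs_domain K" and H: "bcs_domain H" "H \<subseteq> K" "critical_determinant H = critical_determinant K"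
    and P: "parallelogram H"
  shows "parallelogram K"
proof -
  obtain p q where nz: "cross2 p q \<noteq> 0" and sq: "\<And>X Y. X *\<^sub>R p + Y *\<^sub>R q \<in> H \<longleftrightarrow> \<bar>X\<bar> < 1 \<and> \<bar>Y\<bar> < 1"
    using parallelogramE[OF H(1) P] by blast
  have "K \<subseteq> H"
  proof
    fix z assume z: "z \<in> K"
    obtain X Y where XY: "z = X *\<^sub>R p + Y *\<^sub>R q" using cross2_cramer[OF nz] by blast
    have nz': "cross2 q p \<noteq> 0" using nz cross2_swap[of q p] by simp
    have sq': "X *\<^sub>R q + Y *\<^sub>R p \<in> H \<longleftrightarrow> \<bar>X\<bar> < 1 \<and> \<bar>Y\<bar> < 1" for X Y
      using sq[of Y X] by (auto simp: add.commute)
    have "\<bar>X\<bar> < 1" by (rule no_overhang[OF K H nz sq]) (use z XY in simp)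
    moreover have "\<bar>Y\<bar> < 1" by (rule no_overhang[OF K H nz' sq']) (use z XY in \<open>simp add: add.commute\<close>)
    ultimately show "z \<in> H" using sq XY by simp
  qed
  then show ?thesis using P H(2) by auto
qed

section \<open>Embedding the critical locus into a circle\<close>

theorem corollary1p7:
  fixes K :: "(real^2) set"
  assumes "bcs_domain K" and "\<not> parallelogram K"
  shows "\<exists>H. irreducible_domain H \<and> \<not> parallelogram H \<and>
    subtopology lattice_space (critical_locus H) homeomorphic_space
      top_of_set (sphere (0 :: real^2) 1) \<and>
    closedin (subtopology lattice_space (critical_locus H)) (critical_locus K)"
proof -
  obtain H where H: "irreducible_domain H" "H \<subseteq> K" "critical_determinant H = critical_determinant K"
    using exists_irreducible_subdomain[OF assms(1)] by blast
  have bH: "bcs_domain H" using H(1) by (simp add: irreducible_domain_def)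
  have np: "\<not> parallelogram H"
    using parallelogram_if_contains_parallelogram[OF assms(1) bH H(2,3)] assms(2) by blast
  interpret K: bcs K by unfold_locales fact
  interpret H: bcs_nonparallelogram H by unfold_locales fact+
  have "x \<in> H.critical_points" if "H.N x = 1" for x
    using H.irreducible_all_critical[OF H(1) that] H.critical_hexad_in_critical_points by blast
  then have circle: "subtopology lattice_space (critical_locus H) homeomorphic_space top_of_set (sphere (0 :: real^2) 1)"
    by (rule H.critical_locus_circle)
  have "admissible H L" if "admissible K L" for L
    using that H(2) H.zero_in_H by (auto simp: admissible_def)
  then have "critical_locus K = critical_locus H \<inter> {L. admissible K L}"
    using H(3) by (auto simp: critical_locus_def)
  then have "closedin (subtopology lattice_space (critical_locus H)) (critical_locus K)"
    using closedin_subtopology_Int_closed[OF closedin_admissible[OF assms(1)]] by metis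
  then show ?thesis using H(1) np circle by blast
qed

end
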